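(* Let $N\geqslant1$ and $m\geqslant1$, and write $N=2n+1$ or $N=2n$. The following relations hold in the extended Yangian $\mathrm{X}(\mathfrak{osp}_{N|2m})$: $$c(u)=\prod_{i=1}^m\frac{h_i(u+i-1)}{h_i(u+i)}\;\prod_{j=1}^n\frac{h_{m+j}(u+m-j+1)}{h_{m+j}(u+m-j)}\;\times h_{m+n+1}(u+m-n+1/2)\,h_{m+n+1}(u+m-n)$$ for $N=2n+1$, and $$c(u)=\prod_{i=1}^m\frac{h_i(u+i-1)}{h_i(u+i)}\;\prod_{j=1}^{n-1}\frac{h_{m+j}(u+m-j+1)}{h_{m+j}(u+m-j)}\;\times h_{m+n}(u+m-n+1)\,h_{m+n+1}(u+m-n+1)$$ for $N=2n$.
   Context: All algebras are over $\mathbb{C}$. Put $i'=N+2m-i+1$ for $i\in\{1,\dots,N+2m\}$; parity $\bar i=1$ for $i=1,\dots,m,m',\dots,1'$ and $\bar i=0$ for $i=m+1,\dots,(m+1)'$; $\theta_i=1$ for $i=1,\dots,N+m$ and $\theta_i=-1$ for $i=N+m+1,\dots,N+2m$. Let $\mathbb{C}^{N|2m}$ be the superspace with basis $e_1,\dots,e_{N+2m}$, $e_i$ of parity $\bar i$, and $e_{ij}$ the matrix units, of parity $\bar i+\bar j$. Tensor products of superalgebras are taken with the rule $(a\otimes b)(c\otimes d)=ac\otimes bd\,(-1)^{p(b)p(c)}$. Set $P=\sum_{i,j}e_{ij}\otimes e_{ji}(-1)^{\bar j}$, $Q=\sum_{i,j}e_{ij}\otimes e_{i'j'}(-1)^{\bar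 i\bar j}\theta_i\theta_j$, $\kappa=N/2-m-1$ and $R(u)=1-\frac{P}{u}+\frac{Q}{u-\kappa}$. The extended Yangian $\mathrm{X}(\mathfrak{osp}_{N|2m})$ is the superalgebra with generators $t_{ij}^{(r)}$ of parity $\bar i+\bar j$ mod $2$ ($1\leqslant i,j\leqslant N+2m$, $r\geqslant 1$) and defining relations $$R(u-v)\,T_1(u)\,T_2(v)=T_2(v)\,T_1(u)\,R(u-v)$$ where $t_{ij}(u)=\delta_{ij}+\sum_{r\geqslant1}t_{ij}^{(r)}u^{-r}$, $T_1(u)=\sum_{i,j}e_{ij}\otimes1\otimes t_{ij}(u)(-1)^{\bar i\bar j+\bar j}$, $T_2(u)=\sum_{i,j}1\otimes e_{ij}\otimes t_{ij}(u)(-1)^{\bar i\bar j+\bar j}$ (identity of formal series after clearing denominators of $R(u-v)$). Let $T(u)=[t_{ij}(u)]$, and define the super-transpose of a matrix $A=[a_{ij}]$ by $(A^t)_{ij}=a_{j'i'}(-1)^{\bar i\bar j+\bar j}\theta_i\theta_j$. It is known that $T(u-\kappa)\,T^{t}(u)=c(u)\,1$ (usual matrix multiplication) for a series $c(u)\in1+u^{-1}\mathrm{X}(\mathfrak{osp}_{N|2m})[[u^{-1}]]$ whose coefficients are central; this defines $c(u)$. Let $T(u)=F(u)H(u)E(u)$ be the Gauss decomposition, with $F(u)$ lower unitriangular, $H(u)=\mathrm{diag}[h_1(u),\dots,h_{1'}(u)]$ diagonal and $E(u)$ upper unitriangular (uniquely determined); this defines the series $h_i(u)\in 1+u^{-1}\mathrm{X}(\mathfrak{osp}_{N|2m})[[u^{-1}]]$.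 The coefficients of all series $h_i(u)$ pairwise commute, so the order of factors in the products is immaterial and fractions are unambiguous. *)

theory Defs
  imports Complex_Main
    "HOL-Library.Poly_Mapping"
    "HOL-Library.Cardinality"
    "HOL-Computational_Algebra.Formal_Power_Series"
begin

text \<open>
  Conventions.  A formal series in \<open>u\<^sup>-\<^sup>1\<close> is an \<open>fps\<close> in the variable \<open>x = u\<^sup>-\<^sup>1\<close>; a formal
  series in \<open>u\<^sup>-\<^sup>1\<close> and \<open>v\<^sup>-\<^sup>1\<close> is an \<open>fps fps\<close> whose inner variable is \<open>x = u\<^sup>-\<^sup>1\<close> and whose
  outer variable is \<open>y = v\<^sup>-\<^sup>1\<close>.  Matrices are functions on pairs of indices from \<open>{1..N + 2 * m}\<close>;
  values outside of this range are never used.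
\<close>

definition dual :: "nat \<Rightarrow> nat \<Rightarrow> nat \<Rightarrow> nat" where
  "dual N m i = N + 2 * m + 1 - i"

definition par :: "nat \<Rightarrow> nat \<Rightarrow> nat \<Rightarrow> nat" where
  "par N m i = (if i \<le> m \<or> N + m < i then 1 else 0)"

definition theta :: "nat \<Rightarrow> nat \<Rightarrow> nat \<Rightarrow> 'a::ring_1" where
  "theta N m i = (if i \<le> N + m then 1 else - 1)"

definition kappa :: "nat \<Rightarrow> nat \<Rightarrow> complex" where
  "kappa N m = of_nat N / 2 - of_nat m - 1"

text \<open>
  The function \<open>X\<close> stands for the element
  \<open>\<Sum>i j k l. e\<^bsub>ij\<^esub> \<otimes> e\<^bsub>kl\<^esub> \<otimes> X i j k l\<close>.
\<close>

type_synonym 'a tens = "nat \<Rightarrow> nat \<Rightarrow> nat \<Rightarrow> nat \<Rightarrow> 'a"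

text \<open>
  Here \<open>\<sigma>\<close> is the parity automorphism of \<open>A\<close>, i.e. \<open>\<sigma> a = (-1)\<^bsup>p(a)\<^esup> a\<close> for homogeneous \<open>a\<close>.
  In the product of \<open>e\<^bsub>ij\<^esub> \<otimes> e\<^bsub>kl\<^esub> \<otimes> a\<close> and \<open>e\<^bsub>jq\<^esub> \<otimes> e\<^bsub>ls\<^esub> \<otimes> b\<close> the factor \<open>e\<^bsub>jq\<^esub>\<close> moves past
  \<open>e\<^bsub>kl\<^esub>\<close> and \<open>a\<close>, and the factor \<open>e\<^bsub>ls\<^esub>\<close> moves past \<open>a\<close>.
\<close>

definition tens_mult ::
  "nat \<Rightarrow> nat \<Rightarrow> ('a::ring_1 \<Rightarrow> 'a) \<Rightarrow> 'a tens \<Rightarrow> 'a tens \<Rightarrow> 'a tens" where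
  "tens_mult N m \<sigma> X Y = (\<lambda>i q k s. \<Sum>j\<in>{1..N + 2 * m}. \<Sum>l\<in>{1..N + 2 * m}.
     (- 1) ^ ((par N m k + par N m l) * (par N m j + par N m q))
     * (\<sigma> ^^ (par N m j + par N m q + par N m l + par N m s)) (X i j k l) * Y j q l s)"

definition tens_one :: "'a::ring_1 tens" where
  "tens_one i j k l = (if i = j \<and> k = l then 1 else 0)"

definition P_op :: "nat \<Rightarrow> nat \<Rightarrow> 'a::ring_1 tens" where
  "P_op N m i j k l = (if k = j \<and> l = i then (- 1) ^ par N m j else 0)"

definition Q_op :: "nat \<Rightarrow> nat \<Rightarrow> 'a::ring_1 tens" where
  "Q_op N m i j k l = (if k = dual N m i \<and> l = dual N m j
     then (- 1) ^ (par N m i * par N m j) * theta N m i * theta N m j else 0)"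

text \<open>
  The polynomial \<open>(x y)\<^sup>2 (u - v) (u - v - \<kappa>) R(u - v)\<close> in \<open>x = u\<^sup>-\<^sup>1\<close> and \<open>y = v\<^sup>-\<^sup>1\<close>, where
  \<open>R(u) = 1 - P / u + Q / (u - \<kappa>)\<close>.  Note that \<open>x y (u - v) = y - x\<close>.
  The argument \<open>\<kappa>\<close> is the image of the complex number \<open>kappa N m\<close> in the coefficient algebra.
\<close>

definition R_cleared :: "nat \<Rightarrow> nat \<Rightarrow> 'a::ring_1 \<Rightarrow> 'a fps fps tens" where
  "R_cleared N m \<kappa> i j k l =
    (let x = fps_const fps_X; y = fps_X;
         w = y - x;
         w' = y - x - fps_const (fps_const \<kappa>) * x * y
     in w * w' * tens_one i j k l - x * y * w' * P_op N m i j k l + x * y * w * Q_op N m i j k l)"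

definition T1_op :: "nat \<Rightarrow> nat \<Rightarrow> (nat \<Rightarrow> nat \<Rightarrow> 'a::ring_1 fps) \<Rightarrow> 'a fps fps tens" where
  "T1_op N m t i j k l =
    (if k = l then (- 1) ^ (par N m i * par N m j + par N m j) * fps_const (t i j) else 0)"

definition T2_op :: "nat \<Rightarrow> nat \<Rightarrow> (nat \<Rightarrow> nat \<Rightarrow> 'a::ring_1 fps) \<Rightarrow> 'a fps fps tens" where
  "T2_op N m t i j k l =
    (if i = j then (- 1) ^ (par N m k * par N m l + par N m l)
       * Abs_fps (\<lambda>s. fps_const (fps_nth (t k l) s)) else 0)"

definition fps_map2 :: "('a \<Rightarrow> 'b) \<Rightarrow> 'a fps fps \<Rightarrow> 'b fps fps" where
  "fps_map2 f F = Abs_fps (\<lambda>s. Abs_fps (\<lambda>r. f (fps_nth (fps_nth F s) r)))"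

text \<open>The difference of the two sides of \<open>R(u - v) T\<^sub>1(u) T\<^sub>2(v) = T\<^sub>2(v) T\<^sub>1(u) R(u - v)\<close>.\<close>

definition rtt_defect ::
  "nat \<Rightarrow> nat \<Rightarrow> 'a::ring_1 \<Rightarrow> ('a \<Rightarrow> 'a) \<Rightarrow> (nat \<Rightarrow> nat \<Rightarrow> 'a fps) \<Rightarrow> 'a fps fps tens" where
  "rtt_defect N m \<kappa> \<sigma> t i j k l =
    (let mult = tens_mult N m (fps_map2 \<sigma>);
         R = R_cleared N m \<kappa>; T1 = T1_op N m t; T2 = T2_op N m t
     in mult (mult R T1) T2 i j k l - mult (mult T2 T1) R i j k l)"

text \<open>
  \<open>N\<close> and \<open>m\<close> are the (arbitrary, positive) cardinalities of the finite types \<open>'N\<close> and \<open>'m\<close>.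
  The triple \<open>(i, j, r)\<close> is the generator \<open>t\<^bsub>ij\<^esub>\<^bsup>(r)\<^esup>\<close>.
\<close>

typedef ('N::finite, 'm::finite) gen =
  "{(i, j, r). i \<in> {1..CARD('N) + 2 * CARD('m)} \<and> j \<in> {1..CARD('N) + 2 * CARD('m)} \<and> (1::nat) \<le> r}"
proof -
  have "1 \<le> CARD('N)" by (simp add: Suc_le_eq)
  then show ?thesis by (intro exI[of _ "(1, 1, 1)"]) (simp add: trans_le_add1)
qed

datatype ('N::finite, 'm::finite) word = Word (letters: "('N, 'm) gen list")

instantiation word :: (finite, finite) monoid_add
begin

definition zero_word :: "('a, 'b) word" where
  "0 = Word []"

definition plus_word :: "('a, 'b) word \<Rightarrow> ('a, 'b) word \<Rightarrow> ('a, 'b) word" where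
  "v + w = Word (letters v @ letters w)"

instance
  by standard (simp_all add: zero_word_def plus_word_def)

end

text \<open>The monoid algebra of the free monoid of words; its product is concatenation of words.\<close>

type_synonym ('N, 'm) free_alg = "('N, 'm) word \<Rightarrow>\<^sub>0 complex"

definition free_scalar :: "complex \<Rightarrow> ('N::finite, 'm::finite) free_alg" where
  "free_scalar a = Poly_Mapping.single 0 a"

definition free_gen :: "('N::finite, 'm::finite) gen \<Rightarrow> ('N, 'm) free_alg" where
  "free_gen g = Poly_Mapping.single (Word [g]) 1"

definition gen_parity :: "('N::finite, 'm::finite) gen \<Rightarrow> nat" where
  "gen_parity g = (case Rep_gen g of (i, j, r) \<Rightarrow>
     par CARD('N) CARD('m) i + par CARD('N) CARD('m) j)"

definition word_parity :: "('N::finite, 'm::finite) word \<Rightarrow> nat" where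
  "word_parity w = sum_list (map gen_parity (letters w))"

definition free_sigma :: "('N::finite, 'm::finite) free_alg \<Rightarrow> ('N, 'm) free_alg" where
  "free_sigma f = Poly_Mapping.mapp (\<lambda>w a. (- 1) ^ word_parity w * a) f"

definition free_t :: "nat \<Rightarrow> nat \<Rightarrow> ('N::finite, 'm::finite) free_alg fps" where
  "free_t i j = Abs_fps (\<lambda>r. if r = 0 then (if i = j then 1 else 0)
     else free_gen (Abs_gen (i, j, r)))"

definition relators :: "('N::finite, 'm::finite) free_alg set" where
  "relators = {fps_nth (fps_nth
        (rtt_defect CARD('N) CARD('m) (free_scalar (kappa CARD('N) CARD('m))) free_sigma
           free_t i j k l) s) r | i j k l r s.
     {i, j, k, l} \<subseteq> {1..CARD('N) + 2 * CARD('m)}}"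

text \<open>
  The two-sided ideal generated by the relators.  It is a complex subspace, since the scalars
  \<open>free_scalar a\<close> belong to the free algebra.  The relators are homogeneous, so that the
  \<open>\<int>/2\<close>-grading passes to the quotient.
\<close>

inductive_set rel_ideal :: "('N::finite, 'm::finite) free_alg set" where
  zero: "0 \<in> rel_ideal"
| gen: "x \<in> relators \<Longrightarrow> a * x * b \<in> rel_ideal"
| add: "x \<in> rel_ideal \<Longrightarrow> y \<in> rel_ideal \<Longrightarrow> x + y \<in> rel_ideal"

lemma rel_ideal_mult: "x \<in> rel_ideal \<Longrightarrow> a * x * b \<in> rel_ideal"
proof (induction rule: rel_ideal.induct)
  case zero
  show ?case by (simp add: rel_ideal.zero)
next
  case (gen x c d)
  show ?case using rel_ideal.gen[OF gen, of "a * c" "d * b"] by (simp add: mult.assoc)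
next
  case (add x y)
  then show ?case using rel_ideal.add[of "a * x * b" "a * y * b"] by (simp add: algebra_simps)
qed

lemma rel_ideal_uminus: "x \<in> rel_ideal \<Longrightarrow> - x \<in> rel_ideal"
  using rel_ideal_mult[of x "- 1" 1] by simp

definition free_cong ::
  "('N::finite, 'm::finite) free_alg \<Rightarrow> ('N, 'm) free_alg \<Rightarrow> bool" where
  "free_cong x y \<longleftrightarrow> x - y \<in> rel_ideal"

lemma free_cong_equivp: "equivp free_cong"
proof (rule equivpI)
  show "reflp free_cong"
    by (simp add: reflp_def free_cong_def rel_ideal.zero)
  show "symp free_cong"
    using rel_ideal_uminus by (fastforce simp: symp_def free_cong_def)
  show "transp free_cong"
    using rel_ideal.add by (fastforce simp: transp_def free_cong_def)
qed

text \<open>The counit \<open>t\<^bsub>ij\<^esub>(u) \<mapsto> \<delta>\<^bsub>ij\<^esub>\<close> shows that the quotient is not the zero ring.\<close>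

context
begin

private definition counit :: "('N::finite, 'm::finite) free_alg \<Rightarrow> complex" where
  "counit f = Poly_Mapping.lookup f 0"

private lemma counit_add: "counit (f + g) = counit f + counit g"
  by (simp add: counit_def lookup_add)

private lemma counit_diff: "counit (f - g) = counit f - counit g"
  by (simp add: counit_def lookup_minus)

private lemma word_sum_zero: "0 = (v :: ('N::finite, 'm::finite) word) + w \<longleftrightarrow> v = 0 \<and> w = 0"
  by (cases v; cases w) (auto simp: zero_word_def plus_word_def)

private lemma counit_mult: "counit (f * g) = counit f * counit g"
proof -
  have "counit (f * g) = (\<Sum>l. Poly_Mapping.lookup f l *
      (\<Sum>q. Poly_Mapping.lookup g q when l = 0 \<and> q = 0))"
    by (simp add: counit_def lookup_mult word_sum_zero)
  also have "\<dots> = (\<Sum>l. (Poly_Mapping.lookup f l * Poly_Mapping.lookup g 0) when l = 0)"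
  proof (rule arg_cong[where f = Sum_any], rule ext)
    fix l
    show "Poly_Mapping.lookup f l * (\<Sum>q. Poly_Mapping.lookup g q when l = 0 \<and> q = 0)
        = (Poly_Mapping.lookup f l * Poly_Mapping.lookup g 0 when l = 0)"
      by (cases "l = 0") simp_all
  qed
  also have "\<dots> = counit f * counit g"
    by (simp add: counit_def)
  finally show ?thesis .
qed

private lemma counit_zero [simp]: "counit 0 = 0"
  by (simp add: counit_def)

private lemma counit_one [simp]: "counit 1 = 1"
  by (simp add: counit_def)

private lemma counit_sum: "counit (sum f A) = (\<Sum>x\<in>A. counit (f x))"
  by (induction A rule: infinite_finite_induct) (simp_all add: counit_add)

private lemma counit_sigma: "counit (free_sigma f) = counit f"
  by (auto simp: counit_def free_sigma_def lookup_mapp word_parity_def zero_word_def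
      when_def in_keys_iff)

private abbreviation "eps \<equiv> fps_map2 counit"

private lemma eps_nth: "fps_nth (fps_nth (eps F) s) r = counit (fps_nth (fps_nth F s) r)"
  by (simp add: fps_map2_def)

private lemma eps_eqI: "(\<And>s r. fps_nth (fps_nth F s) r = fps_nth (fps_nth G s) r) \<Longrightarrow> F = G"
  by (simp add: fps_ext)

private lemma eps_diff: "eps (F - G) = eps F - eps G"
  by (rule eps_eqI) (simp add: eps_nth counit_diff)

private lemma eps_zero [simp]: "eps 0 = 0"
  by (rule eps_eqI) (simp add: eps_nth)

private lemma eps_add: "eps (F + G) = eps F + eps G"
  by (rule eps_eqI) (simp add: eps_nth counit_add)

private lemma eps_mult: "eps (F * G) = eps F * eps G"
  by (rule eps_eqI)
    (simp add: eps_nth fps_mult_nth fps_sum_nth counit_sum counit_mult)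

private lemma eps_one [simp]: "eps 1 = 1"
  by (rule eps_eqI) (simp add: eps_nth)

private lemma eps_sum: "eps (sum f A) = (\<Sum>x\<in>A. eps (f x))"
  by (induction A rule: infinite_finite_induct) (simp_all add: eps_add)

private lemma eps_uminus: "eps (- F) = - eps F"
  using eps_diff[of 0 F] by simp

private lemma eps_sign: "eps ((- 1) ^ n) = (- 1) ^ n"
  by (induction n) (simp_all add: eps_uminus)

private lemma eps_sigma1: "eps (fps_map2 free_sigma F) = eps F"
  by (rule eps_eqI) (simp add: fps_map2_def counit_sigma)

private lemma eps_sigma: "eps ((fps_map2 free_sigma ^^ n) F) = eps F"
  by (induction n) (simp_all add: eps_sigma1)

private lemma eps_tens_mult:
  "eps (tens_mult N m (fps_map2 free_sigma) X Y i q k s) =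
   tens_mult N m id (\<lambda>i j k l. eps (X i j k l)) (\<lambda>i j k l. eps (Y i j k l)) i q k s"
  by (simp add: tens_mult_def eps_sum eps_mult eps_sign eps_sigma)

private lemma tens_mult_one_right:
  assumes "q \<in> {1..N + 2 * m}" "s \<in> {1..N + 2 * m}"
  shows "tens_mult N m id X tens_one i q k s = X i q k s"
proof -
  have "tens_mult N m id X tens_one i q k s =
     (\<Sum>j\<in>{1..N + 2 * m}. if j = q then (\<Sum>l\<in>{1..N + 2 * m}. if l = s then
     (- 1) ^ ((par N m k + par N m l) * (par N m j + par N m q)) * X i j k l else 0) else 0)"
    unfolding tens_mult_def
    by (intro sum.cong[OF refl], split if_split, intro conjI impI sum.cong[OF refl] sum.neutral)
      (auto simp: tens_one_def)
  also have "\<dots> = (- 1) ^ ((par N m k + par N m s) * (par N m q + par N m q)) * X i q k s"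
    using assms by simp
  also have "\<dots> = X i q k s"
    by simp
  finally show ?thesis .
qed

private lemma tens_mult_one_left:
  assumes "i \<in> {1..N + 2 * m}" "k \<in> {1..N + 2 * m}"
  shows "tens_mult N m id tens_one X i q k s = X i q k s"
proof -
  have "tens_mult N m id tens_one X i q k s =
     (\<Sum>j\<in>{1..N + 2 * m}. if j = i then (\<Sum>l\<in>{1..N + 2 * m}. if l = k then
     (- 1) ^ ((par N m k + par N m l) * (par N m j + par N m q)) * X j q l s else 0) else 0)"
    unfolding tens_mult_def
    by (intro sum.cong[OF refl], split if_split, intro conjI impI sum.cong[OF refl] sum.neutral)
      (auto simp: tens_one_def)
  also have "\<dots> = (- 1) ^ ((par N m k + par N m k) * (par N m i + par N m q)) * X i q k s"
    using assms by simp
  also have "\<dots> = X i q k s"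
    by simp
  finally show ?thesis .
qed

private lemma counit_free_gen: "counit (free_gen g) = 0"
  by (simp add: free_gen_def counit_def lookup_single zero_word_def)

private lemma counit_free_t: "counit (fps_nth (free_t i j) r) = (if r = 0 \<and> i = j then 1 else 0)"
  by (simp add: free_t_def counit_free_gen)

private lemma eps_t1: "eps (fps_const (free_t i j)) = (if i = j then 1 else 0)"
  by (rule eps_eqI) (simp add: eps_nth counit_free_t)

private lemma eps_T1: "eps (T1_op N m free_t i j k l) = tens_one i j k l"
  by (simp add: T1_op_def tens_one_def eps_mult eps_sign eps_t1)

private lemma eps_t2:
  "eps (Abs_fps (\<lambda>s. fps_const (fps_nth (free_t k l) s))) = (if k = l then 1 else 0)"
  by (rule eps_eqI) (simp add: eps_nth counit_free_t)

private lemma eps_T2: "eps (T2_op N m free_t i j k l) = tens_one i j k l"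
  by (simp add: T2_op_def tens_one_def eps_mult eps_sign eps_t2)

private lemma tens_mult_cong:
  assumes "\<And>j l. j \<in> {1..N + 2 * m} \<Longrightarrow> l \<in> {1..N + 2 * m} \<Longrightarrow> X i j k l = X' i j k l"
    and "\<And>j l. j \<in> {1..N + 2 * m} \<Longrightarrow> l \<in> {1..N + 2 * m} \<Longrightarrow> Y j q l s = Y' j q l s"
  shows "tens_mult N m id X Y i q k s = tens_mult N m id X' Y' i q k s"
  unfolding tens_mult_def using assms by (intro sum.cong refl) simp

private lemma counit_relator:
  fixes x :: "('N::finite, 'm::finite) free_alg"
  assumes "x \<in> relators"
  shows "counit x = 0"
proof -
  from assms obtain i j k l r s where
    x: "x = fps_nth (fps_nth (rtt_defect CARD('N) CARD('m)
        (free_scalar (kappa CARD('N) CARD('m))) free_sigma free_t i j k l) s) r"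
    and ind: "i \<in> {1..CARD('N) + 2 * CARD('m)}" "j \<in> {1..CARD('N) + 2 * CARD('m)}"
      "k \<in> {1..CARD('N) + 2 * CARD('m)}" "l \<in> {1..CARD('N) + 2 * CARD('m)}"
    unfolding relators_def by blast
  let ?N = "CARD('N)" and ?m = "CARD('m)"
  let ?R = "\<lambda>i j k l. eps (R_cleared ?N ?m
    (free_scalar (kappa ?N ?m) :: ('N, 'm) free_alg) i j k l)"
  have "eps (rtt_defect ?N ?m (free_scalar (kappa ?N ?m)) free_sigma
      (free_t :: _ \<Rightarrow> _ \<Rightarrow> ('N, 'm) free_alg fps) i j k l) =
      tens_mult ?N ?m id (tens_mult ?N ?m id ?R tens_one) tens_one i j k l
      - tens_mult ?N ?m id (tens_mult ?N ?m id tens_one tens_one) ?R i j k l"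
    unfolding rtt_defect_def Let_def
    by (simp add: eps_diff eps_tens_mult eps_T1 eps_T2)
  also have "tens_mult ?N ?m id (tens_mult ?N ?m id ?R tens_one) tens_one i j k l = ?R i j k l"
    using ind by (simp add: tens_mult_one_right del: atLeastAtMost_iff)
  also have "tens_mult ?N ?m id (tens_mult ?N ?m id tens_one tens_one) ?R i j k l =
      tens_mult ?N ?m id tens_one ?R i j k l"
    using ind by (intro tens_mult_cong refl tens_mult_one_right) auto
  also have "\<dots> = ?R i j k l"
    using ind by (simp add: tens_mult_one_left del: atLeastAtMost_iff)
  finally show "counit x = 0"
    by (simp add: x flip: eps_nth)
qed

private lemma counit_rel_ideal: "x \<in> rel_ideal \<Longrightarrow> counit x = 0"
  by (induction rule: rel_ideal.induct)
    (simp_all add: counit_relator counit_mult counit_add)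

lemma one_notin_rel_ideal: "1 \<notin> rel_ideal"
  using counit_rel_ideal[of 1] by auto

end

quotient_type (overloaded) ('N, 'm) ext_yangian =
  "('N::finite, 'm::finite) free_alg" / free_cong
  by (rule free_cong_equivp)

instantiation ext_yangian :: (finite, finite) ring_1
begin

lift_definition zero_ext_yangian :: "('a, 'b) ext_yangian" is 0 .

lift_definition one_ext_yangian :: "('a, 'b) ext_yangian" is 1 .

lift_definition plus_ext_yangian ::
  "('a, 'b) ext_yangian \<Rightarrow> ('a, 'b) ext_yangian \<Rightarrow> ('a, 'b) ext_yangian" is "(+)"
  using rel_ideal.add by (fastforce simp: free_cong_def algebra_simps)

lift_definition uminus_ext_yangian :: "('a, 'b) ext_yangian \<Rightarrow> ('a, 'b) ext_yangian" is uminus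
  using rel_ideal_uminus by (fastforce simp: free_cong_def)

lift_definition minus_ext_yangian ::
  "('a, 'b) ext_yangian \<Rightarrow> ('a, 'b) ext_yangian \<Rightarrow> ('a, 'b) ext_yangian" is "(-)"
proof -
  fix x x' y y' :: "('a, 'b) free_alg"
  assume "free_cong x x'" "free_cong y y'"
  then have "(x - x') + - (y - y') \<in> rel_ideal"
    unfolding free_cong_def by (intro rel_ideal.add rel_ideal_uminus)
  then show "free_cong (x - y) (x' - y')"
    by (simp add: free_cong_def algebra_simps)
qed

lift_definition times_ext_yangian ::
  "('a, 'b) ext_yangian \<Rightarrow> ('a, 'b) ext_yangian \<Rightarrow> ('a, 'b) ext_yangian" is "(*)"
proof -
  fix x x' y y' :: "('a, 'b) free_alg"
  assume "free_cong x x'" "free_cong y y'"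
  then have "1 * (x - x') * y + x' * (y - y') * 1 \<in> rel_ideal"
    unfolding free_cong_def by (intro rel_ideal.add rel_ideal_mult)
  then show "free_cong (x * y) (x' * y')"
    by (simp add: free_cong_def algebra_simps)
qed

instance
proof
  show "(0 :: ('a, 'b) ext_yangian) \<noteq> 1"
  proof (transfer, rule notI)
    assume "free_cong (0 :: ('a, 'b) free_alg) 1"
    then have "- (0 - 1) \<in> (rel_ideal :: ('a, 'b) free_alg set)"
      unfolding free_cong_def by (rule rel_ideal_uminus)
    then show False by (simp add: one_notin_rel_ideal)
  qed
qed (transfer; simp add: free_cong_def rel_ideal.zero algebra_simps)+

end

lift_definition yangian_scalar :: "complex \<Rightarrow> ('N::finite, 'm::finite) ext_yangian" is free_scalar .

lift_definition yangian_gen ::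
  "('N::finite, 'm::finite) gen \<Rightarrow> ('N, 'm) ext_yangian" is free_gen .

definition T_mat :: "nat \<Rightarrow> nat \<Rightarrow> ('N::finite, 'm::finite) ext_yangian fps" where
  "T_mat i j = Abs_fps (\<lambda>r. if r = 0 then (if i = j then 1 else 0)
     else yangian_gen (Abs_gen (i, j, r)))"

text \<open>
  The series \<open>f(u + a)\<close>, obtained by substituting
  \<open>(u + a)\<^sup>-\<^sup>1 = x / (1 + a x) = \<Sum>n\<ge>1. (- a)\<^bsup>n-1\<^esup> x\<^sup>n\<close> for \<open>x = u\<^sup>-\<^sup>1\<close>.
\<close>

definition translate ::
  "complex \<Rightarrow> ('N::finite, 'm::finite) ext_yangian fps \<Rightarrow> ('N, 'm) ext_yangian fps" where
  "translate a f = fps_compose f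
     (Abs_fps (\<lambda>n. if n = 0 then 0 else yangian_scalar ((- a) ^ (n - 1))))"

definition mat_mult ::
  "nat \<Rightarrow> (nat \<Rightarrow> nat \<Rightarrow> 'a::ring_1) \<Rightarrow> (nat \<Rightarrow> nat \<Rightarrow> 'a) \<Rightarrow> nat \<Rightarrow> nat \<Rightarrow> 'a" where
  "mat_mult d A B i j = (\<Sum>k\<in>{1..d}. A i k * B k j)"

definition super_transpose ::
  "nat \<Rightarrow> nat \<Rightarrow> (nat \<Rightarrow> nat \<Rightarrow> 'a::ring_1) \<Rightarrow> nat \<Rightarrow> nat \<Rightarrow> 'a" where
  "super_transpose N m A i j = A (dual N m j) (dual N m i)
     * (- 1) ^ (par N m i * par N m j + par N m j) * theta N m i * theta N m j"

definition diag_mat :: "(nat \<Rightarrow> 'a::ring_1) \<Rightarrow> nat \<Rightarrow> nat \<Rightarrow> 'a" where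
  "diag_mat h i j = (if i = j then h i else 0)"

definition lower_unitriangular :: "nat \<Rightarrow> (nat \<Rightarrow> nat \<Rightarrow> 'a::ring_1) \<Rightarrow> bool" where
  "lower_unitriangular d A \<longleftrightarrow>
     (\<forall>i\<in>{1..d}. A i i = 1 \<and> (\<forall>j\<in>{1..d}. i < j \<longrightarrow> A i j = 0))"

definition upper_unitriangular :: "nat \<Rightarrow> (nat \<Rightarrow> nat \<Rightarrow> 'a::ring_1) \<Rightarrow> bool" where
  "upper_unitriangular d A \<longleftrightarrow>
     (\<forall>i\<in>{1..d}. A i i = 1 \<and> (\<forall>j\<in>{1..d}. j < i \<longrightarrow> A i j = 0))"

definition gauss_decomposition ::
  "nat \<Rightarrow> (nat \<Rightarrow> nat \<Rightarrow> 'a::ring_1) \<Rightarrow> (nat \<Rightarrow> nat \<Rightarrow> 'a) \<Rightarrow> (nat \<Rightarrow> 'a) \<Rightarrow> (nat \<Rightarrow> nat \<Rightarrow> 'a) \<Rightarrow> bool"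
  where
  "gauss_decomposition d T F h E \<longleftrightarrow>
     lower_unitriangular d F \<and> upper_unitriangular d E \<and>
     (\<forall>i\<in>{1..d}. \<forall>j\<in>{1..d}. T i j = mat_mult d (mat_mult d F (diag_mat h)) E i j)"

text \<open>
  The fraction \<open>f(u) / g(u)\<close>, for \<open>g\<close> with constant term \<open>1\<close>; the right inverse of such a \<open>g\<close>
  is also its left inverse.
\<close>

definition ser_frac :: "'a::ring_1 fps \<Rightarrow> 'a fps \<Rightarrow> 'a fps" where
  "ser_frac f g = f * fps_right_inverse g 1"

end

theory Submission
  imports Defs
begin

text \<open>
  At \<open>u - v = \<kappa>\<close> the RTT relation gives \<open>T\<^sup>t(u) T(u - \<kappa>) = c(u)\<close> in addition to
  \<open>T(u - \<kappa>) T\<^sup>t(u) = c(u)\<close>.  Let \<open>T'\<close> be the Schur complement of \<open>T\<close> with respect to \<open>t\<^sub>1\<^sub>1 = h\<^sub>1\<close>, with the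
  indices \<open>1\<close> and \<open>1'\<close> removed.  Eliminating the first column of \<open>T(u - \<kappa>)\<close> and the last row of \<open>T\<^sup>t(u)\<close>
  turns the identity into one for \<open>T'(u - \<kappa>)\<close> and the entries
  \<open>t\<^sub>a\<^sub>b(u) \<mp> t\<^sub>1\<^sub>b(u) h\<^sub>1(u)\<^sup>-\<^sup>1 t\<^sub>a\<^sub>1(u)\<close>.  The two expansions of a quantum minor show that the latter are
  \<open>h\<^sub>1(u - \<eta>)\<^sup>-\<^sup>1 h\<^sub>1(u) T'\<^sub>a\<^sub>b(u - \<eta>)\<close>, where \<open>\<eta>\<close> is \<open>-1\<close> or \<open>1\<close> according to whether the index \<open>1\<close> is odd
  or even.  Hence \<open>c(u) = h\<^sub>1(u - \<eta>)\<^sup>-\<^sup>1 h\<^sub>1(u) w\<close> with \<open>T'\<^sup>t(u - \<eta>) T'(u - \<kappa>) = w\<close>.  Only those relations enter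
  to which \<open>Q\<close> does not contribute, and they pass from \<open>T\<close> to \<open>T'\<close>; so the step can be iterated until a
  matrix of size one or two is left.  The factors appear in the order of the theorem.
\<close>

text \<open>The eliminations take place in a single ring of series in \<open>u\<close>: a matrix is
  a function of a complex number \<open>p\<close>, whose value stands for the matrix at
  \<open>u + p\<close>. Setting the two variables of the RTT relation to \<open>u + p\<close> and
  \<open>u + q\<close> turns their difference into the central scalar \<open>p - q\<close>, and each
  elimination becomes an identity between finitely many ring elements. The price is that scalars may
  vanish: the factor for \<open>u - v - \<kappa>\<close> has to be cancelled while both variables
  are free, and at \<open>p = q\<close> the relations without \<open>Q\<close> say nothing.

  The shift \<open>\<eta>\<close> comes from the part \<open>1 - P/u\<close> of the R-matrix. It is
  degenerate at \<open>u = 1\<close> and \<open>u = -1\<close>, where commutation relations lose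
  terms and quantum minors appear; the parity of the pivot selects the sign.

  Since the ring is noncommutative, every change in the order of the factors is derived: for one
  pivot at two points from its own relation, for the last two factors in the odd case from the
  commutation of \<open>c\<close> with \<open>T\<close>.\<close>

section \<open>Schur complements\<close>

text \<open>Small letters are entries at \<open>p\<close>, capital ones entries at \<open>q\<close>,
  \<open>o\<close> is the pivot index and \<open>z\<close> is \<open>p - q\<close>. The
  supercommutator with \<open>Tcd\<close> is a superderivation that sends \<open>Di\<close> to
  \<open>- Di [D, Tcd] Di\<close>; applied to \<open>tab - tao * Di * tob\<close> it makes the four
  right sides combine into two products.\<close>

lemma schur_commutator:
  fixes z :: "'b::ring_1"
  assumes z: "\<And>x. x * z = z * x"
    and D: "D * Di = 1" "Di * D = 1"
    and s: "s2 = 1 \<or> s2 = -1" "s3 = 1 \<or> s3 = -1" "y = 1 \<or> y = -1"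
    and H1: "z * (tab * Tcd - s2 * s3 * (Tcd * tab)) = s3 * y * (Tad * tcb - tad * Tcb)"
    and H2: "z * (tao * Tcd - s2 * (Tcd * tao)) = y * (Tad * tco - tad * Tco)"
    and H3: "z * (tob * Tcd - s3 * (Tcd * tob)) = s3 * y * (Tod * tcb - tod * Tcb)"
    and H4: "z * (D * Tcd - Tcd * D) = y * (Tod * tco - tod * Tco)"
  shows "z * ((tab - tao * Di * tob) * Tcd - s2 * s3 * (Tcd * (tab - tao * Di * tob))) =
    s3 * y * ((Tad - tao * Di * Tod) * (tcb - tco * Di * tob)
      - (tad - tao * Di * tod) * (Tcb - Tco * Di * tob))"
proof -
  have z': "x * (z * w) = z * (x * w)" for x w
    by (metis mult.assoc z)
  have D': "D * (Di * x) = x" "Di * (D * x) = x" for x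
    by (simp_all add: D flip: mult.assoc)
  have "z * ((tab - tao * Di * tob) * Tcd - s2 * s3 * (Tcd * (tab - tao * Di * tob))) =
    z * (tab * Tcd - s2 * s3 * (Tcd * tab))
    - s3 * (z * (tao * Tcd - s2 * (Tcd * tao))) * Di * tob
    - tao * Di * (z * (tob * Tcd - s3 * (Tcd * tob)))
    + s3 * tao * Di * (z * (D * Tcd - Tcd * D)) * Di * tob"
    using s by (auto simp: algebra_simps z' D')
  also have "\<dots> = s3 * y * ((Tad - tao * Di * Tod) * (tcb - tco * Di * tob)
      - (tad - tao * Di * tod) * (Tcb - Tco * Di * tob))"
    unfolding H1 H2 H3 H4 using s by (auto simp: algebra_simps)
  finally show ?thesis .
qed

text \<open>The entries \<open>K\<close> are already eliminated at \<open>p\<close>; now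
  \<open>Tcd\<close> is eliminated at \<open>q\<close>, whose pivot \<open>D\<close> commutes with
  every \<open>K\<close>. In the hypotheses \<open>f\<close> and \<open>e\<close> are quotients by
  the pivot at \<open>p\<close> instead of \<open>q\<close>, so a remainder has to be shown to
  vanish.\<close>

lemma schur_bracket:
  fixes z :: "'b::ring_1"
  assumes z: "\<And>x. x * z = z * x" and zi: "zi * z = 1"
    and D: "D * Di = 1" "Di * D = 1"
    and s: "x1 = 1 \<or> x1 = -1" "x2 = 1 \<or> x2 = -1" "x3 = 1 \<or> x3 = -1" "x4 = 1 \<or> x4 = -1"
      "y = 1 \<or> y = -1"
    and K: "Kab * D = D * Kab" "Kcb * D = D * Kcb" "Kad * D = D * Kad" "Kcd * D = D * Kcd"
    and R1: "z * (Kab * Tcd - x1 * x2 * (Tcd * Kab)) =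
      y * ((Tad - f * Tod) * Kcb - Kad * (Tcb - Tco * e))"
    and R2: "z * (Kab * Tco - x1 * (Tco * Kab)) = y * x3 * ((Tao - f * D) * Kcb)"
    and R3: "z * (Kab * Tod - x2 * (Tod * Kab)) = - (y * x4 * x1 * (Kad * (Tob - D * e)))"
    and R4: "z * (Kcb * Tod - x3 * (Tod * Kcb)) = - (y * x4 * x1 * (Kcd * (Tob - D * e)))"
    and R5: "z * (Kad * Tco - x4 * (Tco * Kad)) = y * x3 * x4 * x1 * ((Tao - f * D) * Kcd)"
  shows "z * (Kab * (Tcd - Tco * Di * Tod) - x1 * x2 * ((Tcd - Tco * Di * Tod) * Kab)) =
    y * ((Tad - Tao * Di * Tod) * Kcb - Kad * (Tcb - Tco * Di * Tob))"
proof -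
  have z': "x * (z * w) = z * (x * w)" for x w
    by (metis mult.assoc z)
  have D': "D * (Di * x) = x" "Di * (D * x) = x" for x
    by (simp_all add: D flip: mult.assoc)
  have Ki: "Kx * Di = Di * Kx" if "Kx * D = D * Kx" for Kx
    by (metis that D mult.assoc mult_1_right mult_1_left)
  note Ki = K[THEN Ki]
  have Ki': "Kab * (Di * x) = Di * (Kab * x)" "Kcb * (Di * x) = Di * (Kcb * x)"
    "Kad * (Di * x) = Di * (Kad * x)" "Kcd * (Di * x) = Di * (Kcd * x)" for x
    by (metis Ki mult.assoc)+
  have K': "Kab * (D * x) = D * (Kab * x)" "Kcb * (D * x) = D * (Kcb * x)"
    "Kad * (D * x) = D * (Kad * x)" "Kcd * (D * x) = D * (Kcd * x)" for x
    by (metis K mult.assoc)+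
  \<comment> \<open>\<open>g\<close> and \<open>k\<close> are the differences between the pivot
    quotients at \<open>q\<close> and at \<open>p\<close>.\<close>
  define g where "g = Di * Tob - e"
  define k where "k = Tao * Di - f"
  have g: "Tob - D * e = D * g" and k: "Tao - f * D = k * D"
    by (simp_all add: g_def k_def algebra_simps D D')
  \<comment> \<open>What remains once the desired right side is split off. By \<open>R4\<close> and
    \<open>R5\<close> its two halves, multiplied by \<open>z\<close>, are opposite multiples of
    \<open>k * D * Kcd * g\<close>, and \<open>z\<close> is invertible.\<close>
  define R where "R = k * (y * (Tod * Kcb) - y * x3 * (Kcb * Tod))
    - (y * (Kad * Tco) - y * x4 * (Tco * Kad)) * g"
  have "z * R = - (y * x3 * k * (z * (Kcb * Tod - x3 * (Tod * Kcb))))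
    - y * (z * (Kad * Tco - x4 * (Tco * Kad))) * g"
    using s(3-5) by (auto simp: R_def algebra_simps z')
  also have "\<dots> = 0"
    unfolding R4 R5 g k using s by (auto simp: algebra_simps K K')
  finally have "zi * (z * R) = 0" by simp
  then have R: "R = 0" by (simp add: zi flip: mult.assoc)
  have "z * (Kab * (Tcd - Tco * Di * Tod) - x1 * x2 * ((Tcd - Tco * Di * Tod) * Kab)) =
    z * (Kab * Tcd - x1 * x2 * (Tcd * Kab))
    - z * (Kab * Tco - x1 * (Tco * Kab)) * (Di * Tod)
    - x1 * Tco * Di * (z * (Kab * Tod - x2 * (Tod * Kab)))"
    using s(1,2) by (auto simp: algebra_simps z' Ki Ki')
  also have "\<dots> = y * ((Tad - Tao * Di * Tod) * Kcb - Kad * (Tcb - Tco * Di * Tob)) + R"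
    unfolding R1 R2 R3 g k unfolding R_def g_def k_def
    using s(1,3-5) by (auto simp: algebra_simps z' Ki Ki' D D' K K')
  finally show ?thesis by (simp add: R)
qed

section \<open>Supercommutation relations at pairs of complex arguments\<close>

locale graded_scalars =
  fixes scal :: "complex \<Rightarrow> 'b::ring_1" and \<pi> :: "nat \<Rightarrow> nat"
  assumes scal_add: "scal (x + y) = scal x + scal y"
    and scal_mult: "scal (x * y) = scal x * scal y"
    and scal_1 [simp]: "scal 1 = 1"
    and scal_central: "b * scal x = scal x * b"
begin

lemma scal_0 [simp]: "scal 0 = 0"
  using scal_add[of 0 0] by simp

lemma scal_minus: "scal (- x) = - scal x"
  using scal_add[of "- x" x] by (simp add: eq_neg_iff_add_eq_0)

lemma scal_cancel: "x \<noteq> 0 \<Longrightarrow> scal x * b = 0 \<Longrightarrow> b = 0"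
  by (metis mult.assoc mult_1_left mult_zero_right nonzero_mult_div_cancel_left
      right_inverse mult.commute scal_1 scal_mult)

text \<open>
  The component of the RTT relation at two points \<open>p\<close>, \<open>q\<close> to which \<open>Q\<close> does not contribute; this is
  the case when neither the rows \<open>a\<close>, \<open>c\<close> nor the columns \<open>b\<close>, \<open>d\<close> are dual to each other.
\<close>

definition gl_rel :: "(nat \<Rightarrow> nat \<Rightarrow> complex \<Rightarrow> 'b) \<Rightarrow> nat \<Rightarrow> nat \<Rightarrow> nat \<Rightarrow> nat \<Rightarrow> bool" where
  "gl_rel t a b c d \<longleftrightarrow> (\<forall>p q.
     scal (p - q) * (t a b p * t c d q
       - (- 1) ^ ((\<pi> a + \<pi> b) * (\<pi> c + \<pi> d)) * (t c d q * t a b p)) =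
     (- 1) ^ (\<pi> a * \<pi> b + \<pi> a * \<pi> c + \<pi> b * \<pi> c) * (t c b p * t a d q - t c b q * t a d p))"

text \<open>In this form the index \<open>a\<close> stays in the left factor of each product on the
  right side and \<open>b\<close> in the right factor, so that the quotients
  \<open>t a k * Di\<close> and \<open>Di * t k b\<close> can be multiplied on from outside.\<close>

lemma gl_rel_iff_swapped:
  "gl_rel t c d a b \<longleftrightarrow> (\<forall>p q.
     scal (p - q) * (t a b p * t c d q
       - (- 1) ^ ((\<pi> a + \<pi> b) * (\<pi> c + \<pi> d)) * (t c d q * t a b p)) =
     (- 1) ^ (\<pi> b * \<pi> c + \<pi> b * \<pi> d + \<pi> c * \<pi> d) * (t a d q * t c b p - t a d p * t c b q))"
proof -
  have "scal (q - p) * (t c d q * t a b p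
       - (- 1) ^ ((\<pi> c + \<pi> d) * (\<pi> a + \<pi> b)) * (t a b p * t c d q)) =
     (- 1) ^ (\<pi> c * \<pi> d + \<pi> c * \<pi> a + \<pi> d * \<pi> a) * (t a d q * t c b p - t a d p * t c b q)
    \<longleftrightarrow> scal (p - q) * (t a b p * t c d q
       - (- 1) ^ ((\<pi> a + \<pi> b) * (\<pi> c + \<pi> d)) * (t c d q * t a b p)) =
     (- 1) ^ (\<pi> b * \<pi> c + \<pi> b * \<pi> d + \<pi> c * \<pi> d) * (t a d q * t c b p - t a d p * t c b q)"
    for p q
  proof -
    have *: "scal (q - p) = - scal (p - q)"
      by (simp flip: scal_minus)
    show ?thesis
      unfolding *
      by (cases "even (\<pi> a)"; cases "even (\<pi> b)"; cases "even (\<pi> c)"; cases "even (\<pi> d)")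
        (auto simp: minus_one_power_iff algebra_simps)
  qed
  then show ?thesis
    unfolding gl_rel_def by blast
qed

lemmas gl_rel_swapped = gl_rel_iff_swapped[THEN iffD1, rule_format]

text \<open>The relation reads \<open>(p - q - \<eta>) [t a a p, t a a q] = 0\<close> with a sign
  \<open>\<eta>\<close>. When \<open>p - q = \<eta>\<close>, the exchanged pair has
  \<open>q - p - \<eta> = - 2 \<eta>\<close>, which can be cancelled.\<close>

lemma gl_rel_same_commute:
  assumes "gl_rel t a a a a"
  shows "t a a p * t a a q = t a a q * t a a p"
proof -
  have *: "(scal (p - q) - (- 1) ^ \<pi> a) * (t a a p * t a a q - t a a q * t a a p) = 0" for p q
    using assms unfolding gl_rel_def
    by (cases "even (\<pi> a)") (auto simp: minus_one_power_iff algebra_simps)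
  define \<eta> :: complex where "\<eta> = (- 1) ^ \<pi> a"
  have \<eta>: "scal \<eta> = (- 1) ^ \<pi> a" "\<eta> \<noteq> 0"
    by (simp_all add: \<eta>_def minus_one_power_iff scal_minus)
  have **: "t a a p * t a a q = t a a q * t a a p" if "p - q \<noteq> \<eta>" for p q
  proof -
    have "scal (p - q - \<eta>) = scal (p - q) - (- 1) ^ \<pi> a"
      using scal_add[of "p - q" "- \<eta>"] by (simp add: scal_minus \<eta>(1))
    then have "scal (p - q - \<eta>) * (t a a p * t a a q - t a a q * t a a p) = 0"
      using * by simp
    with that have "t a a p * t a a q - t a a q * t a a p = 0"
      by (intro scal_cancel[of "p - q - \<eta>" "t a a p * t a a q - t a a q * t a a p"]) simp_all
    then show ?thesis by simp
  qed
  show ?thesis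
  proof (cases "p - q = \<eta>")
    case True
    then have "q - p \<noteq> \<eta>" using \<eta>(2) by (auto simp: algebra_simps)
    with **[of q p] show ?thesis by simp
  qed (use ** in blast)
qed

end

text \<open>\<open>nd\<close> stands for pairs of indices in the current block that are not dual to
  each other. One elimination involves only relations between such pairs, provided that the pivot is
  not its own dual.\<close>

locale gauss_step = graded_scalars scal \<pi>
  for scal :: "complex \<Rightarrow> 'b::ring_1" and \<pi> :: "nat \<Rightarrow> nat" +
  fixes t :: "nat \<Rightarrow> nat \<Rightarrow> complex \<Rightarrow> 'b" and k :: nat and D Di :: "complex \<Rightarrow> 'b"
    and nd :: "nat \<Rightarrow> nat \<Rightarrow> bool"
  assumes D: "t k k p = D p" and Di: "D p * Di p = 1" "Di p * D p = 1"
    and rel: "nd a c \<Longrightarrow> nd b d \<Longrightarrow> gl_rel t a b c d"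
    and nd_sym: "nd a b \<Longrightarrow> nd b a" and nd_pivot: "nd k k"
begin

definition schur :: "nat \<Rightarrow> nat \<Rightarrow> complex \<Rightarrow> 'b" where
  "schur a b p = t a b p - t a k p * Di p * t k b p"

lemma schur_pivot: "schur k b p = 0" "schur a k p = 0"
  by (simp_all add: schur_def D Di mult.assoc)

text \<open>Only the entry at \<open>p\<close> has been eliminated, so the right side contains mixed
  differences such as \<open>t a d q - t a k p * Di p * t k d q\<close>, which are Schur complements
  at neither point. The second elimination repairs them.\<close>

lemma schur_t:
  assumes "nd k a" "nd a c" "nd k c" "nd k b" "nd b d" "nd k d"
  shows "scal (p - q) * (schur a b p * t c d q
      - (- 1) ^ ((\<pi> a + \<pi> b) * (\<pi> c + \<pi> d)) * (t c d q * schur a b p)) =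
    (- 1) ^ (\<pi> b * \<pi> c + \<pi> b * \<pi> d + \<pi> c * \<pi> d) *
      ((t a d q - t a k p * Di p * t k d q) * schur c b p
       - schur a d p * (t c b q - t c k q * Di p * t k b p))"
proof -
  have s: "(- 1) ^ ((\<pi> a + \<pi> b) * (\<pi> c + \<pi> d)) =
      (- 1) ^ ((\<pi> a + \<pi> k) * (\<pi> c + \<pi> d)) * (- 1 :: 'b) ^ ((\<pi> k + \<pi> b) * (\<pi> c + \<pi> d))"
    "(- 1) ^ (\<pi> b * \<pi> c + \<pi> b * \<pi> d + \<pi> c * \<pi> d) =
      (- 1) ^ ((\<pi> k + \<pi> b) * (\<pi> c + \<pi> d)) * (- 1 :: 'b) ^ (\<pi> k * \<pi> c + \<pi> k * \<pi> d + \<pi> c * \<pi> d)"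
    by ((cases "even (\<pi> a)"; cases "even (\<pi> b)"; cases "even (\<pi> c)"; cases "even (\<pi> d)"; cases "even (\<pi> k)"; simp add: minus_one_power_iff)+)
  have e: "(- 1) ^ ((\<pi> k + \<pi> k) * (\<pi> c + \<pi> d)) = (1 :: 'b)"
    by (simp add: minus_one_power_iff)
  show ?thesis
    unfolding schur_def s
  proof (rule schur_commutator[where D = "D p"])
    show "scal (p - q) * (t a b p * t c d q - (- 1) ^ ((\<pi> a + \<pi> k) * (\<pi> c + \<pi> d)) *
        (- 1) ^ ((\<pi> k + \<pi> b) * (\<pi> c + \<pi> d)) * (t c d q * t a b p)) =
      (- 1) ^ ((\<pi> k + \<pi> b) * (\<pi> c + \<pi> d)) * (- 1) ^ (\<pi> k * \<pi> c + \<pi> k * \<pi> d + \<pi> c * \<pi> d) *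
        (t a d q * t c b p - t a d p * t c b q)"
      unfolding s[symmetric] using assms nd_sym by (intro gl_rel_swapped rel)
    show "scal (p - q) * (t k b p * t c d q
        - (- 1) ^ ((\<pi> k + \<pi> b) * (\<pi> c + \<pi> d)) * (t c d q * t k b p)) =
      (- 1) ^ ((\<pi> k + \<pi> b) * (\<pi> c + \<pi> d)) * (- 1) ^ (\<pi> k * \<pi> c + \<pi> k * \<pi> d + \<pi> c * \<pi> d) *
        (t k d q * t c b p - t k d p * t c b q)"
      unfolding s(2)[symmetric] using assms nd_sym by (intro gl_rel_swapped rel)
    show "scal (p - q) * (t a k p * t c d q
        - (- 1) ^ ((\<pi> a + \<pi> k) * (\<pi> c + \<pi> d)) * (t c d q * t a k p)) =
      (- 1) ^ (\<pi> k * \<pi> c + \<pi> k * \<pi> d + \<pi> c * \<pi> d) * (t a d q * t c k p - t a d p * t c k q)"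
      using assms nd_sym by (intro gl_rel_swapped rel)
    show "scal (p - q) * (D p * t c d q - t c d q * D p) =
      (- 1) ^ (\<pi> k * \<pi> c + \<pi> k * \<pi> d + \<pi> c * \<pi> d) * (t k d q * t c k p - t k d p * t c k q)"
      using gl_rel_swapped[OF rel, of c k d k p q] assms nd_sym nd_pivot by (simp add: D e)
  qed (auto simp: scal_central Di minus_one_power_iff)
qed

text \<open>For \<open>c = d = k\<close> each term on the right of \<open>schur_t\<close> contains
  an eliminated entry in the pivot row or column, which is zero.\<close>

lemma schur_pivot_commute:
  assumes "nd k a" "nd k b" "p \<noteq> q"
  shows "schur a b p * D q = D q * schur a b p"
proof -
  have "scal (p - q) * (schur a b p * D q - D q * schur a b p) = 0"
    using schur_t[of a k b k p q] assms nd_sym nd_pivot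
    by (simp add: D schur_pivot minus_one_power_iff)
  with assms(3) show ?thesis
    using scal_cancel[of "p - q" "schur a b p * D q - D q * schur a b p"] by auto
qed

theorem gl_rel_schur:
  assumes nd: "nd k a" "nd k c" "nd a c" "nd k b" "nd k d" "nd b d"
  shows "gl_rel schur c d a b"
  unfolding gl_rel_iff_swapped
proof (intro allI)
  fix p q
  show "scal (p - q) * (schur a b p * schur c d q
       - (- 1) ^ ((\<pi> a + \<pi> b) * (\<pi> c + \<pi> d)) * (schur c d q * schur a b p)) =
     (- 1) ^ (\<pi> b * \<pi> c + \<pi> b * \<pi> d + \<pi> c * \<pi> d) *
       (schur a d q * schur c b p - schur a d p * schur c b q)"
  \<comment> \<open>At equal points both sides vanish. Otherwise \<open>p - q\<close> is invertible
    and the pivot at \<open>q\<close> commutes with the eliminated entries at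
    \<open>p\<close>.\<close>
  proof (cases "p = q")
    case False
    \<comment> \<open>\<open>x1\<close> to \<open>x4\<close> are the signs for passing an eliminated
      entry across an entry of the pivot column or row. The prefactors of all instances of
      \<open>schur_t\<close> below are products of these with \<open>y\<close>.\<close>
    define x1 x2 x3 x4 y :: 'b where
      "x1 = (- 1) ^ ((\<pi> a + \<pi> b) * (\<pi> c + \<pi> k))" and
      "x2 = (- 1) ^ ((\<pi> a + \<pi> b) * (\<pi> k + \<pi> d))" and
      "x3 = (- 1) ^ ((\<pi> c + \<pi> b) * (\<pi> k + \<pi> d))" and
      "x4 = (- 1) ^ ((\<pi> a + \<pi> d) * (\<pi> c + \<pi> k))" and
      "y = (- 1) ^ (\<pi> b * \<pi> c + \<pi> b * \<pi> d + \<pi> c * \<pi> d)"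
    note xy = x1_def x2_def x3_def x4_def y_def
    have pm: "(- 1 :: 'b) ^ n = 1 \<or> (- 1 :: 'b) ^ n = - 1" for n
      by (simp add: minus_one_power_iff)
    have x_pm: "x1 = 1 \<or> x1 = - 1" "x2 = 1 \<or> x2 = - 1" "x3 = 1 \<or> x3 = - 1"
      "x4 = 1 \<or> x4 = - 1" "y = 1 \<or> y = - 1"
      unfolding xy by (rule pm)+
    have x12: "(- 1) ^ ((\<pi> a + \<pi> b) * (\<pi> c + \<pi> d)) = x1 * x2"
      by (cases "even (\<pi> a)"; cases "even (\<pi> b)"; cases "even (\<pi> c)"; cases "even (\<pi> d)"; cases "even (\<pi> k)"; simp add: xy minus_one_power_iff)
    have y3: "(- 1) ^ (\<pi> b * \<pi> c + \<pi> b * \<pi> k + \<pi> c * \<pi> k) = y * x3"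
      by (cases "even (\<pi> a)"; cases "even (\<pi> b)"; cases "even (\<pi> c)"; cases "even (\<pi> d)"; cases "even (\<pi> k)"; simp add: xy minus_one_power_iff)
    have y41: "(- 1) ^ (\<pi> b * \<pi> k + \<pi> b * \<pi> d + \<pi> k * \<pi> d) = y * x4 * x1"
      by (cases "even (\<pi> a)"; cases "even (\<pi> b)"; cases "even (\<pi> c)"; cases "even (\<pi> d)"; cases "even (\<pi> k)"; simp add: xy minus_one_power_iff)
    have y341: "(- 1) ^ (\<pi> d * \<pi> c + \<pi> d * \<pi> k + \<pi> c * \<pi> k) = y * x3 * x4 * x1"
      by (cases "even (\<pi> a)"; cases "even (\<pi> b)"; cases "even (\<pi> c)"; cases "even (\<pi> d)"; cases "even (\<pi> k)"; simp add: xy minus_one_power_iff)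
    have zi: "scal (inverse (p - q)) * scal (p - q) = 1"
      using False by (simp flip: scal_mult)
    note nd' = nd nd_sym nd_pivot
    show ?thesis
      unfolding x12 y_def[symmetric] schur_def[of c d q] schur_def[of a d q] schur_def[of c b q]
    proof (rule schur_bracket[where D = "D q" and f = "t a k p * Di p" and e = "Di p * t k b p"
          and ?x3.0 = x3 and ?x4.0 = x4 and Tad = "t a d q" and Tao = "t a k q"
          and Tcb = "t c b q" and Tob = "t k b q" and Kcd = "schur c d p"])
      show "scal (p - q) * (schur a b p * t c d q - x1 * x2 * (t c d q * schur a b p)) =
        y * ((t a d q - t a k p * Di p * t k d q) * schur c b p
          - schur a d p * (t c b q - t c k q * (Di p * t k b p)))"
        using schur_t[of a c b d p q] nd' by (simp add: x12 y_def mult.assoc)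
      show "scal (p - q) * (schur a b p * t c k q - x1 * (t c k q * schur a b p)) =
        y * x3 * ((t a k q - t a k p * Di p * D q) * schur c b p)"
        using schur_t[of a c b k p q] nd' by (simp add: y3 D schur_pivot flip: x1_def)
      show "scal (p - q) * (schur a b p * t k d q - x2 * (t k d q * schur a b p)) =
        - (y * x4 * x1 * (schur a d p * (t k b q - D q * (Di p * t k b p))))"
        using schur_t[of a k b d p q] nd' by (simp add: y41 D schur_pivot mult.assoc flip: x2_def)
      show "scal (p - q) * (schur c b p * t k d q - x3 * (t k d q * schur c b p)) =
        - (y * x4 * x1 * (schur c d p * (t k b q - D q * (Di p * t k b p))))"
        using schur_t[of c k b d p q] nd' by (simp add: y41 D schur_pivot mult.assoc flip: x3_def)
      show "scal (p - q) * (schur a d p * t c k q - x4 * (t c k q * schur a d p)) =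
        y * x3 * x4 * x1 * ((t a k q - t a k p * Di p * D q) * schur c d p)"
        using schur_t[of a c d k p q] nd' by (simp add: y341 D schur_pivot flip: x4_def)
    qed (fact scal_central zi Di x_pm | rule schur_pivot_commute; use nd False in simp)+
  qed simp
qed

text \<open>At distance \<open>\<eta>\<close> the scalar \<open>p - q\<close> matches the sign on
  the right of the relations. Within the pivot row or column a term then cancels, which gives
  \<open>1\<close> and \<open>2\<close>; identity \<open>3\<close> equates two expansions of the
  quantum minor with rows \<open>k\<close>, \<open>a\<close> and columns \<open>k\<close>,
  \<open>b\<close>. The parenthesis on the left has its factors in the order opposite to a Schur
  complement, as elimination in the transposed matrix produces it.\<close>

lemma pivot_minor:
  fixes \<eta> :: complex and q :: complex
  assumes nd: "nd k a" "nd k b" and \<eta>: "\<eta> = (- 1) ^ \<pi> k"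
  shows "D (q - \<eta>) * (t a b q - (- 1) ^ ((\<pi> k + \<pi> a) * (\<pi> k + \<pi> b)) * (t k b q * Di q * t a k q))
    = D q * schur a b (q - \<eta>)"
proof -
  let ?r = "q - \<eta>"
  define s :: 'b where "s = (- 1) ^ ((\<pi> k + \<pi> a) * (\<pi> k + \<pi> b))"
  have s: "s = 1 \<or> s = - 1"
    by (simp add: s_def minus_one_power_iff)
  have ss: "scal \<eta> = (- 1) ^ \<pi> k" "(- 1) ^ \<pi> k * ((- 1) ^ \<pi> k * x) = (x :: 'b)" for x
    by (simp_all add: \<eta> minus_one_power_iff scal_minus)
  have cancel: "x = y" if "scal \<eta> * x = (- 1) ^ \<pi> k * y" for x y
    using that ss by metis
  note rel' = rel[unfolded gl_rel_def, rule_format]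
  have "scal \<eta> * (D q * t k b ?r - t k b ?r * D q) = (- 1) ^ \<pi> k * (D q * t k b ?r - D ?r * t k b q)"
    using rel'[of k k k b q ?r] nd nd_pivot by (cases "even (\<pi> k)") (simp_all add: D minus_one_power_iff)
  from cancel[OF this] have 1: "t k b ?r * D q = D ?r * t k b q" by simp
  have "scal \<eta> * (D q * t a k ?r - t a k ?r * D q) = (- 1) ^ \<pi> k * (t a k q * D ?r - t a k ?r * D q)"
    using rel'[of k a k k q ?r] nd nd_pivot by (cases "even (\<pi> k)") (simp_all add: D minus_one_power_iff)
  from cancel[OF this] have 2: "D q * t a k ?r = t a k q * D ?r" by simp
  have "scal \<eta> * (t a k q * t k b ?r - s * (t k b ?r * t a k q)) =
      (- 1) ^ \<pi> k * (D q * t a b ?r - D ?r * t a b q)"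
    using rel'[of a k k b q ?r] nd_sym nd nd_pivot
    by (cases "even (\<pi> k)"; cases "even (\<pi> a)"; cases "even (\<pi> b)")
      (simp_all add: D s_def minus_one_power_iff)
  from cancel[OF this]
  have 3: "D ?r * t a b q - s * (t k b ?r * t a k q) = D q * t a b ?r - t a k q * t k b ?r"
    by (simp add: algebra_simps)
  have "D ?r * t k b q * Di q = t k b ?r * (D q * Di q)"
    unfolding 1[symmetric] by (simp only: mult.assoc)
  then have 4: "D ?r * t k b q * Di q = t k b ?r" by (simp add: Di)
  have "t a k q * (D ?r * Di ?r) = D q * t a k ?r * Di ?r"
    unfolding 2 by (simp only: mult.assoc)
  then have 5: "D q * t a k ?r * Di ?r = t a k q" by (simp add: Di)
  have "D ?r * (t a b q - s * (t k b q * Di q * t a k q)) =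
      D ?r * t a b q - s * ((D ?r * t k b q * Di q) * t a k q)"
    using s by (elim disjE) (simp_all add: right_diff_distrib distrib_left mult.assoc)
  also have "\<dots> = D q * t a b ?r - (D q * t a k ?r * Di ?r) * t k b ?r"
    unfolding 4 5 by (rule 3)
  also have "\<dots> = D q * schur a b ?r"
    by (simp add: schur_def right_diff_distrib mult.assoc)
  finally show ?thesis by (simp add: s_def)
qed

end

section \<open>Iteration along the Gauss decomposition\<close>

text \<open>Subtracting right multiples of column \<open>k\<close> from the other columns of
  \<open>A\<close> changes the product only by multiples of its column \<open>k\<close>, which is
  zero off the diagonal. It also clears row \<open>k\<close> of \<open>A\<close>, so the index
  \<open>k\<close> drops out of the sum.\<close>

lemma sum_schur_right:
  fixes A B :: "nat \<Rightarrow> nat \<Rightarrow> 'b::ring_1"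
  assumes fin: "finite S" and k: "k \<in> S" "A k k * Ai = 1" "Ai * A k k = 1"
    and BA: "\<And>i. i \<in> S \<Longrightarrow> (\<Sum>l\<in>S. B j l * A l i) = (if j = i then w else 0)"
    and i: "i \<in> S - {k}" "j \<noteq> k"
  shows "(\<Sum>l\<in>S - {k}. B j l * (A l i - A l k * Ai * A k i)) = (if j = i then w else 0)"
proof -
  have "(\<Sum>l\<in>S - {k}. B j l * (A l i - A l k * Ai * A k i)) =
      (\<Sum>l\<in>S. B j l * (A l i - A l k * Ai * A k i))"
    using fin k by (intro sum.mono_neutral_left) auto
  also have "\<dots> = (\<Sum>l\<in>S. B j l * A l i) - (\<Sum>l\<in>S. B j l * A l k) * Ai * A k i"
    by (simp add: right_diff_distrib sum_subtractf sum_distrib_right mult.assoc)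
  also have "\<dots> = (if j = i then w else 0)"
    using BA[of i] BA[of k] i k by simp
  finally show ?thesis .
qed

text \<open>In the application \<open>n\<close> is the dual of \<open>k\<close>, where transposition
  puts the pivot. Row \<open>n\<close> of the product is zero in the remaining columns, so the row
  operation on \<open>B\<close> leaves the remaining block of the product unchanged.\<close>

lemma sum_schur_both:
  fixes A B :: "nat \<Rightarrow> nat \<Rightarrow> 'b::ring_1"
  assumes fin: "finite S" and kn: "k \<in> S" "n \<in> S" "k \<noteq> n"
    and A: "A k k * Ai = 1" "Ai * A k k = 1" and B: "B n n * Bi = 1" "Bi * B n n = 1"
    and BA: "\<And>j i. j \<in> S \<Longrightarrow> i \<in> S \<Longrightarrow> (\<Sum>l\<in>S. B j l * A l i) = (if j = i then w else 0)"
    and ij: "i \<in> S - {k, n}" "j \<in> S - {k, n}"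
  shows "(\<Sum>l\<in>S - {k, n}. (B j l - B j n * Bi * B n l) * (A l i - A l k * Ai * A k i)) =
    (if j = i then w else 0)"
proof -
  have "(\<Sum>l\<in>S - {k, n}. (B j l - B j n * Bi * B n l) * (A l i - A l k * Ai * A k i)) =
      (\<Sum>l\<in>S - {k}. (B j l - B j n * Bi * B n l) * (A l i - A l k * Ai * A k i))"
    using fin B by (intro sum.mono_neutral_left) (auto simp: mult.assoc)
  also have "\<dots> = (\<Sum>l\<in>S - {k}. B j l * (A l i - A l k * Ai * A k i))
      - B j n * Bi * (\<Sum>l\<in>S - {k}. B n l * (A l i - A l k * Ai * A k i))"
    by (simp add: left_diff_distrib sum_subtractf sum_distrib_left mult.assoc)
  also have "\<dots> = (if j = i then w else 0)"
    using sum_schur_right[of S k A Ai B j w i, OF fin] sum_schur_right[of S k A Ai B n w i, OF fin]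
      kn A BA ij by auto
  finally show ?thesis .
qed

section \<open>Schur complements as tails of the Gauss decomposition\<close>

locale gauss_factors =
  fixes d :: nat and F E :: "nat \<Rightarrow> nat \<Rightarrow> complex \<Rightarrow> 'b::ring_1" and h :: "nat \<Rightarrow> complex \<Rightarrow> 'b"
  assumes lower: "lower_unitriangular d (\<lambda>i j. F i j p)"
    and upper: "upper_unitriangular d (\<lambda>i j. E i j p)"
begin

text \<open>The Schur complement of the matrix with respect to its first \<open>k - 1\<close> rows
  and columns; \<open>K 1\<close> is the matrix itself.\<close>

definition K :: "nat \<Rightarrow> nat \<Rightarrow> nat \<Rightarrow> complex \<Rightarrow> 'b" where
  "K k a b p = (\<Sum>j\<in>{k..d}. F a j p * h j p * E j b p)"

lemma K_rec: "k \<in> {1..d} \<Longrightarrow> K k a b p = F a k p * h k p * E k b p + K (Suc k) a b p"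
  by (simp add: K_def sum.atLeast_Suc_atMost)

lemma K_pivot_col:
  assumes "k \<in> {1..d}"
  shows "K k a k p = F a k p * h k p"
proof -
  have "K (Suc k) a k p = 0"
    unfolding K_def using assms upper[of p]
    by (intro sum.neutral) (auto simp: upper_unitriangular_def)
  with assms upper[of p] show ?thesis
    by (simp add: K_rec upper_unitriangular_def)
qed

lemma K_pivot_row:
  assumes "k \<in> {1..d}"
  shows "K k k b p = h k p * E k b p"
proof -
  have "K (Suc k) k b p = 0"
    unfolding K_def using assms lower[of p]
    by (intro sum.neutral) (auto simp: lower_unitriangular_def)
  with assms lower[of p] show ?thesis
    by (simp add: K_rec lower_unitriangular_def)
qed

lemma K_pivot: "k \<in> {1..d} \<Longrightarrow> K k k k p = h k p"
  using K_pivot_row[of k k p] upper[of p] by (simp add: upper_unitriangular_def)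

text \<open>For the identity matrix the pivot column vanishes below the pivot, so the term split off
  is zero on the remaining block, which is again an identity matrix. Applied to constant terms, this
  gives every \<open>h k\<close> the constant term 1 and hence an inverse.\<close>

lemma pivot_eq_1:
  assumes K1: "\<And>a b. a \<in> {1..d} \<Longrightarrow> b \<in> {1..d} \<Longrightarrow> K 1 a b p = (if a = b then 1 else 0)"
    and k: "k \<in> {1..d}"
  shows "h k p = 1"
proof -
  have "\<forall>a\<in>{k..d}. \<forall>b\<in>{k..d}. K k a b p = (if a = b then 1 else 0)"
    if "1 \<le> k" "k \<le> d" for k
    using that
  proof (induction k rule: dec_induct)
    case (step k)
    then have k: "k \<in> {1..d}" by simp
    show ?case
    proof (intro ballI)
      fix a b assume ab: "a \<in> {Suc k..d}" "b \<in> {Suc k..d}"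
      with step K_pivot_col[OF k, of a p] have "F a k p * h k p = 0" by simp
      with ab step K_rec[OF k, of a b p] show "K (Suc k) a b p = (if a = b then 1 else 0)" by simp
    qed
  qed (use K1 in simp)
  with k K_pivot[OF k, of p] show ?thesis by simp
qed

end

locale gauss_chain = graded_scalars scal "par N m" + gauss_factors "N + 2 * m" F E h
  for scal :: "complex \<Rightarrow> 'b::ring_1" and N m :: nat and F E :: "nat \<Rightarrow> nat \<Rightarrow> complex \<Rightarrow> 'b"
    and h :: "nat \<Rightarrow> complex \<Rightarrow> 'b" +
  fixes hi :: "nat \<Rightarrow> complex \<Rightarrow> 'b"
  assumes h_inv: "i \<in> {1..N + 2 * m} \<Longrightarrow> h i p * hi i p = 1" "i \<in> {1..N + 2 * m} \<Longrightarrow> hi i p * h i p = 1"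
begin

definition nd :: "nat \<Rightarrow> nat \<Rightarrow> nat \<Rightarrow> bool" where
  "nd k a c \<longleftrightarrow> a \<in> {k..dual N m k} \<and> c \<in> {k..dual N m k} \<and> c \<noteq> dual N m a"

lemma K_Suc:
  assumes "k \<in> {1..N + 2 * m}"
  shows "K (Suc k) a b p = K k a b p - K k a k p * hi k p * K k k b p"
proof -
  have "F a k p * h k p * (hi k p * (h k p * E k b p)) = F a k p * (h k p * E k b p)"
    using assms by (metis h_inv(2) mult.assoc mult_1_left)
  with assms show ?thesis
    by (simp add: K_pivot_col K_pivot_row K_rec[of k a b] mult.assoc)
qed

definition gl_stage :: "nat \<Rightarrow> bool" where
  "gl_stage k \<longleftrightarrow> (\<forall>a b c e. nd k a c \<longrightarrow> nd k b e \<longrightarrow> gl_rel (K k) a b c e)"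

lemma nd_sym: "k \<in> {1..N + 2 * m} \<Longrightarrow> nd k a b \<Longrightarrow> nd k b a"
  by (auto simp: nd_def dual_def)

lemma gauss_step_stage:
  assumes "1 \<le> k" "k < dual N m k" "gl_stage k"
  shows "gauss_step scal (par N m) (K k) k (h k) (hi k) (nd k)"
proof -
  have k: "k \<in> {1..N + 2 * m}" using assms by (auto simp: dual_def)
  then show ?thesis
    using assms by unfold_locales (auto simp: K_pivot h_inv gl_stage_def nd_sym, auto simp: nd_def)
qed

lemma gl_stage_Suc:
  assumes "1 \<le> k" "k < dual N m k" "gl_stage k"
  shows "gl_stage (Suc k)"
proof -
  interpret gauss_step scal "par N m" "K k" k "h k" "hi k" "nd k"
    using assms by (rule gauss_step_stage)
  have k: "k \<in> {1..N + 2 * m}" using assms by (auto simp: dual_def)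
  have *: "schur = K (Suc k)"
    by (intro ext) (simp add: schur_def K_Suc[OF k])
  \<comment> \<open>The dual of \<open>k\<close> leaves the range together with \<open>k\<close>, so
    no remaining index is dual to the pivot.\<close>
  have nd': "nd k k a \<and> nd k k c \<and> nd k a c \<and> nd k c a" if "nd (Suc k) a c" for a c
    using that assms by (auto simp: nd_def dual_def)
  show ?thesis
    unfolding gl_stage_def *[symmetric] using nd' by (blast intro: gl_rel_schur)
qed

text \<open>
  The matrix identity \<open>T\<^sub>k\<^sup>t(q) T\<^sub>k(p) = w\<close> for the part of the \<open>k\<close>-th Schur complement with indices from
  \<open>k\<close> to \<open>k'\<close>.
\<close>

definition crossing :: "nat \<Rightarrow> complex \<Rightarrow> complex \<Rightarrow> 'b \<Rightarrow> bool" where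
  "crossing k p q w \<longleftrightarrow> (\<forall>j\<in>{k..dual N m k}. \<forall>i\<in>{k..dual N m k}.
     (\<Sum>l\<in>{k..dual N m k}. super_transpose N m (\<lambda>a b. K k a b q) j l * K k l i p) =
     (if j = i then w else 0))"

text \<open>By \<open>pivot_minor\<close>, left multiplication by \<open>h k (q - \<eta>)\<close>
  turns the eliminated transpose into \<open>h k q\<close> times the transpose of the next Schur
  complement at \<open>q - \<eta>\<close>. Both factors act from the left, hence their place before
  \<open>w\<close>.\<close>

lemma crossing_Suc:
  assumes k: "1 \<le> k" "k < dual N m k" and gl: "gl_stage k" and cr: "crossing k p q w"
    and \<eta>: "\<eta> = (- 1) ^ par N m k"
  shows "crossing (Suc k) p (q - \<eta>) (hi k q * h k (q - \<eta>) * w)"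
  unfolding crossing_def
proof (intro ballI)
  fix j i assume j: "j \<in> {Suc k..dual N m (Suc k)}" and i: "i \<in> {Suc k..dual N m (Suc k)}"
  interpret gauss_step scal "par N m" "K k" k "h k" "hi k" "nd k"
    using k gl by (rule gauss_step_stage)
  let ?S = "{k..dual N m k}" and ?n = "dual N m k"
  have k': "k \<in> {1..N + 2 * m}" using k by (auto simp: dual_def)
  have S: "{Suc k..dual N m (Suc k)} = ?S - {k, ?n}"
    by (auto simp: dual_def)
  have schur: "schur = K (Suc k)"
    by (intro ext) (simp add: schur_def K_Suc[OF k'])
  define B where "B = super_transpose N m (\<lambda>a b. K k a b q)"
  have dual: "dual N m (dual N m l) = l" "par N m (dual N m l) = par N m l" if "l \<in> ?S" for l
    using that k' by (auto simp: dual_def par_def)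
  \<comment> \<open>Transposition moves the pivot to the dual index; the signs cancel because
    \<open>theta\<close> occurs squared and the exponent is even.\<close>
  have Bnn: "B ?n ?n = h k q"
    using k' k by (simp add: B_def super_transpose_def dual K_pivot minus_one_power_iff theta_def)
  have B': "h k (q - \<eta>) * (B j l - B j ?n * hi k q * B ?n l) =
      h k q * super_transpose N m (\<lambda>a b. K (Suc k) a b (q - \<eta>)) j l"
    if l: "l \<in> ?S - {k, ?n}" for l
  proof -
    have jl: "l \<in> ?S" "j \<in> ?S" "?n \<in> ?S" using l j S k by auto
    have nd: "nd k k (dual N m l)" "nd k k (dual N m j)"
      using l j k by (auto simp: nd_def dual_def)
    let ?s = "(- 1 :: 'b) ^ (par N m j * par N m l + par N m l) * theta N m j * theta N m l"
    let ?e = "(- 1 :: 'b) ^ ((par N m k + par N m l) * (par N m k + par N m j))"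
    have e: "B j l - B j ?n * hi k q * B ?n l = (K k (dual N m l) (dual N m j) q
        - ?e * (K k k (dual N m j) q * hi k q * K k (dual N m l) k q)) * ?s"
      unfolding B_def super_transpose_def
      using jl k by (cases "even (par N m j)"; cases "even (par N m l)"; cases "even (par N m k)")
        (auto simp: dual theta_def minus_one_power_iff algebra_simps)
    show ?thesis
      unfolding e
      using pivot_minor[of "dual N m l" "dual N m j" \<eta> q] nd \<eta> jl
      by (simp add: dual schur super_transpose_def mult.assoc[symmetric])
  qed
  have "(\<Sum>l\<in>?S - {k, ?n}. (B j l - B j ?n * hi k q * B ?n l)
      * (K k l i p - K k l k p * hi k p * K k k i p)) = (if j = i then w else 0)"
    using cr[unfolded crossing_def, folded B_def] k i j k' unfolding S
    by (intro sum_schur_both) (auto simp: K_pivot h_inv Bnn)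
  then have "(\<Sum>l\<in>?S - {k, ?n}. (h k (q - \<eta>) * (B j l - B j ?n * hi k q * B ?n l)) * K (Suc k) l i p)
      = (if j = i then h k (q - \<eta>) * w else 0)"
    by (simp add: K_Suc[OF k'] mult.assoc flip: sum_distrib_left)
  moreover have "(\<Sum>l\<in>?S - {k, ?n}. (h k (q - \<eta>) * (B j l - B j ?n * hi k q * B ?n l)) * K (Suc k) l i p)
      = (\<Sum>l\<in>?S - {k, ?n}. (h k q * super_transpose N m (\<lambda>a b. K (Suc k) a b (q - \<eta>)) j l)
      * K (Suc k) l i p)"
    by (intro sum.cong refl) (simp only: B')
  ultimately have "h k q * (\<Sum>l\<in>?S - {k, ?n}. super_transpose N m (\<lambda>a b. K (Suc k) a b (q - \<eta>)) j l
      * K (Suc k) l i p) = (if j = i then h k (q - \<eta>) * w else 0)"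
    by (simp only: sum_distrib_left mult.assoc)
  then have "hi k q * h k q * (\<Sum>l\<in>?S - {k, ?n}. super_transpose N m (\<lambda>a b. K (Suc k) a b (q - \<eta>)) j l
      * K (Suc k) l i p) = (if j = i then hi k q * h k (q - \<eta>) * w else 0)"
    by (cases "j = i") (simp_all add: mult.assoc)
  with k' show "(\<Sum>l\<in>{Suc k..dual N m (Suc k)}. super_transpose N m (\<lambda>a b. K (Suc k) a b (q - \<eta>)) j l
      * K (Suc k) l i p) = (if j = i then hi k q * h k (q - \<eta>) * w else 0)"
    unfolding S by (simp add: h_inv)
qed

text \<open>An odd pivot shifts the argument of \<open>T\<^sub>k\<^sup>t\<close> by \<open>1\<close>, an even pivot shifts it by \<open>-1\<close>.\<close>

definition point :: "nat \<Rightarrow> complex" where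
  "point k = (if k \<le> Suc m then of_nat k - 1 else 2 * of_nat m + 1 - of_nat k)"

lemma point_Suc: "1 \<le> k \<Longrightarrow> k \<le> N + m \<Longrightarrow> point (Suc k) = point k - (- 1) ^ par N m k"
  by (cases "k = Suc m") (auto simp: point_def par_def)

lemma crossing_chain:
  assumes "gl_stage 1" "crossing 1 p 0 c" "1 \<le> k" "k \<le> dual N m k"
  shows "gl_stage k \<and> (\<exists>w. crossing k p (point k) w \<and>
    c = (\<Prod>i\<leftarrow>[1..<k]. h i (point i) * hi i (point (Suc i))) * w)"
  using assms(3,4)
proof (induction k rule: dec_induct)
  case base
  with assms(1,2) show ?case by (auto simp: point_def)
next
  case (step k)
  then have k: "1 \<le> k" "k < dual N m k" "k \<in> {1..N + 2 * m}" "k \<le> N + m"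
    by (auto simp: dual_def)
  from step k obtain w where gl: "gl_stage k" and w: "crossing k p (point k) w"
    "c = (\<Prod>i\<leftarrow>[1..<k]. h i (point i) * hi i (point (Suc i))) * w"
    by auto
  interpret gauss_step scal "par N m" "K k" k "h k" "hi k" "nd k"
    using k(1,2) gl by (rule gauss_step_stage)
  let ?q = "point k" and ?r = "point (Suc k)"
  have comm: "h k ?q * h k ?r = h k ?r * h k ?q"
    using gl_rel_same_commute[OF rel[OF nd_pivot nd_pivot]] by (simp add: D)
  \<comment> \<open>Solves the update of \<open>w\<close> in \<open>crossing_Suc\<close> for the old
    value; \<open>comm\<close> brings the two pivot factors into the order of the formula.\<close>
  have "h k ?q * hi k ?r * (hi k ?q * h k ?r * w) =
      (h k ?q * (hi k ?r * (hi k ?q * (h k ?r * (h k ?q * hi k ?q))))) * w"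
    using k(3) by (simp add: h_inv mult.assoc)
  also have "\<dots> = (h k ?q * (hi k ?r * (hi k ?q * (h k ?q * (h k ?r * hi k ?q))))) * w"
    by (simp only: mult.assoc[symmetric] comm)
  also have "\<dots> = w"
    using k(3) by (simp add: h_inv(1)) (simp add: h_inv flip: mult.assoc)
  finally have "h k ?q * hi k ?r * (hi k ?q * h k ?r * w) = w" .
  then have "c = (\<Prod>i\<leftarrow>[1..<Suc k]. h i (point i) * hi i (point (Suc i))) * (hi k ?q * h k ?r * w)"
    using k(1) w(2) by (simp add: mult.assoc)
  moreover have "crossing (Suc k) p ?r (hi k ?q * h k ?r * w)"
    using crossing_Suc[OF k(1,2) gl w(1) refl] point_Suc[OF k(1,4)] by simp
  ultimately show ?case
    using gl_stage_Suc[OF k(1,2) gl] by auto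
qed

lemma commute_mult: "x * y = y * x \<Longrightarrow> x * z = z * x \<Longrightarrow> x * (y * z) = y * z * (x :: 'b)"
  by (metis mult.assoc)

text \<open>Later Schur complements are built from the entries of an earlier one and inverses of
  pivots, and whatever commutes with an invertible element commutes with its inverse.\<close>

lemma K_commute:
  assumes "\<And>a b. a \<in> {k..dual N m k} \<Longrightarrow> b \<in> {k..dual N m k} \<Longrightarrow> K k a b p * x = x * K k a b p"
    and "k \<le> l" "l \<le> dual N m l" "1 \<le> k"
    and "a \<in> {l..dual N m l}" "b \<in> {l..dual N m l}"
  shows "K l a b p * x = x * K l a b p"
  using assms(2,3,5,6)
proof (induction l arbitrary: a b rule: dec_induct)
  case base
  with assms(1) show ?case by blast
next
  case (step l)
  have l: "l \<in> {1..N + 2 * m}" using step assms(4) by (auto simp: dual_def)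
  have IH: "K l a b p * x = x * K l a b p" if "a \<in> {l..dual N m l}" "b \<in> {l..dual N m l}" for a b
    using step that by (auto simp: dual_def)
  have sub: "a \<in> {l..dual N m l}" "b \<in> {l..dual N m l}" "l \<in> {l..dual N m l}"
    using step by (auto simp: dual_def)
  have hx: "h l p * x = x * h l p"
    using IH[OF sub(3,3)] by (simp add: K_pivot[OF l])
  have "hi l p * x = hi l p * (x * h l p) * hi l p"
    using l by (simp add: h_inv mult.assoc)
  also have "\<dots> = x * hi l p"
    unfolding hx[symmetric] using l by (simp add: h_inv flip: mult.assoc)
  finally have hix: "hi l p * x = x * hi l p" .
  have "K l a l p * hi l p * K l l b p * x = x * (K l a l p * hi l p * K l l b p)"
    using IH[of a l] IH[of l b] sub hix by (intro commute_mult[symmetric] commute_mult) simp_all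
  then show ?case
    using IH[of a b] sub by (simp add: K_Suc[OF l] left_diff_distrib right_diff_distrib)
qed

lemma commute_prod_list:
  "(\<And>y. y \<in> set ys \<Longrightarrow> x * y = y * x) \<Longrightarrow> x * prod_list ys = prod_list ys * (x :: 'b)"
  by (induction ys) (simp_all add: commute_mult)

text \<open>
  The last index is its own dual, so that \<open>gl_rel\<close> does not give the commutativity of the last two
  factors.  Instead, \<open>c\<close> commutes with the last pivot at \<open>p\<close>, and so do the other pivots, since \<open>p\<close> is
  half-integral and the points are integral.
\<close>

lemma gauss_chain_odd:
  assumes "gl_stage 1" "crossing 1 p 0 c"
    and N: "N = 2 * n + 1" and p: "p = - kappa N m"
    and c: "\<And>a b. a \<in> {1..N + 2 * m} \<Longrightarrow> b \<in> {1..N + 2 * m} \<Longrightarrow> K 1 a b p * c = c * K 1 a b p"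
  shows "c = (\<Prod>i\<leftarrow>[1..<m + n + 1]. h i (point i) * hi i (point (Suc i))) *
    (h (m + n + 1) p * h (m + n + 1) (point (m + n + 1)))"
proof -
  let ?k = "m + n + 1"
  let ?P = "\<Prod>i\<leftarrow>[1..<?k]. h i (point i) * hi i (point (Suc i))"
  have k: "dual N m ?k = ?k" "?k \<in> {1..N + 2 * m}"
    by (simp_all add: dual_def N)
  have th: "theta N m ?k = (1 :: 'b)"
    by (simp add: theta_def N)
  obtain w where cr: "crossing ?k p (point ?k) w" and cw: "c = ?P * w"
    using crossing_chain[OF assms(1,2), of ?k] k by auto
  have w: "w = h ?k (point ?k) * h ?k p"
    using cr k th by (simp add: crossing_def super_transpose_def K_pivot minus_one_power_iff)
  have hc: "h ?k p * c = c * h ?k p"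
    using K_commute[of 1 p c ?k ?k ?k] c k by (simp add: K_pivot dual_def)
  \<comment> \<open>\<open>2 * p\<close> is the odd integer \<open>2 * m - 2 * n + 1\<close>,
    whereas \<open>2 * point i\<close> is even.\<close>
  have point_p: "point i \<noteq> p" for i
  proof
    assume "point i = p"
    then have "2 * point i = 2 * p" by simp
    moreover have "2 * point i = of_int (if i \<le> Suc m then 2 * (int i - 1) else 2 * (2 * int m + 1 - int i))"
      by (simp add: point_def)
    moreover have "2 * p = of_int (2 * int m - 2 * int n + 1)"
      by (simp add: p kappa_def N field_simps)
    ultimately have "(if i \<le> Suc m then 2 * (int i - 1) else 2 * (2 * int m + 1 - int i)) =
        2 * int m - 2 * int n + 1"
      by (simp only: of_int_eq_iff)
    then show False by (cases "i \<le> Suc m") (simp_all, presburger+)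
  qed
  have hh: "h ?k p * h i (point r) = h i (point r) * h ?k p" if "i \<in> {1..<?k}" for i r
  proof -
    have i: "1 \<le> i" "i < dual N m i" "i \<in> {1..N + 2 * m}" "i \<le> dual N m i"
      using that by (auto simp: dual_def N)
    interpret gauss_step scal "par N m" "K i" i "h i" "hi i" "nd i"
      using i crossing_chain[OF assms(1,2) i(1,4)] by (intro gauss_step_stage) auto
    have schur: "schur = K (Suc i)"
      by (intro ext) (simp add: schur_def K_Suc[OF i(3)])
    \<comment> \<open>The complement after pivot \<open>i\<close> commutes with that pivot at every
      other point. The last pivot inherits this as an entry of a later complement.\<close>
    have "K (Suc i) a b p * h i (point r) = h i (point r) * K (Suc i) a b p"
      if "a \<in> {Suc i..dual N m (Suc i)}" "b \<in> {Suc i..dual N m (Suc i)}" for a b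
      unfolding schur[symmetric]
      using that i point_p[of r] by (intro schur_pivot_commute) (auto simp: nd_def dual_def)
    from K_commute[of "Suc i", OF this, of ?k ?k ?k] show ?thesis
      using that k by (simp add: K_pivot)
  qed
  have hhi: "h ?k p * hi i (point r) = hi i (point r) * h ?k p" if "i \<in> {1..<?k}" for i r
  proof -
    have i: "i \<in> {1..N + 2 * m}" using that by (auto simp: N)
    have "h ?k p * hi i (point r) = hi i (point r) * (h i (point r) * h ?k p) * hi i (point r)"
      using i by (simp add: h_inv flip: mult.assoc)
    also have "\<dots> = hi i (point r) * h ?k p"
      unfolding hh[OF that, symmetric] using i by (simp add: h_inv mult.assoc)
    finally show ?thesis .
  qed
  have hP: "h ?k p * ?P = ?P * h ?k p"
    using hh hhi by (intro commute_prod_list) (auto intro!: commute_mult)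
  have Pinv: "\<exists>y. y * prod_list (map (\<lambda>i. h i (point i) * hi i (point (Suc i))) xs) = 1"
    if "set xs \<subseteq> {1..<?k}" for xs
    using that
  proof (induction xs)
    case (Cons i xs)
    then obtain y where y: "y * prod_list (map (\<lambda>i. h i (point i) * hi i (point (Suc i))) xs) = 1"
      by auto
    have i: "i \<in> {1..N + 2 * m}" using Cons by (auto simp: N)
    have "y * h i (point (Suc i)) * hi i (point i) *
        prod_list (map (\<lambda>i. h i (point i) * hi i (point (Suc i))) (i # xs)) =
      y * (h i (point (Suc i)) * (hi i (point i) * h i (point i)) * hi i (point (Suc i))) *
        prod_list (map (\<lambda>i. h i (point i) * hi i (point (Suc i))) xs)"
      by (simp add: mult.assoc)
    also have "\<dots> = 1"
      using i y by (simp add: h_inv)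
    finally have "y * h i (point (Suc i)) * hi i (point i) *
        prod_list (map (\<lambda>i. h i (point i) * hi i (point (Suc i))) (i # xs)) = 1" .
    then show ?case by blast
  qed simp
  obtain y where y: "y * ?P = 1"
    using Pinv[of "[1..<?k]"] by (auto simp del: upt_Suc)
  \<comment> \<open>This is \<open>hc\<close> with \<open>c = ?P * w\<close>: the product is moved
    to the front and cancelled. Writing out \<open>w\<close> and cancelling \<open>h ?k p\<close> on
    the right then gives the commutation of the last two factors.\<close>
  have "?P * (h ?k p * w) = ?P * (w * h ?k p)"
    using hc by (simp only: cw mult.assoc[symmetric] hP)
  then have "y * ?P * (h ?k p * w) = y * ?P * (w * h ?k p)"
    by (simp only: mult.assoc)
  then have "h ?k p * w = w * h ?k p"
    unfolding y by simp
  then have "h ?k p * (h ?k (point ?k) * h ?k p) * hi ?k p = h ?k (point ?k) * h ?k p * h ?k p * hi ?k p"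
    by (simp only: w)
  then have "h ?k p * h ?k (point ?k) = w"
    using k(2) by (simp add: w mult.assoc h_inv)
  with cw show ?thesis by simp
qed

text \<open>The indices \<open>m + n\<close> and \<open>m + n + 1\<close> are dual and a block of
  size two remains. Eliminating its first column at \<open>p\<close> only leaves a single term in
  the last diagonal entry: transposition puts \<open>h (m + n)\<close> there, and the next Schur
  complement is \<open>h (m + n + 1)\<close>. The transpose is not eliminated once more, so no
  fraction arises for \<open>m + n\<close>.\<close>

lemma gauss_chain_even:
  assumes "gl_stage 1" "crossing 1 p 0 c"
    and N: "N = 2 * n" "1 \<le> n"
  shows "c = (\<Prod>i\<leftarrow>[1..<m + n]. h i (point i) * hi i (point (Suc i))) *
    (h (m + n) (point (m + n)) * h (m + n + 1) p)"
proof -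
  let ?k = "m + n"
  have k: "dual N m ?k = Suc ?k" "?k \<in> {1..N + 2 * m}" "Suc ?k \<in> {1..N + 2 * m}"
    using N by (auto simp: dual_def)
  have th: "theta N m (Suc ?k) = (1 :: 'b)"
    using N by (simp add: theta_def)
  have d: "dual N m (Suc ?k) = ?k" using N by (simp add: dual_def)
  obtain w where cr: "crossing ?k p (point ?k) w"
      and cw: "c = (\<Prod>i\<leftarrow>[1..<?k]. h i (point i) * hi i (point (Suc i))) * w"
    using crossing_chain[OF assms(1,2), of ?k] k by auto
  have S: "{?k..Suc ?k} - {?k} = {Suc ?k}" by auto
  have "(\<Sum>l\<in>{?k..Suc ?k} - {?k}. super_transpose N m (\<lambda>a b. K ?k a b (point ?k)) (Suc ?k) l *
      (K ?k l (Suc ?k) p - K ?k l ?k p * hi ?k p * K ?k ?k (Suc ?k) p)) =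
      (if Suc ?k = Suc ?k then w else 0)"
    using cr k(2) unfolding crossing_def k(1)
    by (intro sum_schur_right) (auto simp: K_pivot h_inv simp del: sum.atLeast_Suc_atMost)
  then have "w = super_transpose N m (\<lambda>a b. K ?k a b (point ?k)) (Suc ?k) (Suc ?k) *
      K (Suc ?k) (Suc ?k) (Suc ?k) p"
    unfolding S by (simp add: K_Suc[OF k(2)])
  also have "\<dots> = h ?k (point ?k) * h (Suc ?k) p"
    using k th by (simp add: super_transpose_def d K_pivot minus_one_power_iff)
  finally show ?thesis using cw by simp
qed

end

section \<open>Components of the RTT relation\<close>

lemma minus_one_power_central: "x * (- 1) ^ n = (- 1) ^ n * (x :: 'a::ring_1)"
  by (simp add: minus_one_power_iff)

lemma sign_rearrange:
  assumes "even (a + b + c + d)"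
  shows "(- 1) ^ a * (z * ((- 1) ^ b * u)) = (- 1) ^ c * (z * ((- 1) ^ d * (u :: 'a::ring_1)))"
  using assms by (auto simp: minus_one_power_iff)

lemma if_expand:
  "e * ((a * (if p then 1 else 0) - b * (if q then g else 0) + c * (if r \<and> s then k else 0)) * u * v) =
    (if p then e * (a * (u * v)) else 0) - (if q then e * (b * (g * (u * v))) else 0)
    + (if s then if r then e * (c * (k * (u * v))) else 0 else (0 :: 'a::ring_1))"
  by (simp add: algebra_simps)

text \<open>Serves both the parity automorphism of the free algebra and the projection onto the
  Yangian, applied to the coefficients of series in two variables.\<close>

locale ring_1_hom =
  fixes f :: "'a::ring_1 \<Rightarrow> 'b::ring_1"
  assumes map_1: "f 1 = 1" and map_add: "f (a + b) = f a + f b" and map_mult: "f (a * b) = f a * f b"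
begin

lemma map_0: "f 0 = 0"
  using map_add[of 0 0] by simp

lemma map_uminus: "f (- a) = - f a"
  using map_add[of "- a" a] by (simp add: map_0 eq_neg_iff_add_eq_0)

lemma map_sum: "f (sum g A) = (\<Sum>x\<in>A. f (g x))"
  by (induction A rule: infinite_finite_induct) (simp_all add: map_0 map_add)

lemma map2_nth: "fps_nth (fps_nth (fps_map2 f X) s) r = f (fps_nth (fps_nth X s) r)"
  by (simp add: fps_map2_def)

lemma map2_eqI: "(\<And>s r. fps_nth (fps_nth X s) r = fps_nth (fps_nth Y s) r) \<Longrightarrow> X = Y"
  by (simp add: fps_ext)

lemma map2_0: "fps_map2 f 0 = 0"
  by (rule map2_eqI) (simp add: map2_nth map_0)

lemma map2_1: "fps_map2 f 1 = 1"
  by (rule map2_eqI) (simp add: map2_nth map_0 map_1)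

lemma map2_add: "fps_map2 f (X + Y) = fps_map2 f X + fps_map2 f Y"
  by (rule map2_eqI) (simp add: map2_nth map_add)

lemma map2_uminus: "fps_map2 f (- X) = - fps_map2 f X"
  by (rule map2_eqI) (simp add: map2_nth map_uminus)

lemma map2_diff: "fps_map2 f (X - Y) = fps_map2 f X - fps_map2 f Y"
  using map2_add[of X "- Y"] by (simp add: map2_uminus)

lemma map2_mult: "fps_map2 f (X * Y) = fps_map2 f X * fps_map2 f Y"
  by (rule map2_eqI) (simp add: map2_nth fps_mult_nth fps_sum_nth map_sum map_mult)

lemma map2_sum: "fps_map2 f (sum g A) = (\<Sum>x\<in>A. fps_map2 f (g x))"
  by (induction A rule: infinite_finite_induct) (simp_all add: map2_0 map2_add)

lemma map2_sign: "fps_map2 f ((- 1) ^ n) = (- 1) ^ n"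
  by (simp add: minus_one_power_iff map2_1 map2_uminus)

lemma map2_X: "fps_map2 f fps_X = fps_X"
  by (rule map2_eqI) (simp add: map2_nth fps_X_def map_0 map_1)

lemma map2_const_X: "fps_map2 f (fps_const fps_X) = fps_const fps_X"
  by (rule map2_eqI) (simp add: map2_nth fps_X_def map_0 map_1)

lemma map2_const_const: "fps_map2 f (fps_const (fps_const a)) = fps_const (fps_const (f a))"
  by (rule map2_eqI) (simp add: map2_nth map_0)

lemma map2_theta: "fps_map2 f (theta N m i) = theta N m i"
  by (simp add: theta_def map2_1 map2_uminus)

lemmas map2_simps = map2_0 map2_1 map2_add map2_uminus map2_diff map2_mult map2_sum map2_sign map2_X
  map2_const_X map2_const_const map2_theta

end

section \<open>Series in two variables and the cleared denominators\<close>

definition in_x :: "'a::zero fps \<Rightarrow> 'a fps fps" where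
  "in_x b = fps_const b"

definition in_y :: "'a::zero fps \<Rightarrow> 'a fps fps" where
  "in_y b = Abs_fps (\<lambda>s. fps_const (fps_nth b s))"

lemma central_mult: "F * a = a * F \<Longrightarrow> F * b = b * F \<Longrightarrow> F * (a * b) = a * b * (F :: 'a::ring_1)"
  by (metis mult.assoc)

abbreviation xvar :: "'a::ring_1 fps fps" where "xvar \<equiv> fps_const fps_X"
abbreviation yvar :: "'a::ring_1 fps fps" where "yvar \<equiv> fps_X"

text \<open>\<open>W a\<close> is \<open>x y (u - v - a)\<close> for \<open>x = u\<^sup>-\<^sup>1\<close> and \<open>y = v\<^sup>-\<^sup>1\<close>.\<close>

definition W :: "'a::ring_1 \<Rightarrow> 'a fps fps" where
  "W a = yvar - xvar - fps_const (fps_const a) * xvar * yvar"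

lemma xvar_central: "F * xvar = xvar * F"
  by (rule fps_ext) (simp add: fps_mult_fps_X_commute)

lemma yvar_central: "F * yvar = yvar * F"
  by (simp add: fps_mult_fps_X_commute)

lemma const_central: "(\<And>b. a * b = b * a) \<Longrightarrow> F * fps_const (fps_const a) = fps_const (fps_const a) * (F :: 'a::ring_1 fps fps)"
  by (rule fps_ext, rule fps_ext) simp

lemma W_central:
  assumes "\<And>b. a * b = b * a"
  shows "F * W a = W a * F"
proof -
  have "F * (fps_const (fps_const a) * xvar * yvar) = F * fps_const (fps_const a) * xvar * yvar"
    by (simp only: mult.assoc)
  also have "\<dots> = fps_const (fps_const a) * (F * xvar) * yvar"
    by (simp only: const_central[OF assms] mult.assoc)
  also have "\<dots> = fps_const (fps_const a) * xvar * (F * yvar)"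
    by (simp only: xvar_central[of F] mult.assoc)
  also have "\<dots> = fps_const (fps_const a) * xvar * yvar * F"
    by (simp only: yvar_central[of F] mult.assoc)
  finally have "F * (fps_const (fps_const a) * xvar * yvar) = fps_const (fps_const a) * xvar * yvar * F" .
  then show ?thesis
    unfolding W_def right_diff_distrib left_diff_distrib by (simp only: xvar_central[of F] yvar_central[of F])
qed

text \<open>This and the next three definitions are the contributions of \<open>1\<close>,
  \<open>P\<close> and \<open>Q\<close> to one component of the relation. \<open>Q\<close>
  contributes on the left only if \<open>k\<close> is dual to \<open>i\<close> and on the right only
  if \<open>s\<close> is dual to \<open>q\<close>, hence two separate sums. A common sign is
  factored out of the first two parts.\<close>

definition ord_part ::
  "nat \<Rightarrow> nat \<Rightarrow> (nat \<Rightarrow> nat \<Rightarrow> 'a::ring_1 fps) \<Rightarrow> nat \<Rightarrow> nat \<Rightarrow> nat \<Rightarrow> nat \<Rightarrow> 'a fps fps" where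
  "ord_part N m t i q k s = in_x (t i q) * in_y (t k s)
     - (- 1) ^ ((par N m i + par N m q) * (par N m k + par N m s)) * (in_y (t k s) * in_x (t i q))"

definition perm_part ::
  "nat \<Rightarrow> nat \<Rightarrow> (nat \<Rightarrow> nat \<Rightarrow> 'a::ring_1 fps) \<Rightarrow> nat \<Rightarrow> nat \<Rightarrow> nat \<Rightarrow> nat \<Rightarrow> 'a fps fps" where
  "perm_part N m t i q k s =
     (- 1) ^ (par N m i * par N m q + par N m i * par N m k + par N m q * par N m k) *
     (in_x (t k q) * in_y (t i s) - in_y (t k q) * in_x (t i s))"

definition Q_left ::
  "nat \<Rightarrow> nat \<Rightarrow> (nat \<Rightarrow> nat \<Rightarrow> 'a::ring_1 fps) \<Rightarrow> nat \<Rightarrow> nat \<Rightarrow> nat \<Rightarrow> 'a fps fps" where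
  "Q_left N m t i q s = (\<Sum>j\<in>{1..N + 2 * m}.
     (- 1) ^ (par N m i * par N m q + par N m s * par N m q + par N m j * par N m q + par N m q + par N m s) *
     theta N m i * theta N m j * (in_x (t j q) * in_y (t (dual N m j) s)))"

definition Q_right ::
  "nat \<Rightarrow> nat \<Rightarrow> (nat \<Rightarrow> nat \<Rightarrow> 'a::ring_1 fps) \<Rightarrow> nat \<Rightarrow> nat \<Rightarrow> nat \<Rightarrow> 'a fps fps" where
  "Q_right N m t i q k = (\<Sum>j\<in>{1..N + 2 * m}.
     (- 1) ^ (par N m k * par N m q + par N m j + par N m i * par N m j) *
     theta N m j * theta N m q * (in_y (t k (dual N m j)) * in_x (t i j)))"

text \<open>The defect is expanded in the free algebra, where the relators and the parity
  automorphism are defined. Once \<open>\<sigma>\<close> has been turned into signs, the expansion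
  can be projected onto the Yangian.\<close>

locale rtt_matrix = ring_1_hom \<sigma> for \<sigma> :: "'a::ring_1 \<Rightarrow> 'a" +
  fixes N m :: nat and \<kappa> :: 'a and t :: "nat \<Rightarrow> nat \<Rightarrow> 'a fps"
  assumes \<sigma>_\<kappa>: "\<sigma> \<kappa> = \<kappa>" and \<kappa>_central: "\<kappa> * a = a * \<kappa>"
    and \<sigma>_t: "i \<in> {1..N + 2 * m} \<Longrightarrow> j \<in> {1..N + 2 * m} \<Longrightarrow>
      \<sigma> (fps_nth (t i j) r) = (- 1) ^ (par N m i + par N m j) * fps_nth (t i j) r"
begin

abbreviation "I \<equiv> {1..N + 2 * m}"
abbreviation "\<pi> \<equiv> par N m"
abbreviation "R \<equiv> R_cleared N m \<kappa>"
abbreviation "S \<equiv> fps_map2 \<sigma>"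
abbreviation "tx i j \<equiv> in_x (t i j)"
abbreviation "ty i j \<equiv> in_y (t i j)"

lemma S_R: "(S ^^ n) (R i j k l) = R i j k l"
proof -
  have "S (tens_one i j k l) = tens_one i j k l" "S (P_op N m i j k l) = P_op N m i j k l"
    "S (Q_op N m i j k l) = Q_op N m i j k l"
    unfolding tens_one_def P_op_def Q_op_def by (simp_all add: map2_simps)
  then have "S (R i j k l) = R i j k l"
    unfolding R_cleared_def Let_def by (simp only: map2_simps \<sigma>_\<kappa>)
  then show ?thesis by (induction n) simp_all
qed

lemma S_sign: "(S ^^ n) ((- 1) ^ r * X) = (- 1) ^ r * (S ^^ n) X"
  by (induction n) (simp_all add: map2_simps)

lemma S_mult: "(S ^^ n) (X * Y) = (S ^^ n) X * (S ^^ n) Y"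
  by (induction n) (simp_all add: map2_simps)

lemma S_sum: "(S ^^ n) (sum g A) = (\<Sum>x\<in>A. (S ^^ n) (g x))"
  by (induction n) (simp_all add: map2_simps)

lemma S_tx: "i \<in> I \<Longrightarrow> j \<in> I \<Longrightarrow> (S ^^ n) (tx i j) = (- 1) ^ (n * (\<pi> i + \<pi> j)) * tx i j"
proof (induction n)
  case (Suc n)
  have "S (tx i j) = (- 1) ^ (\<pi> i + \<pi> j) * tx i j"
    using Suc.prems by (intro map2_eqI) (auto simp: map2_nth \<sigma>_t minus_one_power_iff map_0 in_x_def)
  with Suc show ?case
    by (simp add: map2_simps) (simp add: minus_one_power_iff)
qed simp

lemma S_ty: "i \<in> I \<Longrightarrow> j \<in> I \<Longrightarrow> (S ^^ n) (ty i j) = (- 1) ^ (n * (\<pi> i + \<pi> j)) * ty i j"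
proof (induction n)
  case (Suc n)
  have "S (ty i j) = (- 1) ^ (\<pi> i + \<pi> j) * ty i j"
    using Suc.prems by (intro map2_eqI) (auto simp: map2_nth \<sigma>_t minus_one_power_iff map_0 in_y_def)
  with Suc show ?case
    by (simp add: map2_simps) (simp add: minus_one_power_iff)
qed simp

lemma S_0: "(S ^^ n) 0 = 0"
  by (induction n) (simp_all add: map2_simps)

lemma T1_delta: "T1_op N m t i j k l =
    (if k = l then (- 1) ^ (\<pi> i * \<pi> j + \<pi> j) * tx i j else 0)"
  and T2_delta: "T2_op N m t i j k l =
    (if i = j then (- 1) ^ (\<pi> k * \<pi> l + \<pi> l) * ty k l else 0)"
  by (simp_all add: T1_op_def T2_op_def in_x_def in_y_def)

lemma RT1:
  assumes "l \<in> I"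
  shows "tens_mult N m S R (T1_op N m t) i j k l =
    (\<Sum>a\<in>I. (- 1) ^ ((\<pi> k + \<pi> l) * (\<pi> a + \<pi> j) + \<pi> a * \<pi> j + \<pi> j) * (R i a k l * tx a j))"
proof -
  have "tens_mult N m S R (T1_op N m t) i j k l = (\<Sum>a\<in>I. \<Sum>b\<in>I.
      if b = l then (- 1) ^ ((\<pi> k + \<pi> b) * (\<pi> a + \<pi> j)) * R i a k b *
        ((- 1) ^ (\<pi> a * \<pi> j + \<pi> j) * tx a j) else 0)"
    unfolding tens_mult_def T1_delta S_R by (intro sum.cong refl) auto
  also have "\<dots> = (\<Sum>a\<in>I. (- 1) ^ ((\<pi> k + \<pi> l) * (\<pi> a + \<pi> j)) * R i a k l *
        ((- 1) ^ (\<pi> a * \<pi> j + \<pi> j) * tx a j))"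
    using assms by simp
  also have "\<dots> = (\<Sum>a\<in>I. (- 1) ^ ((\<pi> k + \<pi> l) * (\<pi> a + \<pi> j) + \<pi> a * \<pi> j + \<pi> j) *
      (R i a k l * tx a j))"
    by (intro sum.cong refl) (cases "even (\<pi> l)"; cases "even (\<pi> k)"; cases "even (\<pi> j)";
      simp add: minus_one_power_iff mult.assoc)
  finally show ?thesis .
qed

lemma RT1T2:
  assumes "i \<in> I" "q \<in> I" "k \<in> I" "s \<in> I"
  shows "tens_mult N m S (tens_mult N m S R (T1_op N m t)) (T2_op N m t) i q k s =
    (\<Sum>j\<in>I. \<Sum>l\<in>I. (- 1) ^ ((\<pi> k + \<pi> s) * (\<pi> j + \<pi> q) + \<pi> j * \<pi> q + \<pi> q + \<pi> l * \<pi> s + \<pi> s) *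
      (R i j k l * tx j q * ty l s))"
proof -
  have e: "(- 1) ^ (n * (\<pi> q + \<pi> q)) = (1 :: 'a fps fps)" for n
    by (simp add: minus_one_power_iff)
  have "tens_mult N m S (tens_mult N m S R (T1_op N m t)) (T2_op N m t) i q k s =
    (\<Sum>j\<in>I. if j = q then (\<Sum>l\<in>I. (- 1) ^ ((\<pi> k + \<pi> l) * (\<pi> q + \<pi> q)) *
      (S ^^ (\<pi> q + \<pi> q + \<pi> l + \<pi> s)) (tens_mult N m S R (T1_op N m t) i q k l) *
      ((- 1) ^ (\<pi> l * \<pi> s + \<pi> s) * ty l s)) else 0)"
    unfolding tens_mult_def[of N m S "tens_mult N m S R (T1_op N m t)"] T2_delta
    by (intro sum.cong refl) auto
  also have "\<dots> = (\<Sum>l\<in>I. (S ^^ (\<pi> q + \<pi> q + \<pi> l + \<pi> s)) (tens_mult N m S R (T1_op N m t) i q k l) *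
      ((- 1) ^ (\<pi> l * \<pi> s + \<pi> s) * ty l s))"
    using assms by (simp add: e)
  also have "\<dots> = (\<Sum>l\<in>I. \<Sum>j\<in>I.
      (- 1) ^ ((\<pi> k + \<pi> s) * (\<pi> j + \<pi> q) + \<pi> j * \<pi> q + \<pi> q + \<pi> l * \<pi> s + \<pi> s) *
      (R i j k l * tx j q * ty l s))"
  proof (intro sum.cong refl)
    fix l assume l: "l \<in> I"
    show "(S ^^ (\<pi> q + \<pi> q + \<pi> l + \<pi> s)) (tens_mult N m S R (T1_op N m t) i q k l) *
      ((- 1) ^ (\<pi> l * \<pi> s + \<pi> s) * ty l s) =
      (\<Sum>j\<in>I. (- 1) ^ ((\<pi> k + \<pi> s) * (\<pi> j + \<pi> q) + \<pi> j * \<pi> q + \<pi> q + \<pi> l * \<pi> s + \<pi> s) *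
      (R i j k l * tx j q * ty l s))"
      unfolding RT1[OF l] S_sum S_sign
      unfolding S_mult S_R sum_distrib_right
    proof (intro sum.cong refl)
      fix j assume j: "j \<in> I"
      show "(- 1) ^ ((\<pi> k + \<pi> l) * (\<pi> j + \<pi> q) + \<pi> j * \<pi> q + \<pi> q) *
          (R i j k l * (S ^^ (\<pi> q + \<pi> q + \<pi> l + \<pi> s)) (tx j q)) *
          ((- 1) ^ (\<pi> l * \<pi> s + \<pi> s) * ty l s) =
        (- 1) ^ ((\<pi> k + \<pi> s) * (\<pi> j + \<pi> q) + \<pi> j * \<pi> q + \<pi> q + \<pi> l * \<pi> s + \<pi> s) *
          (R i j k l * tx j q * ty l s)"
        unfolding S_tx[OF j assms(2)]
        by (cases "even (\<pi> j)"; cases "even (\<pi> l)"; cases "even (\<pi> k)"; cases "even (\<pi> q)";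
            cases "even (\<pi> s)"; simp add: minus_one_power_iff mult.assoc)
    qed
  qed
  also have "\<dots> = (\<Sum>j\<in>I. \<Sum>l\<in>I.
      (- 1) ^ ((\<pi> k + \<pi> s) * (\<pi> j + \<pi> q) + \<pi> j * \<pi> q + \<pi> q + \<pi> l * \<pi> s + \<pi> s) *
      (R i j k l * tx j q * ty l s))"
    by (rule sum.swap)
  finally show ?thesis .
qed

lemma T2T1:
  assumes "i \<in> I" "j \<in> I" "k \<in> I" "l \<in> I"
  shows "tens_mult N m S (T2_op N m t) (T1_op N m t) i j k l =
    (- 1) ^ (\<pi> k * \<pi> l + \<pi> l + \<pi> i * \<pi> j + \<pi> j) * (ty k l * tx i j)"
proof -
  have "tens_mult N m S (T2_op N m t) (T1_op N m t) i j k l = (\<Sum>a\<in>I. \<Sum>b\<in>I.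
      if b = l then (if a = i then (- 1) ^ ((\<pi> k + \<pi> b) * (\<pi> a + \<pi> j)) *
        (S ^^ (\<pi> a + \<pi> j + \<pi> b + \<pi> l)) ((- 1) ^ (\<pi> k * \<pi> b + \<pi> b) * ty k b)
        * ((- 1) ^ (\<pi> a * \<pi> j + \<pi> j) * tx a j) else 0) else 0)"
    unfolding tens_mult_def T1_delta T2_delta
    by (intro sum.cong refl) (auto simp: S_0)
  also have "\<dots> = (- 1) ^ ((\<pi> k + \<pi> l) * (\<pi> i + \<pi> j)) *
        (S ^^ (\<pi> i + \<pi> j + \<pi> l + \<pi> l)) ((- 1) ^ (\<pi> k * \<pi> l + \<pi> l) * ty k l)
        * ((- 1) ^ (\<pi> i * \<pi> j + \<pi> j) * tx i j)"
    using assms by simp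
  also have "\<dots> = (- 1) ^ (\<pi> k * \<pi> l + \<pi> l + \<pi> i * \<pi> j + \<pi> j) * (ty k l * tx i j)"
    unfolding S_sign S_ty[OF assms(3,4)]
    by (cases "even (\<pi> j)"; cases "even (\<pi> l)"; cases "even (\<pi> k)"; cases "even (\<pi> i)";
      simp add: minus_one_power_iff mult.assoc)
  finally show ?thesis .
qed

text \<open>The R-matrix is even. In \<open>T2T1R\<close> the exponent of the automorphism is the
  parity of the accompanying entry of \<open>R\<close>, so odd exponents occur only next to zero
  entries.\<close>

lemma R_odd:
  assumes "odd (\<pi> i + \<pi> j + \<pi> k + \<pi> l)" "i \<in> I" "j \<in> I" "k \<in> I" "l \<in> I"
  shows "R i j k l = 0"
proof -
  have "\<pi> (dual N m a) = \<pi> a" if "a \<in> I" for a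
    using that by (auto simp: par_def dual_def)
  with assms have "tens_one i j k l = (0 :: 'a fps fps)" "P_op N m i j k l = (0 :: 'a fps fps)"
    "Q_op N m i j k l = (0 :: 'a fps fps)"
    by (auto simp: tens_one_def P_op_def Q_op_def)
  then show ?thesis
    by (simp add: R_cleared_def Let_def)
qed

lemma T2T1R:
  assumes "i \<in> I" "q \<in> I" "k \<in> I" "s \<in> I"
  shows "tens_mult N m S (tens_mult N m S (T2_op N m t) (T1_op N m t)) R i q k s =
    (\<Sum>j\<in>I. \<Sum>l\<in>I. (- 1) ^ ((\<pi> k + \<pi> l) * (\<pi> j + \<pi> q) + \<pi> k * \<pi> l + \<pi> l + \<pi> i * \<pi> j + \<pi> j) *
      (ty k l * tx i j * R j q l s))"
  unfolding tens_mult_def[of N m S "tens_mult N m S (T2_op N m t) (T1_op N m t)"]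
proof (intro sum.cong refl)
  fix j l assume jl: "j \<in> I" "l \<in> I"
  show "(- 1) ^ ((\<pi> k + \<pi> l) * (\<pi> j + \<pi> q)) *
      (S ^^ (\<pi> j + \<pi> q + \<pi> l + \<pi> s)) (tens_mult N m S (T2_op N m t) (T1_op N m t) i j k l) *
      R j q l s =
    (- 1) ^ ((\<pi> k + \<pi> l) * (\<pi> j + \<pi> q) + \<pi> k * \<pi> l + \<pi> l + \<pi> i * \<pi> j + \<pi> j) *
      (ty k l * tx i j * R j q l s)"
  proof (cases "even (\<pi> j + \<pi> q + \<pi> l + \<pi> s)")
    case True
    then show ?thesis
      unfolding T2T1[OF assms(1) jl(1) assms(3) jl(2)] S_sign
      unfolding S_mult S_tx[OF assms(1) jl(1)] S_ty[OF assms(3) jl(2)]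
      by (cases "even (\<pi> j)"; cases "even (\<pi> l)"; cases "even (\<pi> k)"; cases "even (\<pi> i)";
        cases "even (\<pi> q)"; simp add: minus_one_power_iff mult.assoc)
  next
    case False
    then show ?thesis using R_odd[of j q l s] jl assms by simp
  qed
qed

lemma sum_delta2:
  assumes "a \<in> I" "b \<in> I"
  shows "(\<Sum>j\<in>I. \<Sum>l\<in>I. if j = a \<and> l = b then g j l else (0 :: 'a fps fps)) = g a b"
proof -
  have "(\<Sum>j\<in>I. \<Sum>l\<in>I. if j = a \<and> l = b then g j l else 0) =
    (\<Sum>j\<in>I. if j = a then (\<Sum>l\<in>I. if l = b then g j l else 0) else 0)"
    by (intro sum.cong refl) auto
  with assms show ?thesis by simp
qed

lemma R_split: "R i j k l = W 0 * W \<kappa> * tens_one i j k l - xvar * yvar * W \<kappa> * P_op N m i j k l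
    + xvar * yvar * W 0 * Q_op N m i j k l"
  by (simp add: R_cleared_def Let_def W_def)

lemma dual_mem: "i \<in> I \<Longrightarrow> dual N m i \<in> I"
  by (auto simp: dual_def)

lemma par_dual: "i \<in> I \<Longrightarrow> \<pi> (dual N m i) = \<pi> i"
  by (auto simp: par_def dual_def)

abbreviation "sgn_x i q k s \<equiv>
  (- 1) ^ ((\<pi> k + \<pi> s) * (\<pi> i + \<pi> q) + \<pi> i * \<pi> q + \<pi> q + \<pi> k * \<pi> s + \<pi> s)"

lemma left_sum:
  assumes "i \<in> I" "q \<in> I" "k \<in> I" "s \<in> I"
  shows "(\<Sum>j\<in>I. \<Sum>l\<in>I. (- 1) ^ ((\<pi> k + \<pi> s) * (\<pi> j + \<pi> q) + \<pi> j * \<pi> q + \<pi> q + \<pi> l * \<pi> s + \<pi> s) *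
      (R i j k l * tx j q * ty l s)) =
    sgn_x i q k s * (W 0 * W \<kappa> * (tx i q * ty k s)) -
    sgn_x i q k s * (xvar * yvar * W \<kappa> * ((- 1) ^ (\<pi> i * \<pi> q + \<pi> i * \<pi> k + \<pi> q * \<pi> k) * (tx k q * ty i s))) +
    xvar * yvar * W 0 * (if k = dual N m i then Q_left N m t i q s else 0)"
proof -
  let ?e = "\<lambda>j l. (- 1 :: 'a fps fps) ^ ((\<pi> k + \<pi> s) * (\<pi> j + \<pi> q) + \<pi> j * \<pi> q + \<pi> q + \<pi> l * \<pi> s + \<pi> s)"
  have "(\<Sum>j\<in>I. \<Sum>l\<in>I. ?e j l * (R i j k l * tx j q * ty l s)) =
     (\<Sum>j\<in>I. \<Sum>l\<in>I. if j = i \<and> l = k then ?e j l * (W 0 * W \<kappa> * (tx j q * ty l s)) else 0)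
     - (\<Sum>j\<in>I. \<Sum>l\<in>I. if j = k \<and> l = i then ?e j l * (xvar * yvar * W \<kappa> * ((- 1) ^ \<pi> j * (tx j q * ty l s))) else 0)
     + (\<Sum>j\<in>I. \<Sum>l\<in>I. if l = dual N m j then (if k = dual N m i then
        ?e j l * (xvar * yvar * W 0 * ((- 1) ^ (\<pi> i * \<pi> j) * theta N m i * theta N m j * (tx j q * ty l s))) else 0) else 0)"
    unfolding sum_subtractf[symmetric] sum.distrib[symmetric]
  proof (intro sum.cong refl)
    fix j l
    have c: "(i = j \<and> k = l) = (j = i \<and> l = k)" "(k = j \<and> l = i) = (j = k \<and> l = i)"
      by auto
    show "?e j l * (R i j k l * tx j q * ty l s) =
      (if j = i \<and> l = k then ?e j l * (W 0 * W \<kappa> * (tx j q * ty l s)) else 0)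
      - (if j = k \<and> l = i then ?e j l * (xvar * yvar * W \<kappa> * ((- 1) ^ \<pi> j * (tx j q * ty l s))) else 0)
      + (if l = dual N m j then (if k = dual N m i then
        ?e j l * (xvar * yvar * W 0 * ((- 1) ^ (\<pi> i * \<pi> j) * theta N m i * theta N m j * (tx j q * ty l s))) else 0) else 0)"
      unfolding R_split tens_one_def P_op_def Q_op_def c by (rule if_expand)
  qed
  also have "(\<Sum>j\<in>I. \<Sum>l\<in>I. if l = dual N m j then (if k = dual N m i then
        ?e j l * (xvar * yvar * W 0 * ((- 1) ^ (\<pi> i * \<pi> j) * theta N m i * theta N m j * (tx j q * ty l s))) else 0) else 0)
     = xvar * yvar * W 0 * (if k = dual N m i then Q_left N m t i q s else 0)"
    (is "?L = _")
  proof (cases "k = dual N m i")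
    case True
    have "?L = (\<Sum>j\<in>I. ?e j (dual N m j) * (xvar * yvar * W 0 * ((- 1) ^ (\<pi> i * \<pi> j) * theta N m i * theta N m j
        * (tx j q * ty (dual N m j) s))))"
      using True dual_mem by (simp add: sum.delta)
    also have "\<dots> = xvar * yvar * W 0 * Q_left N m t i q s"
      unfolding Q_left_def sum_distrib_left
    proof (intro sum.cong refl)
      fix j assume j: "j \<in> I"
      have k: "\<pi> k = \<pi> i" using True assms par_dual by simp
      show "?e j (dual N m j) * (xvar * yvar * W 0 * ((- 1) ^ (\<pi> i * \<pi> j) * theta N m i * theta N m j
          * (tx j q * ty (dual N m j) s))) = xvar * yvar * W 0 *
        ((- 1) ^ (\<pi> i * \<pi> q + \<pi> s * \<pi> q + \<pi> j * \<pi> q + \<pi> q + \<pi> s) *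
        theta N m i * theta N m j * (tx j q * ty (dual N m j) s))"
        unfolding par_dual[OF j] k mult.assoc[of "(- 1) ^ _"]
        by (rule sign_rearrange[where c = 0, simplified power_0 mult_1_left])
          (cases "even (\<pi> i)"; cases "even (\<pi> q)"; cases "even (\<pi> s)"; cases "even (\<pi> j)"; simp)
    qed
    finally show ?thesis using True by simp
  next
    case False
    then show ?thesis
      by (simp only: if_False if_cancel sum.neutral_const mult_zero_right)
  qed
  also have "(\<Sum>j\<in>I. \<Sum>l\<in>I. if j = i \<and> l = k then ?e j l * (W 0 * W \<kappa> * (tx j q * ty l s)) else 0)
      = sgn_x i q k s * (W 0 * W \<kappa> * (tx i q * ty k s))"
    using assms by (simp only: sum_delta2)
  also have "(\<Sum>j\<in>I. \<Sum>l\<in>I. if j = k \<and> l = i then ?e j l * (xvar * yvar * W \<kappa> * ((- 1) ^ \<pi> j * (tx j q * ty l s))) else 0)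
      = ?e k i * (xvar * yvar * W \<kappa> * ((- 1) ^ \<pi> k * (tx k q * ty i s)))"
    using assms by (simp only: sum_delta2)
  also have "\<dots> = sgn_x i q k s * (xvar * yvar * W \<kappa> * ((- 1) ^ (\<pi> i * \<pi> q + \<pi> i * \<pi> k + \<pi> q * \<pi> k) * (tx k q * ty i s)))"
    by (rule sign_rearrange)
      (cases "even (\<pi> i)"; cases "even (\<pi> q)"; cases "even (\<pi> s)"; cases "even (\<pi> k)"; simp)
  finally show ?thesis .
qed

lemma R_central: "F * R i j k l = R i j k l * F"
proof -
  have W: "F * W 0 = W 0 * F" "F * W \<kappa> = W \<kappa> * F"
    by (simp_all add: W_central \<kappa>_central)
  have theta: "F * theta N m a = theta N m a * F" for a
    by (simp add: theta_def)
  have t: "F * tens_one i j k l = tens_one i j k l * F" "F * P_op N m i j k l = P_op N m i j k l * F"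
    "F * Q_op N m i j k l = Q_op N m i j k l * F"
    unfolding tens_one_def P_op_def Q_op_def
    using central_mult[OF central_mult[OF minus_one_power_central theta] theta]
    by (simp_all add: minus_one_power_central[of F])
  note XY = xvar_central[of F] yvar_central[of F]
  show ?thesis
    unfolding R_split distrib_left distrib_right left_diff_distrib right_diff_distrib
    by (simp only: central_mult[OF central_mult[OF W] t(1)]
        central_mult[OF central_mult[OF central_mult[OF XY] W(2)] t(2)]
        central_mult[OF central_mult[OF central_mult[OF XY] W(1)] t(3)])
qed

lemma right_sum:
  assumes "i \<in> I" "q \<in> I" "k \<in> I" "s \<in> I"
  shows "(\<Sum>j\<in>I. \<Sum>l\<in>I. (- 1) ^ ((\<pi> k + \<pi> l) * (\<pi> j + \<pi> q) + \<pi> k * \<pi> l + \<pi> l + \<pi> i * \<pi> j + \<pi> j) *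
      (ty k l * tx i j * R j q l s)) =
    sgn_x i q k s * (W 0 * W \<kappa> * ((- 1) ^ ((\<pi> i + \<pi> q) * (\<pi> k + \<pi> s)) * (ty k s * tx i q))) -
    sgn_x i q k s * (xvar * yvar * W \<kappa> * ((- 1) ^ (\<pi> i * \<pi> q + \<pi> i * \<pi> k + \<pi> q * \<pi> k) * (ty k q * tx i s))) +
    xvar * yvar * W 0 * (if s = dual N m q then Q_right N m t i q k else 0)"
proof -
  let ?e = "\<lambda>j l. (- 1 :: 'a fps fps) ^ ((\<pi> k + \<pi> l) * (\<pi> j + \<pi> q) + \<pi> k * \<pi> l + \<pi> l + \<pi> i * \<pi> j + \<pi> j)"
  have "(\<Sum>j\<in>I. \<Sum>l\<in>I. ?e j l * (ty k l * tx i j * R j q l s)) =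
     (\<Sum>j\<in>I. \<Sum>l\<in>I. if j = q \<and> l = s then ?e j l * (W 0 * W \<kappa> * (ty k l * tx i j)) else 0)
     - (\<Sum>j\<in>I. \<Sum>l\<in>I. if j = s \<and> l = q then ?e j l * (xvar * yvar * W \<kappa> * ((- 1) ^ \<pi> q * (ty k l * tx i j))) else 0)
     + (\<Sum>j\<in>I. \<Sum>l\<in>I. if l = dual N m j then (if s = dual N m q then
        ?e j l * (xvar * yvar * W 0 * ((- 1) ^ (\<pi> j * \<pi> q) * theta N m j * theta N m q * (ty k l * tx i j))) else 0) else 0)"
    unfolding sum_subtractf[symmetric] sum.distrib[symmetric]
  proof (intro sum.cong refl)
    fix j l
    have c: "(l = q \<and> s = j) = (j = s \<and> l = q)" "(l = dual N m j \<and> s = dual N m q) = (s = dual N m q \<and> l = dual N m j)"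
      by auto
    show "?e j l * (ty k l * tx i j * R j q l s) =
      (if j = q \<and> l = s then ?e j l * (W 0 * W \<kappa> * (ty k l * tx i j)) else 0)
      - (if j = s \<and> l = q then ?e j l * (xvar * yvar * W \<kappa> * ((- 1) ^ \<pi> q * (ty k l * tx i j))) else 0)
      + (if l = dual N m j then (if s = dual N m q then
        ?e j l * (xvar * yvar * W 0 * ((- 1) ^ (\<pi> j * \<pi> q) * theta N m j * theta N m q * (ty k l * tx i j))) else 0) else 0)"
      unfolding R_central mult.assoc[of "R j q l s", symmetric]
      unfolding R_split tens_one_def P_op_def Q_op_def c by (rule if_expand)
  qed
  also have "(\<Sum>j\<in>I. \<Sum>l\<in>I. if l = dual N m j then (if s = dual N m q then
        ?e j l * (xvar * yvar * W 0 * ((- 1) ^ (\<pi> j * \<pi> q) * theta N m j * theta N m q * (ty k l * tx i j))) else 0) else 0)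
     = xvar * yvar * W 0 * (if s = dual N m q then Q_right N m t i q k else 0)"
    (is "?L = _")
  proof (cases "s = dual N m q")
    case True
    have "?L = (\<Sum>j\<in>I. ?e j (dual N m j) * (xvar * yvar * W 0 * ((- 1) ^ (\<pi> j * \<pi> q) * theta N m j * theta N m q
        * (ty k (dual N m j) * tx i j))))"
      using True dual_mem by (simp add: sum.delta)
    also have "\<dots> = xvar * yvar * W 0 * Q_right N m t i q k"
      unfolding Q_right_def sum_distrib_left
    proof (intro sum.cong refl)
      fix j assume j: "j \<in> I"
      show "?e j (dual N m j) * (xvar * yvar * W 0 * ((- 1) ^ (\<pi> j * \<pi> q) * theta N m j * theta N m q
          * (ty k (dual N m j) * tx i j))) = xvar * yvar * W 0 *
        ((- 1) ^ (\<pi> k * \<pi> q + \<pi> j + \<pi> i * \<pi> j) *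
        theta N m j * theta N m q * (ty k (dual N m j) * tx i j))"
        unfolding par_dual[OF j] mult.assoc[of "(- 1) ^ _"]
        by (rule sign_rearrange[where c = 0, simplified power_0 mult_1_left])
          (cases "even (\<pi> i)"; cases "even (\<pi> q)"; cases "even (\<pi> k)"; cases "even (\<pi> j)"; simp)
    qed
    finally show ?thesis using True by simp
  next
    case False
    then show ?thesis
      by (simp only: if_False if_cancel sum.neutral_const mult_zero_right)
  qed
  also have "(\<Sum>j\<in>I. \<Sum>l\<in>I. if j = q \<and> l = s then ?e j l * (W 0 * W \<kappa> * (ty k l * tx i j)) else 0)
      = ?e q s * (W 0 * W \<kappa> * (ty k s * tx i q))"
    using assms by (simp only: sum_delta2)
  also have "\<dots> = sgn_x i q k s * (W 0 * W \<kappa> * ((- 1) ^ ((\<pi> i + \<pi> q) * (\<pi> k + \<pi> s)) * (ty k s * tx i q)))"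
    by (rule sign_rearrange[where b = 0, simplified power_0 mult_1_left])
      (cases "even (\<pi> i)"; cases "even (\<pi> q)"; cases "even (\<pi> s)"; cases "even (\<pi> k)"; simp)
  also have "(\<Sum>j\<in>I. \<Sum>l\<in>I. if j = s \<and> l = q then ?e j l * (xvar * yvar * W \<kappa> * ((- 1) ^ \<pi> q * (ty k l * tx i j))) else 0)
      = ?e s q * (xvar * yvar * W \<kappa> * ((- 1) ^ \<pi> q * (ty k q * tx i s)))"
    using assms by (simp only: sum_delta2)
  also have "\<dots> = sgn_x i q k s * (xvar * yvar * W \<kappa> * ((- 1) ^ (\<pi> i * \<pi> q + \<pi> i * \<pi> k + \<pi> q * \<pi> k) * (ty k q * tx i s)))"
    by (rule sign_rearrange)
      (cases "even (\<pi> i)"; cases "even (\<pi> q)"; cases "even (\<pi> s)"; cases "even (\<pi> k)"; simp)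
  finally show ?thesis .
qed

theorem rtt_defect_eq:
  assumes "i \<in> I" "q \<in> I" "k \<in> I" "s \<in> I"
  shows "rtt_defect N m \<kappa> \<sigma> t i q k s =
    sgn_x i q k s * (W 0 * W \<kappa> * ord_part N m t i q k s) - sgn_x i q k s * (xvar * yvar * W \<kappa> * perm_part N m t i q k s)
    + xvar * yvar * W 0 * ((if k = dual N m i then Q_left N m t i q s else 0)
      - (if s = dual N m q then Q_right N m t i q k else 0))"
  unfolding rtt_defect_def Let_def RT1T2[OF assms] T2T1R[OF assms] left_sum[OF assms] right_sum[OF assms]
    ord_part_def perm_part_def right_diff_distrib
  by (simp only: diff_add_eq diff_diff_eq2 add_diff_eq diff_diff_eq diff_conv_add_uminus minus_add_distrib
      minus_minus add.assoc add.commute add.left_commute)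

end

section \<open>Substitution of central series\<close>

text \<open>The coefficients of powers of such a series move past all others, so that substituting
  it is multiplicative over a noncommutative ring; the zero constant term keeps the sums
  finite.\<close>

definition central_series :: "'a::ring_1 fps \<Rightarrow> bool" where
  "central_series g \<longleftrightarrow> fps_nth g 0 = 0 \<and> (\<forall>n b. b * fps_nth g n = fps_nth g n * b)"

lemma central_series_power: "central_series g \<Longrightarrow> b * fps_nth (g ^ i) n = fps_nth (g ^ i) n * b"
proof (induction i arbitrary: n)
  case (Suc i)
  have "b * fps_nth (g * g ^ i) n = (\<Sum>j=0..n. b * fps_nth g j * fps_nth (g ^ i) (n - j))"
    by (simp add: fps_mult_nth sum_distrib_left mult.assoc)
  also have "\<dots> = (\<Sum>j=0..n. fps_nth g j * (b * fps_nth (g ^ i) (n - j)))"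
    using Suc.prems by (simp add: central_series_def mult.assoc)
  also have "\<dots> = fps_nth (g * g ^ i) n * b"
    using Suc by (simp add: fps_mult_nth sum_distrib_right mult.assoc)
  finally show ?case by simp
qed simp

lemma central_series_power_zero: "central_series g \<Longrightarrow> n < i \<Longrightarrow> fps_nth (g ^ i) n = 0"
proof (induction i arbitrary: n)
  case (Suc i)
  have "fps_nth g j * fps_nth (g ^ i) (n - j) = 0" if "j \<le> n" for j
    using Suc that by (cases "j = 0") (auto simp: central_series_def)
  then show ?case by (simp add: fps_mult_nth)
qed simp

lemma central_series_commute: "central_series g \<Longrightarrow> f * g ^ i = g ^ i * f"
proof (rule fps_ext)
  fix n assume g: "central_series g"
  have "fps_nth (f * g ^ i) n = (\<Sum>j=0..n. fps_nth f (n - j) * fps_nth (g ^ i) j)"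
    unfolding fps_mult_nth
    by (rule sum.reindex_bij_witness[of _ "\<lambda>j. n - j" "\<lambda>j. n - j"]) auto
  then show "fps_nth (f * g ^ i) n = fps_nth (g ^ i * f) n"
    by (simp add: fps_mult_nth central_series_power[OF g])
qed

text \<open>With any bound \<open>M\<close> beyond \<open>n\<close> allowed, all coefficients up to
  \<open>M\<close> can be computed over one common range of summation.\<close>

lemma compose_nth_bound:
  assumes "central_series g" "n \<le> M"
  shows "fps_nth (a oo g) n = (\<Sum>i\<le>M. fps_nth a i * fps_nth (g ^ i) n)"
  unfolding fps_compose_nth
  using assms by (intro sum.mono_neutral_left) (auto simp: central_series_power_zero)

lemma compose_mult:
  assumes g: "central_series g"
  shows "(a * b) oo g = (a oo g) * (b oo g)"
proof (rule fps_ext)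
  fix n
  define c where "c i j = fps_nth a i * fps_nth b j * fps_nth (g ^ (i + j)) n" for i j
  have c0: "c i j = 0" if "n < i + j" for i j
    using that by (simp add: c_def central_series_power_zero[OF g])
  have "fps_nth ((a * b) oo g) n = (\<Sum>s\<le>n. \<Sum>i\<le>s. c i (s - i))"
    unfolding fps_compose_nth c_def
    by (simp add: fps_mult_nth sum_distrib_right atMost_atLeast0)
  also have "\<dots> = (\<Sum>(i, j)\<in>{(i, j). i + j \<le> n}. c i j)"
    by (simp add: sum.triangle_reindex_eq)
  \<comment> \<open>Terms outside the triangle vanish because \<open>g ^ (i + j)\<close> has order
    at least \<open>i + j\<close>; over the square the two sums separate.\<close>
  also have "\<dots> = (\<Sum>(i, j)\<in>{..n} \<times> {..n}. c i j)"
    using c0 by (intro sum.mono_neutral_left) (auto, force)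
  also have "\<dots> = (\<Sum>i\<le>n. \<Sum>j\<le>n. c i j)"
    by (rule sum.cartesian_product[symmetric])
  also have "\<dots> = (\<Sum>i\<le>n. \<Sum>j\<le>n. \<Sum>k=0..n.
      (fps_nth a i * fps_nth (g ^ i) k) * (fps_nth b j * fps_nth (g ^ j) (n - k)))"
  proof (intro sum.cong refl)
    fix i j
    have "fps_nth a i * fps_nth (g ^ i) k * (fps_nth b j * fps_nth (g ^ j) (n - k)) =
        fps_nth a i * fps_nth b j * (fps_nth (g ^ i) k * fps_nth (g ^ j) (n - k))" for k
      using central_series_power[OF g, of "fps_nth b j" i k] by (metis mult.assoc)
    then show "c i j = (\<Sum>k=0..n. fps_nth a i * fps_nth (g ^ i) k * (fps_nth b j * fps_nth (g ^ j) (n - k)))"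
      by (simp add: c_def power_add fps_mult_nth sum_distrib_left)
  qed
  also have "\<dots> = (\<Sum>i\<le>n. \<Sum>k=0..n. \<Sum>j\<le>n.
      (fps_nth a i * fps_nth (g ^ i) k) * (fps_nth b j * fps_nth (g ^ j) (n - k)))"
    by (intro sum.cong refl sum.swap)
  also have "\<dots> = (\<Sum>k=0..n. \<Sum>i\<le>n. \<Sum>j\<le>n.
      (fps_nth a i * fps_nth (g ^ i) k) * (fps_nth b j * fps_nth (g ^ j) (n - k)))"
    by (rule sum.swap)
  also have "\<dots> = fps_nth ((a oo g) * (b oo g)) n"
    unfolding fps_mult_nth
    by (intro sum.cong refl) (simp add: compose_nth_bound[OF g, of _ n] sum_product)
  finally show "fps_nth ((a * b) oo g) n = fps_nth ((a oo g) * (b oo g)) n" .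
qed

lemma compose_X: "central_series g \<Longrightarrow> fps_X oo g = g"
proof (rule fps_ext)
  fix n assume "central_series g"
  then show "fps_nth (fps_X oo g) n = fps_nth g n"
    by (cases n) (simp_all add: fps_compose_nth fps_X_def if_distrib[of "\<lambda>x. x * _"]
        central_series_def cong: if_cong)
qed

lemma compose_const: "fps_const a oo g = fps_const a"
  by (rule fps_ext) (simp add: fps_compose_nth if_distrib[of "\<lambda>x. x * _"] cong: if_cong)

text \<open>The series \<open>F\<close> at \<open>x = g\<close> and \<open>y = h\<close>.\<close>

definition subst2 :: "'a::ring_1 fps \<Rightarrow> 'a fps \<Rightarrow> 'a fps fps \<Rightarrow> 'a fps" where
  "subst2 g h F = Abs_fps (\<lambda>n. \<Sum>s\<le>n. fps_nth ((fps_nth F s oo g) * h ^ s) n)"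

context
  fixes g h :: "'a::ring_1 fps"
  assumes g: "central_series g" and h: "central_series h"
begin

lemma times_power_nth_zero: "n < s \<Longrightarrow> fps_nth (f * h ^ s) n = 0"
  using central_series_power_zero[OF h] by (simp add: fps_mult_nth)

lemma subst2_nth: "n \<le> M \<Longrightarrow>
    fps_nth (subst2 g h F) n = fps_nth (\<Sum>s\<le>M. (fps_nth F s oo g) * h ^ s) n"
  unfolding subst2_def fps_nth_Abs_fps fps_sum_nth
  by (intro sum.mono_neutral_left) (auto simp: times_power_nth_zero)

lemma subst2_add: "subst2 g h (F + G) = subst2 g h F + subst2 g h G"
  by (rule fps_ext) (simp add: subst2_def fps_compose_add_distrib distrib_right sum.distrib)

lemma subst2_uminus: "subst2 g h (- F) = - subst2 g h F"
  by (rule fps_ext) (simp add: subst2_def fps_compose_uminus sum_negf)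

lemma subst2_diff: "subst2 g h (F - G) = subst2 g h F - subst2 g h G"
  using subst2_add[of F "- G"] by (simp add: subst2_uminus)

lemma subst2_0: "subst2 g h 0 = 0"
  using subst2_diff[of 0 0] by simp

lemma subst2_sum: "subst2 g h (sum f A) = (\<Sum>x\<in>A. subst2 g h (f x))"
  by (induction A rule: infinite_finite_induct) (simp_all add: subst2_0 subst2_add)

lemma subst2_sign: "subst2 g h ((- 1) ^ n * F) = (- 1) ^ n * subst2 g h F"
  by (simp add: minus_one_power_iff subst2_uminus)

lemma subst2_theta: "subst2 g h (theta N m i * F) = theta N m i * subst2 g h F"
  by (simp add: theta_def subst2_uminus)

text \<open>Together with \<open>subst2_in_x_right\<close> and \<open>subst2_in_y\<close> this
  evaluates both orders of a product of a series in \<open>x\<close> and a series in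
  \<open>y\<close>, the form of every quadratic term of the relation.\<close>

lemma subst2_in_x_left: "subst2 g h (in_x a * F) = (a oo g) * subst2 g h F"
proof (rule fps_ext)
  fix n
  have "fps_nth (subst2 g h (in_x a * F)) n = fps_nth ((a oo g) * (\<Sum>s\<le>n. (fps_nth F s oo g) * h ^ s)) n"
    by (simp add: subst2_nth[of n n] in_x_def compose_mult[OF g] sum_distrib_left mult.assoc)
  also have "\<dots> = fps_nth ((a oo g) * subst2 g h F) n"
    unfolding fps_mult_nth by (intro sum.cong refl) (simp add: subst2_nth[of _ n])
  finally show "fps_nth (subst2 g h (in_x a * F)) n = fps_nth ((a oo g) * subst2 g h F) n" .
qed

lemma subst2_in_x_right: "subst2 g h (F * in_x a) = subst2 g h F * (a oo g)"
proof (rule fps_ext)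
  fix n
  have "(fps_nth F s oo g) * (a oo g) * h ^ s = (fps_nth F s oo g) * h ^ s * (a oo g)" for s
    by (simp add: mult.assoc central_series_commute[OF h])
  then have "fps_nth (subst2 g h (F * in_x a)) n = fps_nth ((\<Sum>s\<le>n. (fps_nth F s oo g) * h ^ s) * (a oo g)) n"
    by (simp add: subst2_nth[of n n] in_x_def compose_mult[OF g] sum_distrib_right)
  also have "\<dots> = fps_nth (subst2 g h F * (a oo g)) n"
    unfolding fps_mult_nth by (intro sum.cong refl) (simp add: subst2_nth[of _ n])
  finally show "fps_nth (subst2 g h (F * in_x a)) n = fps_nth (subst2 g h F * (a oo g)) n" .
qed

lemma subst2_in_y: "subst2 g h (in_y b) = b oo h"
  by (rule fps_ext) (simp add: subst2_def in_y_def compose_const fps_compose_nth atMost_atLeast0)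

lemma subst2_xvar: "subst2 g h (xvar * F) = g * subst2 g h F"
  using subst2_in_x_left[of fps_X F] by (simp add: in_x_def compose_X[OF g])

lemma subst2_yvar: "subst2 g h (yvar * F) = h * subst2 g h F"
proof (rule fps_ext)
  fix n
  \<comment> \<open>The bound \<open>Suc n\<close> makes room for the shift of the outer index by
    one; the term for \<open>s = 0\<close> vanishes.\<close>
  have "fps_nth (subst2 g h (yvar * F)) n = fps_nth (\<Sum>s\<le>Suc n. (fps_nth (yvar * F) s oo g) * h ^ s) n"
    by (rule subst2_nth) simp
  also have "(\<Sum>s\<le>Suc n. (fps_nth (yvar * F) s oo g) * h ^ s) = (\<Sum>s\<le>n. (fps_nth F s oo g) * h ^ Suc s)"
    by (subst sum.atMost_Suc_shift) simp
  also have "\<dots> = h * (\<Sum>s\<le>n. (fps_nth F s oo g) * h ^ s)"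
    using central_series_commute[OF h, of _ 1] by (simp add: sum_distrib_left flip: mult.assoc)
  also have "fps_nth \<dots> n = fps_nth (h * subst2 g h F) n"
    unfolding fps_mult_nth by (intro sum.cong refl) (simp add: subst2_nth[of _ n])
  finally show "fps_nth (subst2 g h (yvar * F)) n = fps_nth (h * subst2 g h F) n" .
qed

text \<open>When \<open>g\<close> and \<open>h\<close> are the inverses of \<open>u + p\<close> and
  \<open>u + q\<close> and \<open>a\<close> is a scalar, the factor equals
  \<open>(p - q - a) * g * h\<close>.\<close>

lemma subst2_W: "subst2 g h (W a * F) = (h - g - fps_const a * g * h) * subst2 g h F"
proof -
  have *: "subst2 g h (fps_const (fps_const a) * (xvar * (yvar * F))) = fps_const a * (g * (h * subst2 g h F))"
    using subst2_in_x_left[of "fps_const a" "xvar * (yvar * F)"]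
    unfolding in_x_def compose_const subst2_xvar subst2_yvar .
  show ?thesis
    by (simp only: W_def left_diff_distrib subst2_diff subst2_xvar subst2_yvar mult.assoc *)
qed

end

text \<open>\<open>W a\<close> is not a unit, but its term free of \<open>y\<close> is
  \<open>- x\<close>: once the lower coefficients of \<open>F\<close> in \<open>y\<close> vanish,
  the next coefficient of the product is \<open>- x\<close> times that of \<open>F\<close>.\<close>

lemma W_cancel:
  fixes F :: "'a::ring_1 fps fps"
  assumes "W a * F = 0"
  shows "F = 0"
proof -
  have *: "fps_X * f = 0 \<Longrightarrow> f = 0" for f :: "'a fps"
    by (metis fps_X_mult_nth fps_ext fps_zero_nth nat.distinct(1) diff_Suc_1)
  have WF: "W a * F = yvar * F - xvar * F - fps_const (fps_const a) * (xvar * (yvar * F))"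
    by (simp only: W_def left_diff_distrib mult.assoc)
  have "fps_nth F s = 0" for s
  proof (induction s)
    case 0
    have "fps_nth (W a * F) 0 = - (fps_X * fps_nth F 0)"
      unfolding WF by simp
    with assms * show ?case by simp
  next
    case (Suc s)
    have "fps_nth (W a * F) (Suc s) = - (fps_X * fps_nth F (Suc s))"
      unfolding WF using Suc by simp
    with assms * show ?case by simp
  qed
  then show ?thesis by (simp add: fps_eq_iff)
qed

section \<open>The extended Yangian\<close>

lemma poly_mapping_induct_single [case_names single add]:
  assumes single: "\<And>k a. P (Poly_Mapping.single k a)" and add: "\<And>f g. P f \<Longrightarrow> P g \<Longrightarrow> P (f + g)"
  shows "P (f :: 'k \<Rightarrow>\<^sub>0 'c::monoid_add)"
proof (induction f rule: update_induct)
  case const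
  show ?case using single[of undefined 0] by simp
next
  case (update f a b)
  have "Poly_Mapping.update a b f = f + Poly_Mapping.single a b"
    using update(1) by (intro poly_mapping_eqI)
      (auto simp: lookup_update lookup_add lookup_single when_def in_keys_iff)
  with update add single show ?case by simp
qed

lemma free_scalar_add: "free_scalar (a + b) = free_scalar a + free_scalar b"
  by (simp add: free_scalar_def single_add)

lemma free_scalar_mult: "free_scalar (a * b) = free_scalar a * free_scalar b"
  by (simp add: free_scalar_def mult_single)

lemma free_scalar_1: "free_scalar 1 = 1"
  by (simp add: free_scalar_def)

lemma free_scalar_central: "f * free_scalar a = free_scalar a * f"
  by (induction f rule: poly_mapping_induct_single)
    (simp_all add: free_scalar_def mult_single mult.commute distrib_left distrib_right)

lemma free_sigma_single:
  "free_sigma (Poly_Mapping.single w a) = Poly_Mapping.single w ((- 1) ^ word_parity w * a)"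
  by (rule poly_mapping_eqI) (auto simp: free_sigma_def lookup_mapp lookup_single when_def)

lemma lookup_free_sigma: "Poly_Mapping.lookup (free_sigma f) w = (- 1) ^ word_parity w * Poly_Mapping.lookup f w"
  by (auto simp: free_sigma_def lookup_mapp when_def in_keys_iff)

lemma free_sigma_add: "free_sigma (f + g) = free_sigma f + free_sigma g"
  by (rule poly_mapping_eqI) (simp add: lookup_free_sigma lookup_add distrib_left)

lemma word_parity_add: "word_parity (v + w) = word_parity v + word_parity w"
  by (simp add: word_parity_def plus_word_def)

lemma free_sigma_mult: "free_sigma (f * g) = free_sigma f * free_sigma g"
proof (induction f rule: poly_mapping_induct_single)
  case (single v a)
  show ?case
  proof (induction g rule: poly_mapping_induct_single)
    case (single w b)
    show ?case
      by (simp add: mult_single free_sigma_single word_parity_add power_add mult_ac)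
  qed (simp add: distrib_left free_sigma_add)
qed (simp add: distrib_right free_sigma_add)

lemma word_parity_0: "word_parity 0 = 0"
  by (simp add: word_parity_def zero_word_def)

lemma free_sigma_1: "free_sigma 1 = 1"
  using free_sigma_single[of 0 1] by (simp add: word_parity_0)

lemma free_sigma_scalar: "free_sigma (free_scalar a) = free_scalar a"
  by (simp add: free_scalar_def free_sigma_single word_parity_def zero_word_def)

lemma free_sigma_t:
  assumes "i \<in> {1..CARD('N) + 2 * CARD('m)}" "j \<in> {1..CARD('N) + 2 * CARD('m)}"
  shows "free_sigma (fps_nth (free_t i j :: ('N::finite, 'm::finite) free_alg fps) r) =
    (- 1) ^ (par CARD('N) CARD('m) i + par CARD('N) CARD('m) j) * fps_nth (free_t i j) r"
proof (cases "r = 0")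
  case True
  have "free_sigma 0 = (0 :: ('N, 'm) free_alg)"
    by (rule poly_mapping_eqI) (simp add: lookup_free_sigma)
  with True show ?thesis
    by (simp add: free_t_def free_sigma_1 minus_one_power_iff)
next
  case False
  then have "Rep_gen (Abs_gen (i, j, r) :: ('N, 'm) gen) = (i, j, r)"
    using assms by (intro Abs_gen_inverse) auto
  then have "word_parity (Word [Abs_gen (i, j, r) :: ('N, 'm) gen]) =
      par CARD('N) CARD('m) i + par CARD('N) CARD('m) j"
    by (simp add: word_parity_def gen_parity_def)
  then have "free_sigma (free_gen (Abs_gen (i, j, r) :: ('N, 'm) gen)) =
      (- 1) ^ (par CARD('N) CARD('m) i + par CARD('N) CARD('m) j) * free_gen (Abs_gen (i, j, r))"
    by (simp add: free_gen_def free_sigma_single minus_one_power_iff single_uminus)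
  with False show ?thesis by (simp add: free_t_def)
qed

interpretation free: rtt_matrix free_sigma "CARD('N)" "CARD('m)"
  "free_scalar (kappa CARD('N) CARD('m))" "free_t :: _ \<Rightarrow> _ \<Rightarrow> ('N::finite, 'm::finite) free_alg fps"
  by unfold_locales (simp_all add: free_sigma_1 free_sigma_add free_sigma_mult free_sigma_scalar
      free_scalar_central free_sigma_t)

interpretation quot: ring_1_hom "abs_ext_yangian :: ('N::finite, 'm::finite) free_alg \<Rightarrow> _"
  by unfold_locales
    (simp_all add: one_ext_yangian.abs_eq plus_ext_yangian.abs_eq times_ext_yangian.abs_eq)

lemma abs_relator: "x \<in> relators \<Longrightarrow> abs_ext_yangian x = 0"
  using rel_ideal.gen[of x 1 1] by (simp add: zero_ext_yangian.abs_eq ext_yangian.abs_eq_iff free_cong_def)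

lemma abs_free_t: "abs_ext_yangian (fps_nth (free_t i j) r) = fps_nth (T_mat i j) r"
  by (simp add: free_t_def T_mat_def yangian_gen.abs_eq quot.map_0 quot.map_1)

lemma quot_in: "fps_map2 abs_ext_yangian (in_x (free_t i j)) = in_x (T_mat i j)"
  "fps_map2 abs_ext_yangian (in_y (free_t i j)) = in_y (T_mat i j)"
  by (intro quot.map2_eqI, simp add: quot.map2_nth in_x_def in_y_def abs_free_t quot.map_0)+

lemma yangian_scalar_add: "yangian_scalar (a + b) = yangian_scalar a + yangian_scalar b"
  by transfer (simp add: free_scalar_add free_cong_def rel_ideal.zero)

lemma yangian_scalar_mult: "yangian_scalar (a * b) = yangian_scalar a * yangian_scalar b"
  by transfer (simp add: free_scalar_mult free_cong_def rel_ideal.zero)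

lemma yangian_scalar_1: "yangian_scalar 1 = 1"
  by transfer (simp add: free_scalar_1 free_cong_def rel_ideal.zero)

lemma yangian_scalar_central: "b * yangian_scalar a = yangian_scalar a * b"
  by transfer (simp add: free_scalar_central free_cong_def rel_ideal.zero)

lemma rtt_relation:
  fixes i q k s :: nat
  defines "N \<equiv> CARD('N::finite)" and "m \<equiv> CARD('m::finite)"
  defines "t \<equiv> T_mat :: nat \<Rightarrow> nat \<Rightarrow> ('N, 'm) ext_yangian fps"
    and "K \<equiv> yangian_scalar (kappa N m)"
  assumes ind: "i \<in> {1..N + 2 * m}" "q \<in> {1..N + 2 * m}" "k \<in> {1..N + 2 * m}" "s \<in> {1..N + 2 * m}"
  defines "\<epsilon> \<equiv> (par N m k + par N m s) * (par N m i + par N m q) + par N m i * par N m q + par N m q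
    + par N m k * par N m s + par N m s"
  shows "(- 1) ^ \<epsilon> * (W 0 * W K * ord_part N m t i q k s)
    - (- 1) ^ \<epsilon> * (xvar * yvar * W K * perm_part N m t i q k s)
    + xvar * yvar * W 0 * ((if k = dual N m i then Q_left N m t i q s else 0)
      - (if s = dual N m q then Q_right N m t i q k else 0)) = 0"
proof -
  let ?F = "rtt_defect N m (free_scalar (kappa N m)) free_sigma
    (free_t :: _ \<Rightarrow> _ \<Rightarrow> ('N, 'm) free_alg fps) i q k s"
  have ind': "{i, q, k, s} \<subseteq> {1..N + 2 * m}"
    using ind by simp
  have K: "abs_ext_yangian (free_scalar (kappa N m)) = K"
    by (simp add: K_def yangian_scalar.abs_eq)
  have "fps_map2 abs_ext_yangian ?F = 0"
  proof (rule quot.map2_eqI)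
    fix a b
    have "fps_nth (fps_nth ?F a) b \<in> relators"
      using ind' unfolding relators_def N_def m_def by blast
    then show "fps_nth (fps_nth (fps_map2 abs_ext_yangian ?F) a) b = fps_nth (fps_nth 0 a) b"
      by (simp add: quot.map2_nth abs_relator)
  qed
  moreover have W: "fps_map2 abs_ext_yangian (W 0) = (W 0 :: ('N, 'm) ext_yangian fps fps)"
    "fps_map2 abs_ext_yangian (W (free_scalar (kappa N m))) = (W K :: ('N, 'm) ext_yangian fps fps)"
    unfolding W_def by (simp_all only: quot.map2_simps quot.map_0 K)
  moreover have "fps_map2 abs_ext_yangian (ord_part N m free_t i q k s) = ord_part N m t i q k s"
    "fps_map2 abs_ext_yangian (perm_part N m free_t i q k s) = perm_part N m t i q k s"
    "fps_map2 abs_ext_yangian (Q_left N m free_t i q s) = Q_left N m t i q s"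
    "fps_map2 abs_ext_yangian (Q_right N m free_t i q k) = Q_right N m t i q k"
    unfolding ord_part_def perm_part_def Q_left_def Q_right_def t_def
    by (simp_all only: quot.map2_simps quot_in)
  moreover note free.rtt_defect_eq[where 'N = 'N and 'm = 'm, folded N_def m_def, OF ind]
  ultimately show ?thesis
    unfolding \<epsilon>_def by (simp only: quot.map2_simps if_distrib[of "fps_map2 abs_ext_yangian"])
qed

section \<open>Shifts of the spectral parameter\<close>

definition series_scalar :: "complex \<Rightarrow> ('N::finite, 'm::finite) ext_yangian fps" where
  "series_scalar a = fps_const (yangian_scalar a)"

definition shifted_var :: "complex \<Rightarrow> ('N::finite, 'm::finite) ext_yangian fps" where
  "shifted_var a = Abs_fps (\<lambda>n. if n = 0 then 0 else yangian_scalar ((- a) ^ (n - 1)))"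

lemma translate_eq: "translate a f = f oo shifted_var a"
  by (simp add: translate_def shifted_var_def)

lemma shifted_var_central: "central_series (shifted_var a)"
  by (simp add: central_series_def shifted_var_def yangian_scalar_central)

lemma yangian_scalar_0: "yangian_scalar 0 = 0"
  using yangian_scalar_add[of 0 0] by simp

lemma yangian_scalar_sum: "yangian_scalar (sum f A) = (\<Sum>x\<in>A. yangian_scalar (f x))"
  by (induction A rule: infinite_finite_induct) (simp_all add: yangian_scalar_add yangian_scalar_0)

lemma yangian_scalar_minus: "yangian_scalar (a - b) = yangian_scalar a - yangian_scalar b"
  using yangian_scalar_add[of "a - b" b] by (metis add_diff_cancel_right' diff_add_cancel)

lemma shifted_var_eq: "(1 + series_scalar a * fps_X) * shifted_var a = fps_X"
proof (rule fps_ext)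
  fix n
  have *: "yangian_scalar ((- a) ^ Suc k) + yangian_scalar a * yangian_scalar ((- a) ^ k) =
      (0 :: ('a, 'b) ext_yangian)" for k
    by (simp add: yangian_scalar_0 flip: yangian_scalar_mult yangian_scalar_add)
  show "fps_nth ((1 + series_scalar a * fps_X) * shifted_var a) n =
      fps_nth (fps_X :: ('a, 'b) ext_yangian fps) n"
  proof (cases n)
    case (Suc k)
    then show ?thesis
      using *[of "k - 1"] by (cases k) (simp_all add: distrib_right series_scalar_def shifted_var_def mult.assoc
          yangian_scalar_1 del: power_Suc)
  qed (simp add: shifted_var_def)
qed

text \<open>This is \<open>1/(u + q) - 1/(u + p) = (p - q)/((u + p)(u + q))\<close>. Coefficientwise
  it is the factorization of a difference of powers.\<close>

lemma shifted_var_diff: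
  "shifted_var q - shifted_var p =
    (series_scalar (p - q) * shifted_var p * shifted_var q :: ('N::finite, 'm::finite) ext_yangian fps)"
proof (rule fps_ext)
  fix n
  define f where "f p n = (if n = 0 then 0 else (- p) ^ (n - 1))" for p :: complex and n
  have sf: "fps_nth (shifted_var p) n = (yangian_scalar (f p n) :: ('N, 'm) ext_yangian)" for p n
    by (simp add: shifted_var_def f_def yangian_scalar_0)
  have "f q n - f p n = (p - q) * (\<Sum>i=0..n. f p i * f q (n - i))"
  proof (cases n)
    case 0
    then show ?thesis by (simp add: f_def)
  next
    case (Suc k)
    have "(\<Sum>i=0..Suc k. f p i * f q (Suc k - i)) = (\<Sum>i=1..k. f p i * f q (Suc k - i))"
      by (rule sum.mono_neutral_right) (auto simp: f_def)
    also have "\<dots> = (\<Sum>i<k. (- q) ^ (k - Suc i) * (- p) ^ i)"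
      by (rule sum.reindex_bij_witness[of _ Suc "\<lambda>i. i - 1"]) (auto simp: f_def mult.commute Suc_diff_Suc)
    finally have "(\<Sum>i=0..Suc k. f p i * f q (Suc k - i)) = (\<Sum>i<k. (- q) ^ (k - Suc i) * (- p) ^ i)" .
    moreover have "f q (Suc k) - f p (Suc k) = - ((- p) ^ k - (- q) ^ k)"
      by (simp add: f_def)
    ultimately show ?thesis
      using power_diff_sumr2[of "- p" k "- q"] Suc by (simp add: algebra_simps)
  qed
  then have "yangian_scalar (f q n - f p n) =
      yangian_scalar (p - q) * (\<Sum>i=0..n. yangian_scalar (f p i) * (yangian_scalar (f q (n - i)) :: ('N, 'm) ext_yangian))"
    by (simp only: yangian_scalar_mult yangian_scalar_sum)
  then show "fps_nth (shifted_var q - shifted_var p) n =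
      fps_nth (series_scalar (p - q) * shifted_var p * shifted_var q :: ('N, 'm) ext_yangian fps) n"
    by (simp add: sf yangian_scalar_minus series_scalar_def mult.assoc fps_mult_nth[of "shifted_var p"])
qed

lemma shifted_var_cancel:
  assumes "shifted_var p * f = 0"
  shows "f = 0"
proof -
  have "fps_X * f = (1 + series_scalar p * fps_X) * (shifted_var p * f)"
    by (simp only: shifted_var_eq mult.assoc[symmetric])
  with assms have *: "fps_X * f = 0" by simp
  have "fps_nth f n = fps_nth (fps_X * f) (Suc n)" for n
    by simp
  then show ?thesis by (simp add: * fps_eq_iff)
qed

lemma translate_0:
  fixes f :: "('N::finite, 'm::finite) ext_yangian fps"
  shows "translate 0 f = f"
proof -
  have "shifted_var 0 = (fps_X :: ('N, 'm) ext_yangian fps)"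
    by (rule fps_ext) (auto simp: shifted_var_def fps_X_def yangian_scalar_0 yangian_scalar_1 power_0_left)
  then show ?thesis
    by (intro fps_ext) (simp add: translate_eq fps_compose_nth fps_X_power_nth if_distrib[of "\<lambda>x. _ * x"] cong: if_cong)
qed

interpretation yangian: graded_scalars
  "series_scalar :: complex \<Rightarrow> ('N::finite, 'm::finite) ext_yangian fps" "par N m" for N m
proof
  show "b * series_scalar x = series_scalar x * b" for b :: "('N, 'm) ext_yangian fps" and x
    unfolding series_scalar_def by (rule fps_ext) (simp add: yangian_scalar_central[of _ x])
qed (simp_all add: series_scalar_def yangian_scalar_add yangian_scalar_mult yangian_scalar_1)

definition T_at :: "nat \<Rightarrow> nat \<Rightarrow> complex \<Rightarrow> ('N::finite, 'm::finite) ext_yangian fps" where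
  "T_at i j p = translate p (T_mat i j)"

lemma subst_parts:
  fixes p q :: complex
  defines "\<Phi> \<equiv> subst2 (shifted_var p) (shifted_var q) :: ('N::finite, 'm::finite) ext_yangian fps fps \<Rightarrow> _"
  shows "\<Phi> (ord_part N m T_mat a b c d) = T_at a b p * T_at c d q
      - (- 1) ^ ((par N m a + par N m b) * (par N m c + par N m d)) * (T_at c d q * T_at a b p)"
    and "\<Phi> (perm_part N m T_mat a b c d) =
      (- 1) ^ (par N m a * par N m b + par N m a * par N m c + par N m b * par N m c) *
      (T_at c b p * T_at a d q - T_at c b q * T_at a d p)"
    and "\<Phi> (Q_left N m T_mat a b d) = (\<Sum>j\<in>{1..N + 2 * m}.
     (- 1) ^ (par N m a * par N m b + par N m d * par N m b + par N m j * par N m b + par N m b + par N m d) *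
     (theta N m a * (theta N m j * (T_at j b p * T_at (dual N m j) d q))))"
    and "\<Phi> (Q_right N m T_mat a b c) = (\<Sum>j\<in>{1..N + 2 * m}.
     (- 1) ^ (par N m c * par N m b + par N m j + par N m a * par N m j) *
     (theta N m j * (theta N m b * (T_at c (dual N m j) q * T_at a j p))))"
proof -
  note c = shifted_var_central[of p] shifted_var_central[of q]
  note lin = subst2_diff[OF c] subst2_sum[OF c] subst2_sign[OF c] subst2_theta[OF c]
    subst2_in_x_left[OF c] subst2_in_x_right[OF c] subst2_in_y[OF c] translate_eq[symmetric] T_at_def
  show "\<Phi> (ord_part N m T_mat a b c d) = T_at a b p * T_at c d q
      - (- 1) ^ ((par N m a + par N m b) * (par N m c + par N m d)) * (T_at c d q * T_at a b p)"
    "\<Phi> (perm_part N m T_mat a b c d) =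
      (- 1) ^ (par N m a * par N m b + par N m a * par N m c + par N m b * par N m c) *
      (T_at c b p * T_at a d q - T_at c b q * T_at a d p)"
    "\<Phi> (Q_left N m T_mat a b d) = (\<Sum>j\<in>{1..N + 2 * m}.
     (- 1) ^ (par N m a * par N m b + par N m d * par N m b + par N m j * par N m b + par N m b + par N m d) *
     (theta N m a * (theta N m j * (T_at j b p * T_at (dual N m j) d q))))"
    "\<Phi> (Q_right N m T_mat a b c) = (\<Sum>j\<in>{1..N + 2 * m}.
     (- 1) ^ (par N m c * par N m b + par N m j + par N m a * par N m j) *
     (theta N m j * (theta N m b * (T_at c (dual N m j) q * T_at a j p))))"
    unfolding \<Phi>_def ord_part_def perm_part_def Q_left_def Q_right_def mult.assoc
    by (simp_all only: lin)
qed

lemma W_W_central: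
  fixes F :: "('N::finite, 'm::finite) ext_yangian fps fps"
  shows "F * W (yangian_scalar a) = W (yangian_scalar a) * F" "F * W 0 = W 0 * F"
  by (rule W_central, simp add: yangian_scalar_central[of _ a]) (rule W_central, simp)

lemma sign_W: "(- 1) ^ n * (W a * F) = W a * ((- 1) ^ n * F)"
  by (simp add: minus_one_power_iff)

lemma sign_cancel: "(- 1) ^ n * z = 0 \<Longrightarrow> z = (0 :: 'a::ring_1)"
  by (simp add: minus_one_power_iff split: if_splits)

lemma scalar_rearrange: "series_scalar a * g * h * z = g * (h * (series_scalar a * z))"
proof -
  have "series_scalar a * g * h * z = (series_scalar a * (g * h)) * z"
    by (simp only: mult.assoc)
  also have "\<dots> = (g * h * series_scalar a) * z"
    by (simp only: yangian.scal_central[of "g * h" a])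
  also have "\<dots> = g * (h * (series_scalar a * z))"
    by (simp only: mult.assoc)
  finally show ?thesis .
qed

lemma gl_rel_T:
  fixes N m :: nat
  assumes N: "N = CARD('N::finite)" and m: "m = CARD('m::finite)"
    and ind: "a \<in> {1..N + 2 * m}" "b \<in> {1..N + 2 * m}" "c \<in> {1..N + 2 * m}" "d \<in> {1..N + 2 * m}"
    and nd: "c \<noteq> dual N m a" "d \<noteq> dual N m b"
  shows "yangian.gl_rel N m (T_at :: _ \<Rightarrow> _ \<Rightarrow> _ \<Rightarrow> ('N, 'm) ext_yangian fps) a b c d"
  unfolding yangian.gl_rel_def
proof (intro allI)
  fix p q :: complex
  define K :: "('N, 'm) ext_yangian" where "K = yangian_scalar (kappa N m)"
  define A B :: "('N, 'm) ext_yangian fps fps"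
    where "A = ord_part N m T_mat a b c d" and "B = perm_part N m T_mat a b c d"
  define e where "e = (par N m c + par N m d) * (par N m a + par N m b) + par N m a * par N m b + par N m b
    + par N m c * par N m d + par N m d"
  have "(- 1) ^ e * (W 0 * W K * A) - (- 1) ^ e * (xvar * yvar * W K * B) = 0"
    using rtt_relation[where 'N = 'N and 'm = 'm, of a b c d] ind nd
    by (simp add: N m K_def A_def B_def e_def)
  \<comment> \<open>The factor for \<open>u - v - \<kappa>\<close> is cancelled while
    \<open>u\<close> and \<open>v\<close> are independent, since it would vanish at points with
    \<open>p - q = \<kappa>\<close>.\<close>
  then have "W K * ((- 1) ^ e * (W 0 * A - xvar * yvar * B)) = 0"
    unfolding K_def W_W_central(1)[of "W 0"] W_W_central(1)[of "xvar * yvar"]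
    by (simp only: mult.assoc right_diff_distrib sign_W)
  then have "(- 1) ^ e * (W 0 * A - xvar * yvar * B) = 0"
    by (rule W_cancel)
  then have AB: "W 0 * A - xvar * (yvar * B) = 0"
    unfolding mult.assoc by (rule sign_cancel)
  let ?g = "shifted_var p :: ('N, 'm) ext_yangian fps" and ?h = "shifted_var q :: ('N, 'm) ext_yangian fps"
  note cs = shifted_var_central[of p] shifted_var_central[of q]
  have "subst2 ?g ?h (W 0 * A - xvar * (yvar * B)) = 0"
    unfolding AB by (rule subst2_0[OF cs])
  then have "(?h - ?g) * subst2 ?g ?h A - ?g * (?h * subst2 ?g ?h B) = 0"
    by (simp add: subst2_diff[OF cs] subst2_W[OF cs] subst2_xvar[OF cs] subst2_yvar[OF cs])
  moreover have "(?h - ?g) * subst2 ?g ?h A = ?g * (?h * (series_scalar (p - q) * subst2 ?g ?h A))"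
    unfolding shifted_var_diff by (rule scalar_rearrange)
  ultimately have "?g * (?h * (series_scalar (p - q) * subst2 ?g ?h A - subst2 ?g ?h B)) = 0"
    by (simp add: right_diff_distrib)
  from shifted_var_cancel[OF shifted_var_cancel[OF this]]
  have "series_scalar (p - q) * subst2 ?g ?h A = subst2 ?g ?h B"
    by simp
  then show "series_scalar (p - q) * (T_at a b p * T_at c d q
      - (- 1) ^ ((par N m a + par N m b) * (par N m c + par N m d)) * (T_at c d q * T_at a b p)) =
    (- 1) ^ (par N m a * par N m b + par N m a * par N m c + par N m b * par N m c) *
      (T_at c b p * T_at a d q - T_at c b q * (T_at a d p :: ('N, 'm) ext_yangian fps))"
    by (simp add: A_def B_def subst_parts)
qed

text \<open>
  The residue of the RTT relation at \<open>u - v = \<kappa>\<close>.  If \<open>\<kappa> = 0\<close>, then both denominators of \<open>R(u - v)\<close>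
  coincide and the common factor has to be cancelled before \<open>u\<close> and \<open>v\<close> are specialized.
\<close>

lemma Q_relation:
  fixes N m :: nat
  assumes N: "N = CARD('N::finite)" and m: "m = CARD('m::finite)"
    and ind: "i \<in> {1..N + 2 * m}" "q \<in> {1..N + 2 * m}" "s \<in> {1..N + 2 * m}"
  defines "\<Phi> \<equiv> subst2 (shifted_var 0) (shifted_var (- kappa N m))"
  shows "\<Phi> (Q_left N m T_mat i q s) =
    (if s = dual N m q then \<Phi> (Q_right N m T_mat i q (dual N m i)) else (0 :: ('N, 'm) ext_yangian fps))"
proof -
  define k where "k = dual N m i"
  have k: "k \<in> {1..N + 2 * m}" using ind by (auto simp: k_def dual_def)
  let ?\<kappa> = "kappa N m"
  define K :: "('N, 'm) ext_yangian" where "K = yangian_scalar ?\<kappa>"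
  define A B C :: "('N, 'm) ext_yangian fps fps"
    where "A = ord_part N m T_mat i q k s" and "B = perm_part N m T_mat i q k s"
      and "C = Q_left N m T_mat i q s - (if s = dual N m q then Q_right N m T_mat i q k else 0)"
  define e where "e = (par N m k + par N m s) * (par N m i + par N m q) + par N m i * par N m q + par N m q
    + par N m k * par N m s + par N m s"
  have rel: "(- 1) ^ e * (W 0 * W K * A) - (- 1) ^ e * (xvar * yvar * W K * B) + xvar * yvar * W 0 * C = 0"
    using rtt_relation[where 'N = 'N and 'm = 'm, folded N m, OF ind(1,2) k ind(3)]
    unfolding K_def A_def B_def C_def e_def by (simp add: k_def)
  let ?g = "shifted_var 0 :: ('N, 'm) ext_yangian fps" and ?h = "shifted_var (- ?\<kappa>) :: ('N, 'm) ext_yangian fps"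
  note cs = shifted_var_central[of 0] shifted_var_central[of "- ?\<kappa>"]
  have hg: "?h - ?g = series_scalar ?\<kappa> * ?g * ?h"
    using shifted_var_diff[of "- ?\<kappa>" 0] by simp
  note lin = subst2_diff[OF cs] subst2_add[OF cs] subst2_W[OF cs] subst2_xvar[OF cs] subst2_yvar[OF cs]
    subst2_sign[OF cs] subst2_0[OF cs]
  have "\<Phi> C = 0"
  proof (cases "?\<kappa> = 0")
    case False
    \<comment> \<open>\<open>W K\<close> vanishes at \<open>u - v = \<kappa>\<close>, which removes
      the terms of \<open>1\<close> and \<open>P\<close>, while \<open>W 0\<close> becomes
      \<open>\<kappa> * ?g * ?h\<close> with \<open>\<kappa>\<close> invertible.\<close>
    have "subst2 ?g ?h (W K * F) = 0" for F
      by (simp only: lin hg) (simp add: K_def series_scalar_def)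
    then have K0: "subst2 ?g ?h (W 0 * (W K * A)) = 0" "subst2 ?g ?h (xvar * (yvar * (W K * B))) = 0"
      by (simp_all add: lin)
    have "subst2 ?g ?h ((- 1) ^ e * (W 0 * (W K * A)) - (- 1) ^ e * (xvar * (yvar * (W K * B)))
        + xvar * (yvar * (W 0 * C))) = 0"
      using rel by (simp add: mult.assoc lin(7))
    then have "?g * (?h * ((?h - ?g) * subst2 ?g ?h C)) = 0"
      using K0 by (simp add: lin)
    then have "(?h - ?g) * subst2 ?g ?h C = 0"
      using shifted_var_cancel by blast
    then have "?g * (?h * (series_scalar ?\<kappa> * subst2 ?g ?h C)) = 0"
      unfolding hg scalar_rearrange .
    then show ?thesis
      using shifted_var_cancel yangian.scal_cancel[OF False] unfolding \<Phi>_def by blast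
  next
    case True
    then have K: "K = 0" by (simp add: K_def yangian_scalar_0)
    have "W 0 * ((- 1) ^ e * (W 0 * A) - (- 1) ^ e * (xvar * (yvar * B)) + xvar * (yvar * C)) = 0"
      using rel unfolding K W_W_central(2)[of "xvar * yvar"]
      by (simp only: mult.assoc right_diff_distrib distrib_left sign_W)
    then have "(- 1) ^ e * (W 0 * A) - (- 1) ^ e * (xvar * (yvar * B)) + xvar * (yvar * C) = 0"
      by (rule W_cancel)
    then have "subst2 ?g ?h ((- 1) ^ e * (W 0 * A) - (- 1) ^ e * (xvar * (yvar * B)) + xvar * (yvar * C)) = 0"
      by (simp only: lin(7))
    \<comment> \<open>The two points coincide, so the two products in \<open>perm_part\<close>
      cancel; the term of \<open>1\<close> is removed by its remaining factor
      \<open>W 0\<close>.\<close>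
    moreover have "subst2 ?g ?h B = 0"
      by (simp add: B_def subst_parts True)
    ultimately have "?g * (?h * subst2 ?g ?h C) = 0"
      by (simp add: lin) (simp add: True)
    then show ?thesis
      using shifted_var_cancel unfolding \<Phi>_def by blast
  qed
  then show ?thesis
    by (auto simp: C_def \<Phi>_def lin k_def split: if_splits)
qed

section \<open>The product of the transpose and \<open>T\<close> in the reversed order\<close>

lemma theta_dual:
  "i \<in> {1..N + 2 * m} \<Longrightarrow> theta N m (dual N m i) = (- 1) ^ par N m i * (theta N m i :: 'a::ring_1)"
  by (auto simp: theta_def par_def dual_def)

lemma sum_dual:
  "(\<Sum>l\<in>{1..N + 2 * m}. f (dual N m l)) = (\<Sum>l\<in>{1..N + 2 * m}. f l)"
  by (rule sum.reindex_bij_witness[of _ "dual N m" "dual N m"]) (auto simp: dual_def)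

text \<open>In the residue identity \<open>Q T1 T2 = T2 T1 Q\<close> the left side carries the
  entries of the reversed product and the right side those of the given one. Off the diagonal the
  right side is absent; on the diagonal it is \<open>c\<close>.\<close>

lemma crossing_T:
  fixes N m :: nat and c :: "('N::finite, 'm::finite) ext_yangian fps"
  assumes N: "N = CARD('N)" and m: "m = CARD('m)"
    and c: "\<forall>i\<in>{1..N + 2 * m}. \<forall>j\<in>{1..N + 2 * m}.
      mat_mult (N + 2 * m) (\<lambda>i j. T_at i j (- kappa N m))
        (super_transpose N m (\<lambda>i j. T_at i j 0)) i j = (if i = j then c else 0)"
    and ab: "a \<in> {1..N + 2 * m}" "b \<in> {1..N + 2 * m}"
  shows "(\<Sum>l\<in>{1..N + 2 * m}. super_transpose N m (\<lambda>i j. T_at i j 0) a l * T_at l b (- kappa N m)) =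
    (if a = b then c else 0)"
proof -
  let ?I = "{1..N + 2 * m}" and ?p = "- kappa N m"
  \<comment> \<open>With both \<open>i\<close> and \<open>q\<close> of \<open>Q_relation\<close>
    equal to the dual of \<open>a\<close>, its right side appears exactly when
    \<open>b = a\<close>.\<close>
  define q where "q = dual N m a"
  have q: "q \<in> ?I" "dual N m q = a" "par N m q = par N m a"
    "theta N m q = (- 1) ^ par N m a * (theta N m a :: ('N, 'm) ext_yangian fps)"
    using ab theta_dual[of a N m] by (auto simp: q_def dual_def par_def)
  let ?L = "subst2 (shifted_var 0) (shifted_var ?p) (Q_left N m T_mat q q b) :: ('N, 'm) ext_yangian fps"
  let ?R = "subst2 (shifted_var 0) (shifted_var ?p) (Q_right N m T_mat q q a) :: ('N, 'm) ext_yangian fps"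
  let ?s = "(- 1) ^ (par N m a + par N m b * par N m a + par N m b) :: ('N, 'm) ext_yangian fps"
  have dd: "dual N m (dual N m l) = l" "par N m (dual N m l) = par N m l" if "l \<in> ?I" for l
    using that by (auto simp: dual_def par_def)
  have pm: "(theta N m l :: ('N, 'm) ext_yangian fps) = 1 \<or> (theta N m l :: ('N, 'm) ext_yangian fps) = - 1" for l
    by (simp add: theta_def)
  have "(\<Sum>l\<in>?I. super_transpose N m (\<lambda>i j. T_at i j 0) a l * T_at l b ?p) =
      (\<Sum>l\<in>?I. super_transpose N m (\<lambda>i j. T_at i j 0) a (dual N m l) * T_at (dual N m l) b ?p)"
    by (rule sum_dual[symmetric])
  also have "\<dots> = ?s * ?L"
    unfolding subst_parts sum_distrib_left
  proof (intro sum.cong refl)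
    fix j assume j: "j \<in> ?I"
    show "super_transpose N m (\<lambda>i j. T_at i j 0) a (dual N m j) * T_at (dual N m j) b ?p =
      ?s * ((- 1) ^ (par N m q * par N m q + par N m b * par N m q + par N m j * par N m q + par N m q + par N m b)
        * (theta N m q * (theta N m j * (T_at j q 0 * T_at (dual N m j) b ?p))) :: ('N, 'm) ext_yangian fps)"
      unfolding super_transpose_def dd[OF j] theta_dual[OF j] q(3,4) q_def[symmetric]
      using pm[of a] pm[of j]
      by (cases "even (par N m a)"; cases "even (par N m b)"; cases "even (par N m j)")
        (auto simp: minus_one_power_iff)
  qed
  also have "?L = (if b = a then ?R else 0)"
    using Q_relation[OF N m q(1) q(1) ab(2)] by (simp add: q(2))
  also have "?s * (if b = a then ?R else 0) = (if a = b then c else 0)"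
  proof (cases "a = b")
    case True
    have "c = (\<Sum>l\<in>?I. T_at a l ?p * super_transpose N m (\<lambda>i j. T_at i j 0) l a)"
      using c ab(1) by (simp add: mat_mult_def)
    also have "\<dots> = (\<Sum>l\<in>?I. T_at a (dual N m l) ?p * super_transpose N m (\<lambda>i j. T_at i j 0) (dual N m l) a)"
      by (rule sum_dual[symmetric])
    also have "\<dots> = ?s * ?R"
      unfolding subst_parts sum_distrib_left
    proof (intro sum.cong refl)
      fix j assume j: "j \<in> ?I"
      show "T_at a (dual N m j) ?p * super_transpose N m (\<lambda>i j. T_at i j 0) (dual N m j) a =
        ?s * ((- 1) ^ (par N m a * par N m q + par N m j + par N m q * par N m j) *
          (theta N m j * (theta N m q * (T_at a (dual N m j) ?p * T_at q j 0))) :: ('N, 'm) ext_yangian fps)"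
        unfolding super_transpose_def dd[OF j] theta_dual[OF j] q(3,4) q_def[symmetric] True[symmetric]
        using pm[of a] pm[of j]
        by (cases "even (par N m a)"; cases "even (par N m j)") (auto simp: minus_one_power_iff)
    qed
    finally show ?thesis using True by simp
  qed simp
  finally show ?thesis .
qed

lemma translate_mult: "translate p (f * g) = translate p f * translate p g"
  by (simp add: translate_eq compose_mult[OF shifted_var_central])

lemma translate_sum: "translate p (sum f A) = (\<Sum>x\<in>A. translate p (f x))"
  by (simp add: translate_eq fps_compose_sum_distrib)

lemma translate_0_1: "translate p 0 = 0" "translate p 1 = 1"
  by (simp_all add: translate_eq)

lemma mat_mult_diag:
  "mat_mult d (mat_mult d F (diag_mat h)) E i j = (\<Sum>k\<in>{1..d}. F i k * h k * E k j)"
  by (simp add: mat_mult_def diag_mat_def if_distrib[of "\<lambda>x. _ * x"] cong: if_cong)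

lemma prod_list_upt_split:
  assumes "1 \<le> r"
  shows "(\<Prod>i\<leftarrow>[1..<m + r]. f i) = (\<Prod>i\<leftarrow>[1..<m + 1]. f i) * (\<Prod>j\<leftarrow>[1..<r]. f (m + j) :: 'a::monoid_mult)"
proof -
  have "[1..<m + r] = [1..<m + 1] @ map (\<lambda>j. m + j) [1..<r]"
    using assms by (intro nth_equalityI) (auto simp: nth_append simp del: upt_Suc)
  then have "(\<Prod>i\<leftarrow>[1..<m + r]. f i) = (\<Prod>i\<leftarrow>[1..<m + 1] @ map (\<lambda>j. m + j) [1..<r]. f i)"
    by (simp only:)
  then show ?thesis by (simp add: o_def del: upt_Suc)
qed

text \<open>\<open>c\<close> and \<open>h\<close> enter through the identities that define them.
  Multiplication is noncommutative, so the order of the factors is part of the claim.\<close>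

theorem theorem5p3:
  fixes c :: "('N::finite, 'm::finite) ext_yangian fps"
    and h :: "nat \<Rightarrow> ('N, 'm) ext_yangian fps"
    and F E :: "nat \<Rightarrow> nat \<Rightarrow> ('N, 'm) ext_yangian fps"
    and N m n :: nat
  assumes N: "N = CARD('N)" and m: "m = CARD('m)"
    and c: "\<forall>i\<in>{1..N + 2 * m}. \<forall>j\<in>{1..N + 2 * m}.
      mat_mult (N + 2 * m) (\<lambda>i j. translate (- kappa N m) (T_mat i j))
        (super_transpose N m T_mat) i j = (if i = j then c else 0)"
    and gauss: "gauss_decomposition (N + 2 * m) T_mat F h E"
  shows "(N = 2 * n + 1 \<longrightarrow>
      c = (\<Prod>i\<leftarrow>[1..<m + 1]. ser_frac (translate (of_nat i - 1) (h i)) (translate (of_nat i) (h i)))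
        * (\<Prod>j\<leftarrow>[1..<n + 1]. ser_frac
            (translate (of_nat m - of_nat j + 1) (h (m + j)))
            (translate (of_nat m - of_nat j) (h (m + j))))
        * (translate (of_nat m - of_nat n + 1 / 2) (h (m + n + 1))
            * translate (of_nat m - of_nat n) (h (m + n + 1))))
    \<and> (N = 2 * n \<longrightarrow>
      c = (\<Prod>i\<leftarrow>[1..<m + 1]. ser_frac (translate (of_nat i - 1) (h i)) (translate (of_nat i) (h i)))
        * (\<Prod>j\<leftarrow>[1..<n]. ser_frac
            (translate (of_nat m - of_nat j + 1) (h (m + j)))
            (translate (of_nat m - of_nat j) (h (m + j))))
        * (translate (of_nat m - of_nat n + 1) (h (m + n))
            * translate (of_nat m - of_nat n + 1) (h (m + n + 1))))"
proof -
  let ?I = "{1..N + 2 * m}" and ?p = "- kappa N m"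
  define Fp Ep where "Fp i j p = translate p (F i j)" and "Ep i j p = translate p (E i j)" for i j p
  define hp hi where "hp i p = translate p (h i)" and "hi i p = fps_right_inverse (hp i p) 1" for i p
  have Ft: "lower_unitriangular (N + 2 * m) F" and Et: "upper_unitriangular (N + 2 * m) E"
    and FhE: "\<And>i j. i \<in> ?I \<Longrightarrow> j \<in> ?I \<Longrightarrow> T_mat i j = (\<Sum>k\<in>?I. F i k * h k * E k j)"
    using gauss by (auto simp: gauss_decomposition_def mat_mult_diag)
  have h1: "fps_nth (h k) 0 = 1" if k: "k \<in> ?I" for k
  proof -
    \<comment> \<open>The constant terms form a Gauss decomposition of the identity matrix; the
      argument \<open>p\<close> is a dummy here.\<close>
    interpret gauss_factors "N + 2 * m" "\<lambda>i j (p::complex). fps_nth (F i j) 0"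
      "\<lambda>i j p. fps_nth (E i j) 0" "\<lambda>i p. fps_nth (h i) 0"
      using Ft Et by unfold_locales (auto simp: lower_unitriangular_def upper_unitriangular_def)
    show ?thesis
    proof (rule pivot_eq_1[OF _ k])
      fix a b assume "a \<in> ?I" "b \<in> ?I"
      then show "K 1 a b 0 = (if a = b then 1 else 0)"
        using arg_cong[OF FhE[of a b], of "\<lambda>f. fps_nth f 0"]
        by (simp add: K_def T_mat_def fps_sum_nth)
    qed
  qed
  interpret gauss_chain series_scalar N m Fp Ep hp hi
  proof
    show "lower_unitriangular (N + 2 * m) (\<lambda>i j. Fp i j p)" for p
      using Ft by (auto simp: lower_unitriangular_def Fp_def translate_0_1)
    show "upper_unitriangular (N + 2 * m) (\<lambda>i j. Ep i j p)" for p
      using Et by (auto simp: upper_unitriangular_def Ep_def translate_0_1)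
    fix i p assume "i \<in> ?I"
    then have "fps_nth (hp i p) 0 = 1"
      by (simp add: hp_def translate_eq h1)
    then show "hp i p * hi i p = 1" "hi i p * hp i p = 1"
      unfolding hi_def by (auto intro!: fps_right_inverse fps_left_inverse'[where x = 1])
  qed
  have K1: "K 1 a b p = T_at a b p" if "a \<in> ?I" "b \<in> ?I" for a b p
    using that by (simp add: K_def T_at_def FhE translate_sum translate_mult Fp_def Ep_def hp_def)
  have d1: "dual N m 1 = N + 2 * m" by (simp add: dual_def)
  have gl: "gl_stage 1"
    unfolding gl_stage_def
  proof (intro allI impI)
    fix a b a' b' assume "nd 1 a a'" "nd 1 b b'"
    then have ab: "a \<in> ?I" "b \<in> ?I" "a' \<in> ?I" "b' \<in> ?I" "a' \<noteq> dual N m a" "b' \<noteq> dual N m b"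
      unfolding nd_def d1 by auto
    show "yangian.gl_rel N m (K 1) a b a' b'"
      using gl_rel_T[OF N m ab]
      unfolding yangian.gl_rel_def K1[OF ab(1,2)] K1[OF ab(3,4)] K1[OF ab(3,2)] K1[OF ab(1,4)] .
  qed
  have T0: "(\<lambda>i j. T_at i j 0) = (T_mat :: _ \<Rightarrow> _ \<Rightarrow> ('N, 'm) ext_yangian fps)"
    by (intro ext) (simp add: T_at_def translate_0)
  have AB: "\<forall>i\<in>?I. \<forall>j\<in>?I. mat_mult (N + 2 * m) (\<lambda>i j. T_at i j ?p)
        (super_transpose N m (\<lambda>i j. T_at i j 0)) i j = (if i = j then c else 0)"
    using c unfolding T0 by (simp add: T_at_def)
  note BA = crossing_T[OF N m AB]
  have cr: "crossing 1 ?p 0 c"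
    unfolding crossing_def d1
  proof (intro ballI)
    fix j i assume ij: "j \<in> ?I" "i \<in> ?I"
    have "(\<Sum>l\<in>?I. super_transpose N m (\<lambda>a b. K 1 a b 0) j l * K 1 l i ?p) =
        (\<Sum>l\<in>?I. super_transpose N m (\<lambda>a b. T_at a b 0) j l * T_at l i ?p)"
    proof (intro sum.cong refl)
      fix l assume l: "l \<in> ?I"
      have "dual N m l \<in> ?I" "dual N m j \<in> ?I"
        using l ij by (auto simp: dual_def)
      then show "super_transpose N m (\<lambda>a b. K 1 a b 0) j l * K 1 l i ?p =
          super_transpose N m (\<lambda>a b. T_at a b 0) j l * T_at l i ?p"
        unfolding super_transpose_def K1[OF l ij(2)] by (simp only: K1)
    qed
    with BA[OF ij] show "(\<Sum>l\<in>?I. super_transpose N m (\<lambda>a b. K 1 a b 0) j l * K 1 l i ?p) =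
        (if j = i then c else 0)" by simp
  qed
  \<comment> \<open>With \<open>A\<close> for \<open>T(u - \<kappa>)\<close> and \<open>B\<close>
    for the transpose at \<open>u\<close>, both \<open>A B\<close> and \<open>B A\<close> equal
    \<open>c\<close>, so that \<open>A c = A B A = c A\<close>.\<close>
  have comm: "K 1 a b ?p * c = c * K 1 a b ?p" if ab: "a \<in> ?I" "b \<in> ?I" for a b
  proof -
    define A B where "A i j = (T_at i j ?p :: ('N, 'm) ext_yangian fps)"
      and "B = super_transpose N m (\<lambda>i j. T_at i j 0 :: ('N, 'm) ext_yangian fps)" for i j
    have "A a b * c = (\<Sum>l\<in>?I. A a l * (if l = b then c else 0))"
      using ab by (simp add: if_distrib[of "\<lambda>x. _ * x"] cong: if_cong)
    also have "\<dots> = (\<Sum>l\<in>?I. A a l * (\<Sum>k\<in>?I. B l k * A k b))"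
      using BA ab by (intro sum.cong refl) (simp add: A_def B_def)
    also have "\<dots> = (\<Sum>k\<in>?I. (\<Sum>l\<in>?I. A a l * B l k) * A k b)"
      by (simp add: sum_distrib_left sum_distrib_right mult.assoc) (rule sum.swap)
    also have "\<dots> = (\<Sum>k\<in>?I. (if a = k then c else 0) * A k b)"
      using AB ab by (intro sum.cong refl) (simp add: A_def B_def mat_mult_def)
    also have "\<dots> = c * A a b"
      using ab by (simp add: if_distrib[of "\<lambda>x. x * _"] cong: if_cong)
    finally show ?thesis unfolding K1[OF ab] A_def .
  qed
  let ?f = "\<lambda>i. hp i (point i) * hi i (point (Suc i))"
  have f1: "(\<Prod>i\<leftarrow>[1..<m + 1]. ?f i) =
      (\<Prod>i\<leftarrow>[1..<m + 1]. ser_frac (translate (of_nat i - 1) (h i)) (translate (of_nat i) (h i)))"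
    by (intro arg_cong[of _ _ prod_list] map_cong refl) (auto simp: ser_frac_def hp_def hi_def point_def)
  have f2: "(\<Prod>j\<leftarrow>[1..<r]. ?f (m + j)) = (\<Prod>j\<leftarrow>[1..<r]. ser_frac
            (translate (of_nat m - of_nat j + 1) (h (m + j)))
            (translate (of_nat m - of_nat j) (h (m + j))))" for r
  proof (intro arg_cong[of _ _ prod_list] map_cong refl)
    fix j assume "j \<in> set [1..<r]"
    \<comment> \<open>For \<open>j = 1\<close> the index is \<open>Suc m\<close>, where the rising
      and the falling branch of \<open>point\<close> agree.\<close>
    then have "point (m + j) = of_nat m - of_nat j + 1" "point (Suc (m + j)) = of_nat m - of_nat j"
      by (auto simp: point_def algebra_simps le_Suc_eq)
    then show "?f (m + j) = ser_frac (translate (of_nat m - of_nat j + 1) (h (m + j)))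
            (translate (of_nat m - of_nat j) (h (m + j)))"
      by (simp add: ser_frac_def hp_def hi_def)
  qed
  show ?thesis
  proof (intro conjI impI)
    assume n: "N = 2 * n + 1"
    have p: "?p = of_nat m - of_nat n + 1 / 2" "point (m + n + 1) = of_nat m - of_nat n"
      by (simp_all add: kappa_def point_def n field_simps)
    have "c = (\<Prod>i\<leftarrow>[1..<m + n + 1]. ?f i) * (hp (m + n + 1) ?p * hp (m + n + 1) (point (m + n + 1)))"
      by (rule gauss_chain_odd[OF gl cr n refl comm])
    then show "c = (\<Prod>i\<leftarrow>[1..<m + 1]. ser_frac (translate (of_nat i - 1) (h i)) (translate (of_nat i) (h i)))
        * (\<Prod>j\<leftarrow>[1..<n + 1]. ser_frac
            (translate (of_nat m - of_nat j + 1) (h (m + j)))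
            (translate (of_nat m - of_nat j) (h (m + j))))
        * (translate (of_nat m - of_nat n + 1 / 2) (h (m + n + 1))
            * translate (of_nat m - of_nat n) (h (m + n + 1)))"
      using prod_list_upt_split[of "n + 1" ?f m] unfolding p f1 f2 by (simp add: hp_def add.assoc del: upt_Suc)
  next
    assume n: "N = 2 * n"
    have n1: "1 \<le> n" using n N by (cases n) auto
    have p: "?p = of_nat m - of_nat n + 1" "point (m + n) = of_nat m - of_nat n + 1"
      using n1 by (auto simp: kappa_def point_def n field_simps le_Suc_eq)
    have "c = (\<Prod>i\<leftarrow>[1..<m + n]. ?f i) * (hp (m + n) (point (m + n)) * hp (m + n + 1) ?p)"
      by (rule gauss_chain_even[OF gl cr n n1])
    then show "c = (\<Prod>i\<leftarrow>[1..<m + 1]. ser_frac (translate (of_nat i - 1) (h i)) (translate (of_nat i) (h i)))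
        * (\<Prod>j\<leftarrow>[1..<n]. ser_frac
            (translate (of_nat m - of_nat j + 1) (h (m + j)))
            (translate (of_nat m - of_nat j) (h (m + j))))
        * (translate (of_nat m - of_nat n + 1) (h (m + n))
            * translate (of_nat m - of_nat n + 1) (h (m + n + 1)))"
      using prod_list_upt_split[OF n1, of ?f m] unfolding p f1 f2 by (simp add: hp_def del: upt_Suc)
  qed
qed

end
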